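(* Let $1<p<\infty$ and $q=p/(p-1)$. Let $(k_n)$ be a sequence in $H^q\setminus\{0\}$ with $k_n\to k$ in $H^q$, where $k\not\equiv 0$. Let $F_n$ be the $A^p$ extremal function for $k_n$ and $F$ the $A^p$ extremal function for $k$. Then $F_n$, $F\in H^p$ and $F_n\rightharpoonup F$ weakly in $H^p$. Moreover, if $k$ and all $k_n$ are polynomials, then $F_n\to F$ in the norm of $H^p$.
   Context: $\mathbb{D}$ is the open unit disc and $\sigma$ is normalized area measure on $\mathbb{D}$. For $1<p<\infty$, $A^p$ is the Bergman space of analytic $f$ on $\mathbb{D}$ with $\|f\|_{A^p}=(\int_{\mathbb{D}}|f|^p\,d\sigma)^{1/p}<\infty$, and $H^p$ is the Hardy space of analytic $f$ with $\|f\|_{H^p}=\sup_{0<r<1}(\frac1{2\pi}\int_0^{2\pi}|f(re^{i\theta})|^p d\theta)^{1/p}<\infty$ (note $H^q\subset A^q$). For $k\in A^q$, $k\not\equiv0$, the functional with kernel $k$ is $\phi(f)=\int_{\mathbb{D}} f\,\overline{k}\,d\sigma$ on $A^p$, with norm $\|\phi\|$ in $(A^p)^*$. The extremal function for $k$ is the unique $F\in A^p$ with $\|F\|_{A^p}=1$ and $\operatorname{Re}\phi(F)=\sup_{\|g\|_{A^p}=1}\operatorname{Re}\phi(g)=\|\phi\|$. *)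

theory Defs
  imports "HOL-Analysis.Analysis" "HOL-Computational_Algebra.Polynomial"
begin

definition disc :: "complex set" where
  "disc = ball 0 1"

definition in_Ap :: "real \<Rightarrow> (complex \<Rightarrow> complex) \<Rightarrow> bool" where
  "in_Ap p f \<longleftrightarrow> f holomorphic_on disc \<and>
     set_integrable lborel disc (\<lambda>z. norm (f z) powr p)"

definition Ap_norm :: "real \<Rightarrow> (complex \<Rightarrow> complex) \<Rightarrow> real" where
  "Ap_norm p f = ((1 / pi) * set_lebesgue_integral lborel disc (\<lambda>z. norm (f z) powr p)) powr (1 / p)"

definition Hp_mean :: "real \<Rightarrow> (complex \<Rightarrow> complex) \<Rightarrow> real \<Rightarrow> real" where
  "Hp_mean p f r = ((1 / (2 * pi)) * integral {0..2 * pi} (\<lambda>t. norm (f (of_real r * cis t)) powr p)) powr (1 / p)"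

definition in_Hp :: "real \<Rightarrow> (complex \<Rightarrow> complex) \<Rightarrow> bool" where
  "in_Hp p f \<longleftrightarrow> f holomorphic_on disc \<and> bdd_above (Hp_mean p f ` {0<..<1})"

definition Hp_norm :: "real \<Rightarrow> (complex \<Rightarrow> complex) \<Rightarrow> real" where
  "Hp_norm p f = (SUP r \<in> {0<..<1}. Hp_mean p f r)"

definition phi :: "(complex \<Rightarrow> complex) \<Rightarrow> (complex \<Rightarrow> complex) \<Rightarrow> complex" where
  "phi k f = of_real (1 / pi) * set_lebesgue_integral lborel disc (\<lambda>z. f z * cnj (k z))"

definition Ap_extremal :: "real \<Rightarrow> (complex \<Rightarrow> complex) \<Rightarrow> (complex \<Rightarrow> complex) \<Rightarrow> bool" where
  "Ap_extremal p k F \<longleftrightarrow> in_Ap p F \<and> Ap_norm p F = 1 \<and>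
     Re (phi k F) = (SUP g \<in> {g. in_Ap p g \<and> Ap_norm p g = 1}. Re (phi k g))"

definition Hp_bounded_functional :: "real \<Rightarrow> ((complex \<Rightarrow> complex) \<Rightarrow> complex) \<Rightarrow> bool" where
  "Hp_bounded_functional p L \<longleftrightarrow>
     (\<forall>f g a b. in_Hp p f \<longrightarrow> in_Hp p g \<longrightarrow> L (\<lambda>z. a * f z + b * g z) = a * L f + b * L g) \<and>
     (\<exists>C. \<forall>f. in_Hp p f \<longrightarrow> norm (L f) \<le> C * Hp_norm p f)"

definition Hp_weak_conv :: "real \<Rightarrow> (nat \<Rightarrow> complex \<Rightarrow> complex) \<Rightarrow> (complex \<Rightarrow> complex) \<Rightarrow> bool" where
  "Hp_weak_conv p G g \<longleftrightarrow>
     (\<forall>L. Hp_bounded_functional p L \<longrightarrow> (\<lambda>n. L (G n)) \<longlonglongrightarrow> L g)"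

definition is_poly_on_disc :: "(complex \<Rightarrow> complex) \<Rightarrow> bool" where
  "is_poly_on_disc f \<longleftrightarrow> (\<exists>P :: complex poly. \<forall>z\<in>disc. f z = poly P z)"

end

theory Submission
  imports Defs "HOL-Complex_Analysis.Complex_Analysis"
begin

text \<open>
  Comparing an extremal function \<open>F\<close> with its dilates \<open>F\<^sub>r(z) = F(rz)\<close> gives
  \<open>\<integral> \<bar>F\<^sub>r\<bar>\<^sup>p \<ge> 1 + p (Re \<phi>(F\<^sub>r) / \<parallel>\<phi>\<parallel> - 1)\<close>. Dilations are self-adjoint for the area pairing, so
  \<open>\<phi>(F) - \<phi>(F\<^sub>r)\<close> is, up to a harmless term, an integral of \<open>F\<close> times the conjugate of \<open>k\<close> over the thin
  annulus \<open>\<surd>r \<le> \<bar>z\<bar> < 1\<close>. Hoelder's inequality there bounds the average \<open>A\<close> of \<open>\<bar>F\<bar>\<^sup>p\<close> over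
  \<open>r \<le> \<bar>z\<bar> < 1\<close> by \<open>1 + C (A\<^sup>1\<^sup>/\<^sup>p + 4)\<close>; as integral means increase, \<open>F\<close> lies in \<open>H\<^sup>p\<close> with a bound
  that is uniform along the sequence.

  Uniform convexity gives \<open>F\<^sub>n \<rightarrow> F\<close> in \<open>A\<^sup>p\<close>, and a bounded sequence of \<open>H\<^sup>p\<close> whose means on every
  circle tend to \<open>0\<close> is weakly null. For polynomial \<open>k\<close> the same comparison gives
  \<open>limsup \<parallel>F\<^sub>n\<parallel>\<^sup>p \<le> 1 + (p / 2\<parallel>\<phi>\<parallel>) Re \<Lambda>\<close> with \<open>\<Lambda>\<close> the derivative of \<open>u \<mapsto> \<phi>(F\<^sub>u)\<close> at \<open>u = 1\<close>.
  Conversely, for \<open>\<bar>u\<bar> = 1\<close> uniform convexity bounds \<open>\<integral> (\<bar>F\<bar> + \<bar>F\<^sub>u\<bar>)\<^sup>p\<^sup>-\<^sup>2 \<bar>F - F\<^sub>u\<bar>\<^sup>2\<close> by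
  \<open>C \<bar>u - 1\<bar>\<^sup>2\<close>; this is enough regularity to pass to the limit in the Euler-Lagrange equation tested
  with \<open>(F\<^sub>u - F) / (u - 1)\<close>, and shows that the right-hand side is at most \<open>\<parallel>F\<parallel>\<^sup>p\<close>. Norm convergence
  then follows from uniform convexity.
\<close>

section \<open>Convexity of powers of the modulus\<close>

text \<open>Boundary values never enter: the argument works with p-th powers of integral means on
  circles inside the disc and with area integrals, linked by the measure 1 - r^2 of the annulus r <=
  |z| < 1. Uniform convexity is kept as an inequality linear in p-th powers, so the same pointwise
  statement integrates over the disc and over circles. The obstacle for norm convergence is that the
  natural test function z F' is not known to lie in A^p, so the Euler-Lagrange equation cannot be
  tested with it. Rotations supply the difference quotients because they preserve the A^p norm and
  come in conjugate pairs, which makes the defect of the midpoint of F and F_u second order in u -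
  1. The weight (|F| + |F_u|)^(p-2) is the one that pointwise uniform convexity yields for p below
  and above 2 alike. Polynomial k matters because u -> phi(F_u) is then a polynomial, whose
  derivative at 1 is a finite combination of pairings with monomials and so passes to the limit
  under A^p convergence.\<close>

lemma powr_tangent:
  fixes p x y :: real
  assumes "1 \<le> p" "0 \<le> x" "0 \<le> y"
  shows "x powr p + p * x powr (p - 1) * (y - x) \<le> y powr p"
proof (cases "p = 1 \<or> x = 0")
  case True
  then show ?thesis using assms by (cases "x = 0") auto
next
  case False
  then have p: "1 < p" "0 < x" using assms by auto
  have "y * x powr (p - 1) \<le> y powr p / p + (x powr (p - 1)) powr (p / (p - 1)) / (p / (p - 1))"
    using p assms by (intro Youngs_inequality) (auto simp: field_simps)
  also have "(x powr (p - 1)) powr (p / (p - 1)) = x powr p"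
    using p by (simp add: powr_powr)
  finally have "p * (y * x powr (p - 1)) \<le> p * (y powr p / p + x powr p / (p / (p - 1)))"
    using p by (intro mult_left_mono) auto
  also have "\<dots> = y powr p + (p - 1) * x powr p" using p by (simp add: field_simps)
  also have "x powr p = x * x powr (p - 1)" using p by (simp add: powr_mult_base)
  finally show ?thesis using powr_mult_base[of x "p - 1"] p by (simp add: algebra_simps)
qed

text \<open>Young's inequality with exponents 1/a and 1/(1-a). It serves p < 2, where the power p/2
  of a squared modulus is concave.\<close>

lemma powr_tangent_concave:
  fixes a u v :: real
  assumes "0 < a" "a < 1" "0 < u" "0 \<le> v"
  shows "v powr a \<le> u powr a + a * u powr (a - 1) * (v - u)"
proof -
  have "(v powr a) * u powr (1 - a) \<le> (v powr a) powr (1 / a) / (1 / a)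
      + (u powr (1 - a)) powr (1 / (1 - a)) / (1 / (1 - a))"
    using assms by (intro Youngs_inequality) (auto simp: field_simps)
  also have "\<dots> = a * v + (1 - a) * u"
    using assms by (simp add: powr_powr field_simps)
  finally have "(v powr a * u powr (1 - a)) * u powr (a - 1) \<le> (a * v + (1 - a) * u) * u powr (a - 1)"
    by (intro mult_right_mono) auto
  moreover have "u powr (1 - a) * u powr (a - 1) = 1"
    using assms by (simp flip: powr_add)
  moreover have "u powr a = u * u powr (a - 1)" using assms by (simp add: powr_mult_base)
  ultimately show ?thesis by (simp add: algebra_simps)
qed

text \<open>The gradient of |a|^p / p for the real pairing Re (x * y); its modulus |a|^(p-1) puts
  \<open>dual_unit p (f z)\<close> in L^q whenever f is in L^p. The factor \<open>cnj a\<close>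
  gives the value 0 at 0 also for p < 2.\<close>

definition dual_unit :: "real \<Rightarrow> complex \<Rightarrow> complex" where
  "dual_unit p a = of_real (norm a powr (p - 2)) * cnj a"

lemma norm_dual_unit: "norm (dual_unit p a) = norm a powr (p - 1)"
proof (cases "a = 0")
  case False
  then have "norm a powr (p - 2) * norm a = norm a powr (p - 1)"
    using powr_mult_base[of "norm a" "p - 2"] by (simp add: algebra_simps)
  then show ?thesis by (simp add: dual_unit_def norm_mult)
qed (simp add: dual_unit_def)

lemma dual_unit_mult_self: "dual_unit p a * a = of_real (norm a powr p)"
proof (cases "a = 0")
  case False
  have "cnj a * a = of_real ((norm a)\<^sup>2)" by (metis complex_norm_square mult.commute of_real_power)
  then have "dual_unit p a * a = of_real (norm a powr (p - 2) * (norm a)\<^sup>2)"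
    by (simp add: dual_unit_def mult.assoc)
  also have "norm a powr (p - 2) * (norm a)\<^sup>2 = norm a powr p"
    using False by (simp add: powr_diff powr_numeral)
  finally show ?thesis .
qed (simp add: dual_unit_def)

lemma norm_powr_tangent:
  assumes "1 \<le> p"
  shows "norm a powr p + p * Re (dual_unit p a * (b - a)) \<le> norm b powr p"
proof -
  have "Re (dual_unit p a * b) \<le> norm a powr (p - 1) * norm b"
    using complex_Re_le_cmod[of "dual_unit p a * b"] by (simp add: norm_mult norm_dual_unit)
  moreover have "Re (dual_unit p a * a) = norm a powr (p - 1) * norm a"
    unfolding dual_unit_mult_self using powr_mult_base[of "norm a" "p - 1"] by (simp add: mult.commute)
  ultimately have "Re (dual_unit p a * (b - a)) \<le> norm a powr (p - 1) * (norm b - norm a)"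
    by (simp add: algebra_simps)
  then have "p * Re (dual_unit p a * (b - a)) \<le> p * norm a powr (p - 1) * (norm b - norm a)"
    using assms by (simp add: mult.assoc mult_left_mono)
  with powr_tangent[OF assms, of "norm a" "norm b"] show ?thesis by simp
qed

lemma continuous_on_norm_powr [continuous_intros]:
  fixes f :: "'a::topological_space \<Rightarrow> complex"
  assumes "continuous_on A f" "0 < p"
  shows "continuous_on A (\<lambda>x. norm (f x) powr p)"
  using assms by (intro continuous_on_powr') (auto intro: continuous_intros)

lemma isCont_dual_unit:
  assumes "1 < p" shows "isCont (dual_unit p) a"
proof (cases "a = 0")
  case True
  have "((\<lambda>x::complex. norm x powr (p - 1)) \<longlongrightarrow> norm (0::complex) powr (p - 1)) (at 0)"
    using assms continuous_on_norm_powr[OF continuous_on_id, of "p - 1" UNIV]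
    by (intro isContD) (simp add: continuous_on_eq_continuous_at)
  then have "((\<lambda>x. norm (dual_unit p x)) \<longlongrightarrow> 0) (at 0)" by (simp add: norm_dual_unit)
  from tendsto_norm_zero_cancel[OF this] show ?thesis
    using True by (simp add: isCont_def dual_unit_def[of p 0])
next
  case False
  then show ?thesis unfolding dual_unit_def
    by (intro continuous_intros) (auto intro!: continuous_intros)
qed

lemma continuous_on_dual_unit [continuous_intros]:
  assumes "1 < p" "continuous_on A f" shows "continuous_on A (\<lambda>x. dual_unit p (f x))"
  using continuous_on_compose2[OF continuous_at_imp_continuous_on[of UNIV "dual_unit p"] assms(2)]
    isCont_dual_unit[OF assms(1)] by auto

text \<open>For p < 2 the second derivative p(p-1) t^(p-2) is smallest at the right end of (0, x +
  y], so t^p - c t^2 is convex there with c half that minimum. The midpoint gap of c t^2 is c (x -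
  y)^2 / 4, whence the 8.\<close>

lemma real_powr_midpoint_lt2:
  fixes p x y :: real
  assumes p: "1 < p" "p < 2" and xy: "0 \<le> x" "0 \<le> y" "0 < x + y"
  shows "p * (p - 1) / 8 * (x + y) powr (p - 2) * (x - y)\<^sup>2
      \<le> (x powr p + y powr p) / 2 - ((x + y) / 2) powr p"
proof -
  have pos: "p * (p - 1) / 8 * (x + y) powr (p - 2) * (x - y)\<^sup>2
      \<le> (x powr p + y powr p) / 2 - ((x + y) / 2) powr p" if "0 < x" "0 < y" for x y :: real
  proof -
    define c where "c = p * (p - 1) / 2 * (x + y) powr (p - 2)"
    have "convex_on {0<..x + y} (\<lambda>t. t powr p - c * t\<^sup>2)"
    proof (rule f''_ge0_imp_convex)
      fix t assume t: "t \<in> {0<..x + y}"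
      show "DERIV (\<lambda>t. t powr p - c * t\<^sup>2) t :> p * t powr (p - 1) - c * (2 * t)"
        using t by (auto intro!: derivative_eq_intros)
      show "DERIV (\<lambda>t. p * t powr (p - 1) - c * (2 * t)) t :> p * ((p - 1) * t powr (p - 2)) - 2 * c"
        using t by (auto intro!: derivative_eq_intros)
      have "(x + y) powr (p - 2) \<le> t powr (p - 2)"
        using t p by (intro powr_mono2') auto
      then have "p * (p - 1) * (x + y) powr (p - 2) \<le> p * (p - 1) * t powr (p - 2)"
        using p by (intro mult_left_mono) auto
      then show "0 \<le> p * ((p - 1) * t powr (p - 2)) - 2 * c"
        by (simp add: c_def mult.assoc)
    qed simp
    from convex_onD[OF this, of "1/2" x y] that
    have "((x + y) / 2) powr p - c * ((x + y) / 2)\<^sup>2 \<le> (x powr p - c * x\<^sup>2) / 2 + (y powr p - c * y\<^sup>2) / 2"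
      by (simp add: field_simps)
    moreover have "c * ((x + y) / 2)\<^sup>2 = c * x\<^sup>2 / 2 + c * y\<^sup>2 / 2 - c / 4 * (x - y)\<^sup>2"
      by (simp add: field_simps power2_eq_square)
    ultimately have "c / 4 * (x - y)\<^sup>2 \<le> (x powr p + y powr p) / 2 - ((x + y) / 2) powr p"
      by (simp add: diff_divide_distrib add_divide_distrib)
    then show ?thesis by (simp add: c_def)
  qed
  \<comment> \<open>The differentiation argument needs positive numbers; shifting both by 1/(n+1)
    and passing to the limit admits x = 0 or y = 0.\<close>
  let ?X = "\<lambda>n. x + inverse (real (Suc n))" and ?Y = "\<lambda>n. y + inverse (real (Suc n))"
  have X: "?X \<longlonglongrightarrow> x" and Y: "?Y \<longlonglongrightarrow> y"
    using LIMSEQ_inverse_real_of_nat_add by auto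
  show ?thesis
  proof (rule LIMSEQ_le)
    show "(\<lambda>n. p * (p - 1) / 8 * (?X n + ?Y n) powr (p - 2) * (?X n - ?Y n)\<^sup>2)
       \<longlonglongrightarrow> p * (p - 1) / 8 * (x + y) powr (p - 2) * (x - y)\<^sup>2"
      using xy by (intro tendsto_intros X Y) auto
    show "(\<lambda>n. (?X n powr p + ?Y n powr p) / 2 - ((?X n + ?Y n) / 2) powr p)
       \<longlonglongrightarrow> (x powr p + y powr p) / 2 - ((x + y) / 2) powr p"
      using xy p by (intro tendsto_intros X Y tendsto_powr') (auto intro!: always_eventually add_nonneg_nonneg)
    show "\<exists>N. \<forall>n\<ge>N. p * (p - 1) / 8 * (?X n + ?Y n) powr (p - 2) * (?X n - ?Y n)\<^sup>2
        \<le> (?X n powr p + ?Y n powr p) / 2 - ((?X n + ?Y n) / 2) powr p"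
      using xy by (intro exI allI impI pos) (auto intro!: add_nonneg_pos)
  qed
qed

lemma powr_half_square: "0 \<le> x \<Longrightarrow> (x\<^sup>2) powr (p / 2) = x powr p" for x :: real
  by (cases "x = 0") (simp_all add: powr_powr flip: powr_numeral)

text \<open>With S the mean of |a|^2 and |b|^2 and v = |(a+b)/2|^2, the parallelogram law gives S -
  v = |a-b|^2 / 4. For p >= 2 convexity of t^(p/2) compares S and v directly. For p < 2 that
  function is concave, and S - v is split at u = ((|a|+|b|)/2)^2 into a radial part, handled by the
  real inequality, and an angular part, handled by the tangent at u.\<close>

lemma uniform_convexity_quadratic:
  assumes p: "1 < p"
  shows "\<exists>c>0. \<forall>a b :: complex. c * ((norm a + norm b) powr (p - 2) * (norm (a - b))\<^sup>2)
      \<le> (norm a powr p + norm b powr p) / 2 - norm ((a + b) / 2) powr p"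
proof -
  \<comment> \<open>The factor 1/4 of the parallelogram law meets p(p-1)/2 in one case and the
    (1/2)^(p-2) from ((x+y)/2)^(p-2) in the other.\<close>
  define c where "c = (if p < 2 then p * (p - 1) / 8 else (1/2) powr (p - 2) / 4)"
  have "c * ((norm a + norm b) powr (p - 2) * (norm (a - b))\<^sup>2)
      \<le> (norm a powr p + norm b powr p) / 2 - norm ((a + b) / 2) powr p" for a b :: complex
  proof (cases "a = 0 \<and> b = 0")
    case False
    define x y where "x = norm a" and "y = norm b"
    have xy: "0 \<le> x" "0 \<le> y" "0 < x + y"
      using False by (auto simp: x_def y_def add_nonneg_pos add_pos_nonneg)
    define S where "S = (x\<^sup>2 + y\<^sup>2) / 2"
    define u where "u = ((x + y) / 2)\<^sup>2"
    define v where "v = (norm ((a + b) / 2))\<^sup>2"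
    define d where "d = (norm (a - b))\<^sup>2 / 4"
    have Sv: "S - v = d"
      unfolding S_def v_def d_def x_def y_def
      using cmod_power2[of a] cmod_power2[of b] cmod_power2[of "(a + b)/2"] cmod_power2[of "a - b"]
      by (simp add: field_simps power2_eq_square)
    have Su: "S - u = (x - y)\<^sup>2 / 4"
      by (simp add: S_def u_def field_simps power2_eq_square)
    have uS: "u \<le> S" using Su by (metis diff_ge_0_iff_ge divide_nonneg_pos zero_le_power2 zero_less_numeral)
    have vu: "v \<le> u" unfolding v_def u_def using norm_triangle_ineq[of a b]
      by (intro power_mono) (auto simp: x_def y_def norm_divide)
    have v0: "0 \<le> v" and u0: "0 < u" using xy by (auto simp: v_def u_def)
    have vp: "norm ((a + b) / 2) powr p = v powr (p / 2)"
      unfolding v_def by (simp add: powr_half_square)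
    have up: "u powr (p / 2) = ((x + y) / 2) powr p" using xy by (simp add: u_def powr_half_square)
    have "u powr (p / 2 - 1) = (((x + y) / 2)\<^sup>2) powr ((p - 2) / 2)"
      unfolding u_def by (simp add: diff_divide_distrib)
    then have up1: "u powr (p / 2 - 1) = ((x + y) / 2) powr (p - 2)"
      using xy by (simp add: powr_half_square)
    show ?thesis
    proof (cases "p < 2")
      case True
      have 1: "p * (p - 1) / 8 * (x + y) powr (p - 2) * (x - y)\<^sup>2
          \<le> (x powr p + y powr p) / 2 - u powr (p / 2)"
        unfolding up using p True xy by (intro real_powr_midpoint_lt2)
      \<comment> \<open>The angular estimate holds with a larger constant; p - 1 < 1 and the
        negative exponent p - 2 weaken it to the constant of the radial one, so that the two add up
        to a multiple of S - v.\<close>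
      have "(p - 1) * (x + y) powr (p - 2) \<le> 1 * (x + y) powr (p - 2)"
        using p True by (intro mult_right_mono) auto
      also have "\<dots> \<le> ((x + y) / 2) powr (p - 2)"
        using True xy by (simp add: powr_mono2')
      finally have "p / 2 * ((p - 1) * (x + y) powr (p - 2)) * (u - v)
           \<le> p / 2 * ((x + y) / 2) powr (p - 2) * (u - v)"
        using p vu by (intro mult_right_mono mult_left_mono) auto
      also have "\<dots> \<le> u powr (p / 2) - v powr (p / 2)"
        using powr_tangent_concave[of "p / 2" u v] p True u0 v0 unfolding up1
        by (simp add: right_diff_distrib)
      finally have 2: "p / 2 * ((p - 1) * (x + y) powr (p - 2)) * (u - v) \<le> u powr (p / 2) - v powr (p / 2)" .
      have S: "S - v = (x - y)\<^sup>2 / 4 + (u - v)" using Su by linarith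
      have "p * (p - 1) / 2 * (x + y) powr (p - 2) * (S - v) =
          p * (p - 1) / 8 * (x + y) powr (p - 2) * (x - y)\<^sup>2 + p / 2 * ((p - 1) * (x + y) powr (p - 2)) * (u - v)"
        unfolding S by (simp add: field_simps)
      also have "\<dots> \<le> (x powr p + y powr p) / 2 - v powr (p / 2)" using 1 2 by linarith
      finally have "p * (p - 1) / 2 * (x + y) powr (p - 2) * (S - v)
          \<le> (x powr p + y powr p) / 2 - v powr (p / 2)" .
      then show ?thesis unfolding vp Sv using True
        by (simp add: c_def d_def x_def y_def field_simps)
    next
      case False
      have S0: "0 < S" using u0 uS by linarith
      \<comment> \<open>The tangent of s^(p/2) at S, evaluated at t^2: averaging over t = x and t =
        y removes the linear term, because S is the mean of x^2 and y^2.\<close>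
      have t: "S powr (p/2) + p / 2 * S powr (p / 2 - 1) * (t\<^sup>2 - S) \<le> t powr p" if "0 \<le> t" for t
        using powr_tangent[of "p / 2" S "t\<^sup>2"] False S0 that by (simp add: powr_half_square)
      have "(x powr p + y powr p) / 2 \<ge> S powr (p/2) + p / 4 * S powr (p / 2 - 1) * (x\<^sup>2 + y\<^sup>2 - 2 * S)"
        using t[OF xy(1)] t[OF xy(2)] by (simp add: field_simps)
      moreover have "x\<^sup>2 + y\<^sup>2 - 2 * S = 0" by (simp add: S_def)
      ultimately have 1: "S powr (p/2) \<le> (x powr p + y powr p) / 2" by simp
      have "v powr (p / 2) = v powr (p / 2 - 1) * v" 
        using v0 powr_mult_base[of v "p / 2 - 1"] by (simp add: mult.commute)
      also have "\<dots> \<le> S powr (p / 2 - 1) * v"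
        using False v0 vu uS by (intro mult_right_mono powr_mono2) auto
      finally have "S powr (p / 2 - 1) * (S - v) \<le> S powr (p/2) - v powr (p / 2)"
        using S0 powr_mult_base[of S "p / 2 - 1"] by (simp add: algebra_simps)
      moreover have "u powr (p / 2 - 1) * (S - v) \<le> S powr (p / 2 - 1) * (S - v)"
        using False u0 uS vu by (intro mult_right_mono powr_mono2) auto
      ultimately have "((x + y) / 2) powr (p - 2) * d \<le> (x powr p + y powr p) / 2 - v powr (p / 2)"
        using 1 unfolding up1 Sv by linarith
      moreover have "((x + y) / 2) powr (p - 2) = (1/2) powr (p - 2) * (x + y) powr (p - 2)"
        using xy by (simp add: powr_divide)
      ultimately show ?thesis unfolding vp using False
        by (simp add: c_def d_def x_def y_def algebra_simps)
    qed
  qed auto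
  moreover have "c > 0" using p by (auto simp: c_def)
  ultimately show ?thesis by blast
qed

text \<open>For p >= 2 the bound |a-b| <= |a|+|b| suffices. For p < 2 the weight has a negative
  exponent: either |a-b| is below h (|a|+|b|) with h^p = e and the first term wins, or it is above
  and the second does.\<close>

lemma norm_powr_diff_le:
  assumes p: "1 < p" and e: "0 < e"
  shows "\<exists>K>0. \<forall>a b :: complex. norm (a - b) powr p
      \<le> e * (norm a + norm b) powr p + K * ((norm a + norm b) powr (p - 2) * (norm (a - b))\<^sup>2)"
proof (cases "p \<ge> 2")
  case True
  have "norm (a - b) powr p \<le> e * (norm a + norm b) powr p + 1 * ((norm a + norm b) powr (p - 2) * (norm (a - b))\<^sup>2)"
    for a b :: complex
  proof (cases "a = b")
    case False
    have "norm (a - b) powr p = norm (a - b) powr (p - 2) * (norm (a - b))\<^sup>2"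
      using False by (simp add: powr_diff powr_numeral)
    also have "\<dots> \<le> (norm a + norm b) powr (p - 2) * (norm (a - b))\<^sup>2"
      using True norm_triangle_ineq4[of a b] by (intro mult_right_mono powr_mono2) auto
    finally show ?thesis using e by (simp add: add_increasing)
  qed (use e in auto)
  then show ?thesis by (intro exI[of _ 1]) auto
next
  case False
  define h where "h = e powr (1 / p)"
  have h: "0 < h" "h powr p = e" using e p by (auto simp: h_def powr_powr)
  have "norm (a - b) powr p \<le> e * (norm a + norm b) powr p
      + h powr (p - 2) * ((norm a + norm b) powr (p - 2) * (norm (a - b))\<^sup>2)"
    for a b :: complex
  proof (cases "norm (a - b) \<le> h * (norm a + norm b)")
    case True
    then have "norm (a - b) powr p \<le> (h * (norm a + norm b)) powr p"
      using p by (intro powr_mono2) auto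
    also have "\<dots> = e * (norm a + norm b) powr p" using h by (simp add: powr_mult)
    finally show ?thesis by (simp add: add_increasing2)
  next
    case c: False
    then have ab: "a \<noteq> b" using h by (auto simp: mult_less_0_iff not_le)
    then have "0 < norm (a - b)" by simp
    then have s: "0 < norm a + norm b" using norm_triangle_ineq4[of a b] by linarith
    have "norm (a - b) powr p = norm (a - b) powr (p - 2) * (norm (a - b))\<^sup>2"
      using ab by (simp add: powr_diff powr_numeral)
    also have "\<dots> \<le> (h * (norm a + norm b)) powr (p - 2) * (norm (a - b))\<^sup>2"
      using False c s h by (intro mult_right_mono powr_mono2') auto
    also have "\<dots> = h powr (p - 2) * ((norm a + norm b) powr (p - 2) * (norm (a - b))\<^sup>2)"
      using h s by (simp add: powr_mult)
    finally show ?thesis using e by (simp add: add_increasing)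
  qed
  moreover have "0 < h powr (p - 2)" using h by simp
  ultimately show ?thesis by blast
qed

lemma powr_add_le:
  fixes x y p :: real
  assumes "1 \<le> p" "0 \<le> x" "0 \<le> y"
  shows "(x + y) powr p \<le> 2 powr (p - 1) * (x powr p + y powr p)"
proof -
  define m where "m = (x + y) / 2"
  have m: "m powr p \<le> (x powr p + y powr p) / 2"
    using powr_tangent[OF assms(1), of m x] powr_tangent[OF assms(1), of m y] assms
    by (simp add: m_def field_simps)
  have "(x + y) powr p = 2 powr p * m powr p"
    using assms by (simp add: m_def powr_divide)
  also have "\<dots> \<le> 2 powr p * ((x powr p + y powr p) / 2)" using m by (intro mult_left_mono) auto
  also have "\<dots> = 2 powr (p - 1) * (x powr p + y powr p)" by (simp add: powr_diff)
  finally show ?thesis .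
qed

text \<open>Since the right-hand side is linear in |a|^p, |b|^p and |(a+b)/2|^p, integration
  preserves it, and every uniform convexity argument below is an instance for some measure. The
  price is the small term with e, which stays fixed while the convexity gap is made small.\<close>

lemma uniform_convexity:
  assumes p: "1 < p" and e: "0 < e"
  shows "\<exists>K>0. \<forall>a b :: complex. norm (a - b) powr p
      \<le> e * (norm a powr p + norm b powr p)
        + K * ((norm a powr p + norm b powr p) / 2 - norm ((a + b) / 2) powr p)"
proof -
  obtain c where c: "c > 0" "\<And>a b :: complex. c * ((norm a + norm b) powr (p - 2) * (norm (a - b))\<^sup>2)
      \<le> (norm a powr p + norm b powr p) / 2 - norm ((a + b) / 2) powr p"
    using uniform_convexity_quadratic[OF p] by blast
  obtain K where K: "K > 0" "\<And>a b :: complex. norm (a - b) powr p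
      \<le> e / 2 powr (p - 1) * (norm a + norm b) powr p + K * ((norm a + norm b) powr (p - 2) * (norm (a - b))\<^sup>2)"
    using norm_powr_diff_le[OF p, of "e / 2 powr (p - 1)"] e by auto
  have "norm (a - b) powr p \<le> e * (norm a powr p + norm b powr p)
        + K / c * ((norm a powr p + norm b powr p) / 2 - norm ((a + b) / 2) powr p)" for a b :: complex
  proof -
    have "e / 2 powr (p - 1) * (norm a + norm b) powr p
        \<le> e / 2 powr (p - 1) * (2 powr (p - 1) * (norm a powr p + norm b powr p))"
      using p e by (intro mult_left_mono powr_add_le) auto
    moreover have "K / c * (c * ((norm a + norm b) powr (p - 2) * (norm (a - b))\<^sup>2)) \<le>
        K / c * ((norm a powr p + norm b powr p) / 2 - norm ((a + b) / 2) powr p)"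
      using c K by (intro mult_left_mono) auto
    ultimately show ?thesis using K(2)[of a b] c(1) by simp
  qed
  then show ?thesis using c(1) K(1) by (intro exI[of _ "K / c"]) auto
qed

text \<open>Convexity of the p-th power applied to |a| <= t (|b|/t) + (1-t) (|a-b|/(1-t)).\<close>

lemma norm_powr_perturb:
  assumes p: "1 < p" and e: "0 < e"
  shows "\<exists>K>0. \<forall>a b :: complex. norm a powr p \<le> (1 + e) * norm b powr p + K * norm (a - b) powr p"
proof -
  \<comment> \<open>Chosen so that t^(1-p) = 1 + e, the factor in front of |b|^p.\<close>
  define t where "t = (1 + e) powr (1 / (1 - p))"
  have "(1 + e) powr (1 / (1 - p)) < (1 + e) powr 0"
    using p e by (intro powr_less_mono) auto
  then have t: "0 < t" "t < 1" using e by (auto simp: t_def)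
  have te: "t powr (1 - p) = 1 + e" using p e by (simp add: t_def powr_powr)
  have "norm a powr p \<le> (1 + e) * norm b powr p + (1 - t) powr (1 - p) * norm (a - b) powr p" for a b :: complex
  proof -
    define X Y where "X = norm b / t" and "Y = norm (a - b) / (1 - t)"
    define m where "m = t * X + (1 - t) * Y"
    have XY: "0 \<le> X" "0 \<le> Y" "0 \<le> m" using t by (auto simp: X_def Y_def m_def)
    have "norm a \<le> m" using t norm_triangle_sub[of a b] by (simp add: m_def X_def Y_def)
    then have "norm a powr p \<le> m powr p" using p by (intro powr_mono2) auto
    also have "m powr p = t * (m powr p + p * m powr (p - 1) * (X - m)) + (1 - t) * (m powr p + p * m powr (p - 1) * (Y - m))"
      unfolding m_def by (simp add: algebra_simps)
    also have "\<dots> \<le> t * X powr p + (1 - t) * Y powr p"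
      using t p XY by (intro add_mono mult_left_mono powr_tangent) auto
    also have "t * X powr p = (1 + e) * norm b powr p"
      using t te[symmetric] by (simp add: X_def powr_divide powr_diff)
    also have "(1 - t) * Y powr p = (1 - t) powr (1 - p) * norm (a - b) powr p"
      using t by (simp add: Y_def powr_divide powr_diff)
    finally show ?thesis .
  qed
  moreover have "(1 - t) powr (1 - p) > 0" using t by simp
  ultimately show ?thesis by blast
qed

section \<open>Area measure on the disc\<close>

lemma ball_borel [measurable, simp]: "ball (0::complex) s \<in> sets borel"
  by (intro borel_open) simp

lemma integrable_scaleR_iff:
  "c \<noteq> 0 \<Longrightarrow> integrable M (\<lambda>x. c *\<^sub>R f x) \<longleftrightarrow> integrable M f"
  for f :: "'a \<Rightarrow> 'b::{banach, second_countable_topology}"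
  using integrable_scaleR_right[of "1 / c" M "\<lambda>x. c *\<^sub>R f x"] by auto

section \<open>Invariance of planar Lebesgue measure\<close>

lemma nn_integral_lborel_translate:
  fixes c :: "'a::euclidean_space" and f :: "'a \<Rightarrow> ennreal"
  assumes [measurable]: "f \<in> borel_measurable borel"
  shows "(\<integral>\<^sup>+x. f (c + x) \<partial>lborel) = (\<integral>\<^sup>+x. f x \<partial>lborel)"
proof -
  have "(\<integral>\<^sup>+x. f x \<partial>lborel) = (\<integral>\<^sup>+x. f x \<partial>distr lborel borel ((+) c))"
    by (simp add: lborel_distr_plus)
  also have "\<dots> = (\<integral>\<^sup>+x. f (c + x) \<partial>lborel)" by (simp add: nn_integral_distr)
  finally show ?thesis ..
qed

lemma nn_integral_lborel_reflect:
  fixes c :: complex and f :: "complex \<Rightarrow> ennreal"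
  assumes [measurable]: "f \<in> borel_measurable borel"
  shows "(\<integral>\<^sup>+x. f (c - x) \<partial>lborel) = (\<integral>\<^sup>+x. f x \<partial>lborel)"
proof -
  have L: "lborel = density (distr lborel borel (\<lambda>x. c - x)) (\<lambda>_. 1)"
    using lborel_affine[of "-1" c] by simp
  show ?thesis by (subst (2) L) (simp add: nn_integral_distr nn_integral_density)
qed

text \<open>Uniqueness of a translation invariant measure, specialised to the image of Lebesgue measure
  under the rotation: both sides are compared on the rotation invariant unit disc.\<close>

lemma nn_integral_lborel_rotate:
  fixes u :: complex and f :: "complex \<Rightarrow> ennreal"
  assumes u: "norm u = 1" and [measurable]: "f \<in> borel_measurable borel"
  shows "(\<integral>\<^sup>+x. f (u * x) \<partial>lborel) = (\<integral>\<^sup>+x. f x \<partial>lborel)"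
proof -
  have L: "pair_sigma_finite (lborel :: complex measure) (lborel :: complex measure)"
    by (simp add: pair_sigma_finite_def sigma_finite_lborel)
  define g :: "complex \<Rightarrow> ennreal" where "g = indicator (ball 0 1)"
  have [measurable]: "g \<in> borel_measurable borel" unfolding g_def by (intro borel_measurable_indicator) simp
  have uu: "u * (- cnj u * y + x) = u * x - y" for x y
  proof -
    have "u * cnj u = 1" using u by (simp add: complex_norm_square[symmetric])
    moreover have "u * (- cnj u * y + x) = u * x - (u * cnj u) * y" by (simp add: algebra_simps)
    ultimately show ?thesis by simp
  qed
  have gu: "g (u * x) = g x" for x using u by (simp add: g_def indicator_def norm_mult)
  have "(\<integral>\<^sup>+x. f (u * x) \<partial>lborel) * (\<integral>\<^sup>+y. g y \<partial>lborel)
      = (\<integral>\<^sup>+x. (\<integral>\<^sup>+y. f (u * x) * g y \<partial>lborel) \<partial>lborel)"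
    by (simp add: nn_integral_cmult nn_integral_multc)
  also have "\<dots> = (\<integral>\<^sup>+x. (\<integral>\<^sup>+y. f (u * x) * g (u * x + y) \<partial>lborel) \<partial>lborel)"
    by (intro nn_integral_cong nn_integral_lborel_translate[symmetric]) simp
  also have "\<dots> = (\<integral>\<^sup>+y. (\<integral>\<^sup>+x. f (u * x) * g (u * x + y) \<partial>lborel) \<partial>lborel)"
    by (intro pair_sigma_finite.Fubini'[OF L, symmetric]) (simp add: split_beta')
  \<comment> \<open>Translating x by - conj(u) y changes u x into u x - y, so that the factor g
    loses its dependence on y and, by rotation invariance of g, on u.\<close>
  also have "\<dots> = (\<integral>\<^sup>+y. (\<integral>\<^sup>+x. f (u * (- cnj u * y + x)) * g (u * (- cnj u * y + x) + y) \<partial>lborel) \<partial>lborel)"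
    by (intro nn_integral_cong nn_integral_lborel_translate[symmetric]) simp
  also have "\<dots> = (\<integral>\<^sup>+y. (\<integral>\<^sup>+x. f (u * x - y) * g x \<partial>lborel) \<partial>lborel)"
    unfolding uu by (simp add: gu)
  also have "\<dots> = (\<integral>\<^sup>+x. (\<integral>\<^sup>+y. f (u * x - y) * g x \<partial>lborel) \<partial>lborel)"
    by (intro pair_sigma_finite.Fubini'[OF L]) (simp add: split_beta')
  also have "\<dots> = (\<integral>\<^sup>+x. (\<integral>\<^sup>+y. f y * g x \<partial>lborel) \<partial>lborel)"
    by (intro nn_integral_cong nn_integral_lborel_reflect) simp
  also have "\<dots> = (\<integral>\<^sup>+x. f x \<partial>lborel) * (\<integral>\<^sup>+y. g y \<partial>lborel)"
    by (simp add: nn_integral_cmult nn_integral_multc)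
  finally have "(\<integral>\<^sup>+x. f (u * x) \<partial>lborel) * (\<integral>\<^sup>+y. g y \<partial>lborel) = (\<integral>\<^sup>+x. f x \<partial>lborel) * (\<integral>\<^sup>+y. g y \<partial>lborel)" .
  moreover have "(\<integral>\<^sup>+y. g y \<partial>lborel) = ennreal pi"
    by (simp add: g_def emeasure_ball unit_ball_vol_2)
  ultimately show ?thesis
    using ennreal_mult_cancel_left[of "ennreal pi" "\<integral>\<^sup>+x. f (u * x) \<partial>lborel" "\<integral>\<^sup>+x. f x \<partial>lborel"]
    by (simp add: mult.commute)
qed

lemma nn_integral_lborel_dilate:
  fixes f :: "complex \<Rightarrow> ennreal"
  assumes s: "0 < s" and [measurable]: "f \<in> borel_measurable borel"
  shows "(\<integral>\<^sup>+x. f x \<partial>lborel) = ennreal (s\<^sup>2) * (\<integral>\<^sup>+x. f (of_real s * x) \<partial>lborel)"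
proof -
  have L: "lborel = density (distr lborel borel (\<lambda>x::complex. of_real s * x)) (\<lambda>_. ennreal (s\<^sup>2))"
    using lborel_affine[of s "0::complex"] s by (simp add: scaleR_conv_of_real)
  show ?thesis by (subst L) (simp add: nn_integral_distr nn_integral_density nn_integral_cmult)
qed

text \<open>Normalised to total mass 1 and living on the disc itself: the functions of interest are
  arbitrary outside it, so they are measurable only on the restricted space.\<close>

definition area :: "complex measure" where
  "area = density (restrict_space lborel disc) (\<lambda>_. ennreal (1 / pi))"

lemma open_disc [simp]: "open disc" and zero_in_disc [simp]: "0 \<in> disc"
  and mem_disc: "z \<in> disc \<longleftrightarrow> norm z < 1" and disc_borel [measurable, simp]: "disc \<in> sets borel"
  by (auto simp: disc_def)

lemma space_area [simp]: "space area = disc"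
  by (simp add: area_def space_restrict_space)

lemma sets_area [measurable_cong]: "sets area = sets (restrict_space borel disc)"
  by (simp add: area_def sets_restrict_space)

lemma borel_measurable_area_continuous:
  "continuous_on disc f \<Longrightarrow> f \<in> borel_measurable area"
  by (subst measurable_cong_sets[OF sets_area refl]) (rule borel_measurable_continuous_on_restrict)

lemma borel_measurable_area_borel: "f \<in> borel_measurable borel \<Longrightarrow> f \<in> borel_measurable area"
  by (subst measurable_cong_sets[OF sets_area refl]) (rule measurable_restrict_space1)

lemma mult_mem_disc: "norm u \<le> 1 \<Longrightarrow> z \<in> disc \<Longrightarrow> u * z \<in> disc"
  using mult_left_le_one_le[of "norm z" "norm u"] by (simp add: mem_disc norm_mult)

lemma nn_integral_area:
  assumes [measurable]: "f \<in> borel_measurable borel"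
  shows "(\<integral>\<^sup>+z. f z \<partial>area) = ennreal (1 / pi) * (\<integral>\<^sup>+z. f z * indicator disc z \<partial>lborel)"
proof -
  have [measurable]: "f \<in> borel_measurable (restrict_space lborel disc)"
    by (rule measurable_restrict_space1) simp
  show ?thesis unfolding area_def
    by (simp add: nn_integral_density nn_integral_cmult nn_integral_restrict_space)
qed

lemma integrable_area_iff:
  fixes f :: "complex \<Rightarrow> 'b::{banach, second_countable_topology}"
  assumes "f \<in> borel_measurable area"
  shows "integrable area f \<longleftrightarrow> set_integrable lborel disc f"
proof -
  have [measurable]: "f \<in> borel_measurable (restrict_space lborel disc)"
    using assms by (simp add: area_def)
  have *: "integrable lborel (\<lambda>x. (indicator disc x / pi) *\<^sub>R f x) \<longleftrightarrow> integrable lborel (\<lambda>x. indicator disc x *\<^sub>R f x)"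
    using integrable_scaleR_iff[of "1 / pi" lborel "\<lambda>x. indicator disc x *\<^sub>R f x"] by simp
  show ?thesis unfolding area_def
    by (subst integrable_density) (auto simp: integrable_restrict_space set_integrable_def *)
qed

lemma integral_area:
  fixes f :: "complex \<Rightarrow> 'b::{banach, second_countable_topology}"
  assumes "f \<in> borel_measurable area"
  shows "integral\<^sup>L area f = (1 / pi) *\<^sub>R set_lebesgue_integral lborel disc f"
proof -
  have [measurable]: "f \<in> borel_measurable (restrict_space lborel disc)"
    using assms by (simp add: area_def)
  show ?thesis unfolding area_def
    by (subst integral_density) (auto simp: integral_restrict_space set_lebesgue_integral_def)
qed

lemma nn_integral_area_rotate:
  assumes u: "norm u = 1" and [measurable]: "f \<in> borel_measurable borel"
  shows "(\<integral>\<^sup>+z. f (u * z) \<partial>area) = (\<integral>\<^sup>+z. f z \<partial>area)"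
proof -
  have "(\<integral>\<^sup>+z. f (u * z) * indicator disc (u * z) \<partial>lborel) = (\<integral>\<^sup>+z. f z * indicator disc z \<partial>lborel)"
    by (rule nn_integral_lborel_rotate[OF u]) simp
  moreover have "indicator disc (u * z) = (indicator disc z :: ennreal)" for z
    using u by (simp add: indicator_def mem_disc norm_mult)
  ultimately show ?thesis by (simp add: nn_integral_area)
qed

lemma measurable_mult_area:
  assumes "norm u \<le> 1" shows "(\<lambda>z. u * z) \<in> measurable area area"
proof -
  have "(\<lambda>z. u * z) \<in> measurable (restrict_space borel disc) (restrict_space borel disc)"
    using assms by (intro measurable_restrict_space3) (auto intro: mult_mem_disc)
  then show ?thesis by (subst measurable_cong_sets[OF sets_area sets_area])
qed

lemma emeasure_area:
  assumes "A \<subseteq> disc" "A \<in> sets borel"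
  shows "A \<in> sets area" "emeasure area A = (\<integral>\<^sup>+z. indicator A z \<partial>area)"
proof -
  show "A \<in> sets area" using assms by (auto simp: sets_area sets_restrict_space)
  then show "emeasure area A = (\<integral>\<^sup>+z. indicator A z \<partial>area)" by simp
qed

lemma sets_area_borel: "A \<in> sets area \<Longrightarrow> A \<in> sets borel" "A \<in> sets area \<Longrightarrow> A \<subseteq> disc"
  by (auto simp: sets_area sets_restrict_space)

lemma distr_area_rotate:
  assumes u: "norm u = 1" shows "distr area area (\<lambda>z. u * z) = area"
proof (rule measure_eqI)
  fix A assume A: "A \<in> sets (distr area area (\<lambda>z. u * z))"
  then have [measurable]: "A \<in> sets borel" "A \<in> sets area" using sets_area_borel by auto
  have m: "(\<lambda>z. u * z) \<in> measurable area area" using u by (simp add: measurable_mult_area)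
  have "emeasure (distr area area (\<lambda>z. u * z)) A = (\<integral>\<^sup>+z. indicator A z \<partial>distr area area (\<lambda>z. u * z))"
    by simp
  also have "\<dots> = (\<integral>\<^sup>+z. indicator A (u * z) \<partial>area)" using m by (subst nn_integral_distr) auto
  also have "\<dots> = (\<integral>\<^sup>+z. indicator A z \<partial>area)" by (intro nn_integral_area_rotate u) simp
  also have "\<dots> = emeasure area A" by simp
  finally show "emeasure (distr area area (\<lambda>z. u * z)) A = emeasure area A" .
qed simp

lemma integral_area_rotate:
  fixes f :: "complex \<Rightarrow> 'b::{banach, second_countable_topology}"
  assumes u: "norm u = 1" and f: "f \<in> borel_measurable area"
  shows "integral\<^sup>L area (\<lambda>z. f (u * z)) = integral\<^sup>L area f"
    and "integrable area (\<lambda>z. f (u * z)) \<longleftrightarrow> integrable area f"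
  using integral_distr[of "\<lambda>z. u * z" area area f] integrable_distr_eq[of "\<lambda>z. u * z" area area f]
    measurable_mult_area[of u] u f by (simp_all add: distr_area_rotate)

text \<open>The change of variables w = s z with Jacobian s^2. As an identity of measures it
  transports both integrals and integrability, for values in any Banach space.\<close>

lemma distr_area_dilate:
  assumes s: "0 < s" "s \<le> 1"
  shows "density (distr area area (\<lambda>z. of_real s * z)) (\<lambda>_. ennreal (s\<^sup>2))
    = density area (\<lambda>z. indicator (ball 0 s) z)"
proof (rule measure_eqI)
  have m: "(\<lambda>z. of_real s * z) \<in> measurable area area" using s by (simp add: measurable_mult_area)
  have i: "indicator (ball 0 s) \<in> borel_measurable area"
    by (intro borel_measurable_area_borel borel_measurable_indicator) simp
  fix A assume A: "A \<in> sets (density (distr area area (\<lambda>z. of_real s * z)) (\<lambda>_. ennreal (s\<^sup>2)))"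
  then have [measurable]: "A \<in> sets borel" "A \<in> sets area" using sets_area_borel by auto
  have ind: "indicator disc (of_real s * z) * indicator (ball 0 s) (of_real s * z) = (indicator disc z :: ennreal)" for z
    using s mult_mem_disc[of "of_real s" z] by (auto simp: indicator_def mem_disc norm_mult)
  have "emeasure (density (distr area area (\<lambda>z. of_real s * z)) (\<lambda>_. ennreal (s\<^sup>2))) A
      = ennreal (s\<^sup>2) * (\<integral>\<^sup>+z. indicator A z \<partial>distr area area (\<lambda>z. of_real s * z))"
    by (simp add: emeasure_density nn_integral_cmult)
  also have "\<dots> = ennreal (s\<^sup>2) * (\<integral>\<^sup>+z. indicator A (of_real s * z) \<partial>area)"
    using m by (subst nn_integral_distr) auto
  also have "\<dots> = ennreal (1 / pi) * (ennreal (s\<^sup>2) * (\<integral>\<^sup>+z. indicator A (of_real s * z) *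
       (indicator disc (of_real s * z) * indicator (ball 0 s) (of_real s * z)) \<partial>lborel))"
    unfolding ind by (simp add: nn_integral_area ac_simps)
  also have "\<dots> = ennreal (1 / pi) * (\<integral>\<^sup>+z. indicator A z * (indicator disc z * indicator (ball 0 s) z) \<partial>lborel)"
    using s by (subst nn_integral_lborel_dilate[of s "\<lambda>z. indicator A z * (indicator disc z * indicator (ball 0 s) z)"]) simp_all
  also have "\<dots> = (\<integral>\<^sup>+z. indicator (ball 0 s) z * indicator A z \<partial>area)"
    by (simp add: nn_integral_area ac_simps)
  also have "\<dots> = emeasure (density area (\<lambda>z. indicator (ball 0 s) z)) A"
    using i by (subst emeasure_density) auto
  finally show "emeasure (density (distr area area (\<lambda>z. of_real s * z)) (\<lambda>_. ennreal (s\<^sup>2))) A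
     = emeasure (density area (\<lambda>z. indicator (ball 0 s) z)) A" .
qed simp

lemma integral_area_dilate:
  fixes f :: "complex \<Rightarrow> 'b::{banach, second_countable_topology}"
  assumes s: "0 < s" "s \<le> 1" and [measurable]: "f \<in> borel_measurable area"
  shows "s\<^sup>2 *\<^sub>R integral\<^sup>L area (\<lambda>z. f (of_real s * z)) = (LINT z:ball 0 s|area. f z)"
    and "integrable area (\<lambda>z. f (of_real s * z)) \<longleftrightarrow> set_integrable area (ball 0 s) f"
proof -
  have m [measurable]: "(\<lambda>z. of_real s * z) \<in> measurable area area" using s by (simp add: measurable_mult_area)
  have i [measurable]: "indicator (ball 0 s) \<in> borel_measurable area"
    by (intro borel_measurable_area_borel borel_measurable_indicator) simp
  have e: "density (distr area area (\<lambda>z. of_real s * z)) (\<lambda>_. ennreal (s\<^sup>2))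
    = density area (\<lambda>z. ennreal (indicator (ball 0 s) z))"
    using distr_area_dilate[OF s] by (simp add: ennreal_indicator)
  have "s\<^sup>2 *\<^sub>R integral\<^sup>L area (\<lambda>z. f (of_real s * z)) = s\<^sup>2 *\<^sub>R integral\<^sup>L (distr area area (\<lambda>z. of_real s * z)) f"
    by (simp add: integral_distr)
  also have "\<dots> = integral\<^sup>L (density (distr area area (\<lambda>z. of_real s * z)) (\<lambda>_. ennreal (s\<^sup>2))) f"
    by (subst integral_density) auto
  also have "\<dots> = (LINT z:ball 0 s|area. f z)"
    unfolding e set_lebesgue_integral_def by (subst integral_density) auto
  finally show "s\<^sup>2 *\<^sub>R integral\<^sup>L area (\<lambda>z. f (of_real s * z)) = (LINT z:ball 0 s|area. f z)" .
  have "integrable area (\<lambda>z. f (of_real s * z)) \<longleftrightarrow> integrable (density (distr area area (\<lambda>z. of_real s * z)) (\<lambda>_. ennreal (s\<^sup>2))) f"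
    using s by (subst integrable_density) (auto simp: integrable_distr_eq integrable_scaleR_iff)
  also have "\<dots> \<longleftrightarrow> set_integrable area (ball 0 s) f"
    unfolding e set_integrable_def by (subst integrable_density) auto
  finally show "integrable area (\<lambda>z. f (of_real s * z)) \<longleftrightarrow> set_integrable area (ball 0 s) f" .
qed

lemma emeasure_area_ball: "0 \<le> s \<Longrightarrow> s \<le> 1 \<Longrightarrow> emeasure area (ball 0 s) = ennreal (s\<^sup>2)"
proof -
  assume s: "0 \<le> s" "s \<le> 1"
  have b: "ball 0 s \<subseteq> disc" using s by (auto simp: mem_disc)
  have "emeasure area (ball 0 s) = (\<integral>\<^sup>+z. indicator (ball 0 s) z \<partial>area)" using b by (intro emeasure_area) auto
  also have "\<dots> = ennreal (1 / pi) * (\<integral>\<^sup>+z. indicator (ball 0 s) z * indicator disc z \<partial>lborel)"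
    by (rule nn_integral_area) simp
  also have "(\<integral>\<^sup>+z. indicator (ball 0 s) z * indicator disc z \<partial>lborel) = (\<integral>\<^sup>+z. indicator (ball 0 s) z \<partial>(lborel :: complex measure))"
    using b by (intro nn_integral_cong) (auto simp: indicator_def)
  also have "\<dots> = ennreal (pi * s\<^sup>2)" using s by (simp add: emeasure_ball unit_ball_vol_2)
  finally show ?thesis by (simp flip: ennreal_mult)
qed

lemma emeasure_area_space: "emeasure area disc = 1"
  using emeasure_area_ball[of 1] by (simp add: disc_def)

interpretation area: finite_measure area
  by (rule finite_measureI) (simp add: emeasure_area_space)

lemma measure_area_disc [simp]: "measure area disc = 1"
  by (simp add: measure_def emeasure_area_space)

definition ann :: "real \<Rightarrow> complex set" where "ann r = {z. r \<le> norm z \<and> norm z < 1}"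

lemma ann_borel [measurable]: "ann r \<in> sets borel"
  unfolding ann_def by measurable

lemma ann_subset: "ann r \<subseteq> disc" by (auto simp: ann_def mem_disc)

lemma ann_sets [measurable]: "ann r \<in> sets area"
  by (intro emeasure_area ann_subset) simp

lemma ball_sets: "s \<le> 1 \<Longrightarrow> ball 0 s \<in> sets area"
  by (intro emeasure_area) (auto simp: mem_disc)

lemma measure_area_ball: "0 \<le> s \<Longrightarrow> s \<le> 1 \<Longrightarrow> measure area (ball 0 s) = s\<^sup>2"
  using emeasure_area_ball[of s] by (simp add: measure_def)

lemma measure_area_ann: "0 \<le> r \<Longrightarrow> r \<le> 1 \<Longrightarrow> measure area (ann r) = 1 - r\<^sup>2"
proof -
  assume r: "0 \<le> r" "r \<le> 1"
  have "ann r = space area - ball 0 r" by (auto simp: ann_def mem_disc)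
  then have "measure area (ann r) = measure area (space area) - measure area (ball 0 r)"
    using r by (simp only: area.finite_measure_compl ball_sets)
  then show ?thesis using r by (simp add: measure_area_ball)
qed

section \<open>Circles, polar averaging and the inequality of Hoelder\<close>

definition circle :: "real measure" where
  "circle = density (restrict_space lborel {0..2 * pi}) (\<lambda>_. ennreal (1 / (2 * pi)))"

lemma space_circle [simp]: "space circle = {0..2 * pi}"
  by (simp add: circle_def space_restrict_space)

lemma sets_circle [measurable_cong]: "sets circle = sets (restrict_space borel {0..2 * pi})"
  by (simp add: circle_def sets_restrict_space)

lemma borel_measurable_circle_continuous:
  "continuous_on {0..2 * pi} f \<Longrightarrow> f \<in> borel_measurable circle"
  by (subst measurable_cong_sets[OF sets_circle refl]) (rule borel_measurable_continuous_on_restrict)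

lemma emeasure_circle_space: "emeasure circle {0..2 * pi} = 1"
proof -
  have "emeasure circle {0..2 * pi} = (\<integral>\<^sup>+x. ennreal (1 / (2 * pi)) * indicator {0..2 * pi} x \<partial>restrict_space lborel {0..2 * pi})"
    unfolding circle_def by (subst emeasure_density) (auto simp: sets_restrict_space)
  also have "\<dots> = (\<integral>\<^sup>+x. ennreal (1 / (2 * pi)) * indicator {0..2 * pi} x * indicator {0..2 * pi} x \<partial>lborel)"
    by (subst nn_integral_restrict_space) auto
  also have "\<dots> = (\<integral>\<^sup>+x. ennreal (1 / (2 * pi)) * indicator {0..2 * pi} x \<partial>lborel)"
    by (intro nn_integral_cong) (auto simp: indicator_def)
  also have "\<dots> = ennreal (1 / (2 * pi)) * ennreal (2 * pi)"
    by (subst nn_integral_cmult) auto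
  also have "\<dots> = 1" by (subst ennreal_mult[symmetric]) auto
  finally show ?thesis .
qed

interpretation circle: finite_measure circle
  by (rule finite_measureI) (simp add: emeasure_circle_space)

lemma integral_circle:
  fixes f :: "real \<Rightarrow> 'b::euclidean_space"
  assumes "continuous_on {0..2 * pi} f"
  shows "integrable circle f" "integral\<^sup>L circle f = (1 / (2 * pi)) *\<^sub>R integral {0..2 * pi} f"
proof -
  have [measurable]: "f \<in> borel_measurable (restrict_space lborel {0..2 * pi})"
    using borel_measurable_circle_continuous[OF assms] by (simp add: circle_def)
  have s: "set_integrable lborel {0..2 * pi} f" using assms by (rule borel_integrable_atLeastAtMost')
  have r: "integrable (restrict_space lborel {0..2 * pi}) f"
    using s by (simp add: integrable_restrict_space set_integrable_def)
  show "integrable circle f"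
    unfolding circle_def using r by (subst integrable_density) (auto intro: integrable_scaleR_right)
  have "integral\<^sup>L circle f = (1 / (2 * pi)) *\<^sub>R integral\<^sup>L (restrict_space lborel {0..2 * pi}) f"
    unfolding circle_def by (subst integral_density) auto
  also have "integral\<^sup>L (restrict_space lborel {0..2 * pi}) f = integral {0..2 * pi} f"
    using set_borel_integral_eq_integral(2)[OF s]
    by (simp add: integral_restrict_space set_lebesgue_integral_def)
  finally show "integral\<^sup>L circle f = (1 / (2 * pi)) *\<^sub>R integral {0..2 * pi} f" .
qed

lemma continuous_on_circle:
  assumes "continuous_on (sphere 0 (norm z)) h"
  shows "continuous_on A (\<lambda>t. h (z * cis t))"
  by (rule continuous_on_compose2[OF assms]) (auto intro!: continuous_intros simp: norm_mult)

text \<open>Writing z = |z| cis(alpha) shifts the parameter interval by alpha; the part sticking out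
  beyond 2 pi is moved back by periodicity.\<close>

lemma integral_circle_rotate:
  fixes h :: "complex \<Rightarrow> 'b::euclidean_space"
  assumes h: "continuous_on (sphere 0 (norm z)) h"
  shows "(\<integral>t. h (z * cis t) \<partial>circle) = (\<integral>t. h (of_real (norm z) * cis t) \<partial>circle)"
proof -
  define \<alpha> where "\<alpha> = Arg2pi z"
  have \<alpha>: "0 \<le> \<alpha>" "\<alpha> \<le> 2 * pi" "z = of_real (norm z) * cis \<alpha>"
    using Arg2pi_eq[of z] Arg2pi_ge_0[of z] Arg2pi_lt_2pi[of z] by (auto simp: \<alpha>_def cis_conv_exp)
  define \<phi> where "\<phi> t = h (of_real (norm z) * cis t)" for t
  have c: "continuous_on A \<phi>" for A
    unfolding \<phi>_def using continuous_on_circle[of "of_real (norm z)" h A] h by simp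
  have per: "\<phi> (t + 2 * pi) = \<phi> t" for t by (simp add: \<phi>_def flip: cis_mult)
  have shift: "integral {a..b} (\<lambda>t. \<phi> (t + c)) = integral {a + c..b + c} \<phi>" for a b c
    using integral_shift[OF c] by (simp add: o_def)
  have hz: "h (z * cis t) = \<phi> (t + \<alpha>)" for t
    unfolding \<phi>_def by (subst \<alpha>(3)) (simp add: cis_mult add.commute mult.assoc)
  have "integral {0..2 * pi} (\<lambda>t. h (z * cis t)) = integral {\<alpha>..2 * pi + \<alpha>} \<phi>"
    unfolding hz by (subst shift) simp
  also have "\<dots> = integral {\<alpha>..2 * pi} \<phi> + integral {2 * pi..2 * pi + \<alpha>} \<phi>"
    using \<alpha> by (intro Henstock_Kurzweil_Integration.integral_combine[symmetric] integrable_continuous_real c) auto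
  also have "integral {2 * pi..2 * pi + \<alpha>} \<phi> = integral {0..\<alpha>} \<phi>"
    using shift[of 0 \<alpha> "2 * pi"] by (simp add: per add.commute)
  also have "integral {\<alpha>..2 * pi} \<phi> + integral {0..\<alpha>} \<phi> = integral {0..2 * pi} \<phi>"
    using \<alpha> by (subst add.commute) (intro Henstock_Kurzweil_Integration.integral_combine integrable_continuous_real c; simp)
  finally have "integral {0..2 * pi} (\<lambda>t. h (z * cis t)) = integral {0..2 * pi} \<phi>" .
  moreover have "continuous_on {0..2*pi} (\<lambda>t. h (z * cis t))" using h by (rule continuous_on_circle)
  ultimately show ?thesis using c[of "{0..2*pi}"] by (simp add: integral_circle flip: \<phi>_def)
qed

text \<open>A substitute for polar coordinates: the area integral does not change when f is rotated,
  so it equals its average over all rotations, and Fubini turns that average into the circular mean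
  of f at each point.\<close>

lemma nn_integral_area_polar:
  fixes f :: "complex \<Rightarrow> real"
  assumes f: "continuous_on disc f" and pos: "\<And>z. z \<in> disc \<Longrightarrow> 0 \<le> f z"
  shows "(\<integral>\<^sup>+z. indicator (ann r) z * ennreal (f z) \<partial>area)
    = (\<integral>\<^sup>+z. indicator (ann r) z * ennreal (\<integral>t. f (of_real (norm z) * cis t) \<partial>circle) \<partial>area)"
proof -
  have ps: "pair_sigma_finite circle area"
    by (simp add: pair_sigma_finite_def circle.sigma_finite_measure_axioms area.sigma_finite_measure_axioms)
  \<comment> \<open>Extension by 0 makes the function Borel on the whole plane, as rotation
    invariance and joint measurability require.\<close>
  define G where "G z = ennreal (indicator disc z *\<^sub>R f z)" for z
  have [measurable]: "G \<in> borel_measurable borel"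
    unfolding G_def by (intro measurable_compose[OF _ measurable_ennreal] borel_measurable_continuous_on_indicator f) simp
  have [measurable]: "(\<lambda>z. z) \<in> borel_measurable area" by (rule borel_measurable_area_borel) simp
  have [measurable]: "cis \<in> borel_measurable circle"
    by (rule borel_measurable_circle_continuous) (auto intro: continuous_intros)
  have [measurable]: "indicator (ann r) \<in> borel_measurable area" by (rule borel_measurable_area_borel) simp
  have iG: "(\<integral>\<^sup>+z. indicator (ann r) z * ennreal (f z) \<partial>area) = (\<integral>\<^sup>+z. indicator (ann r) z * G z \<partial>area)"
    by (intro nn_integral_cong) (simp add: G_def)
  also have rot: "\<dots> = (\<integral>\<^sup>+z. indicator (ann r) z * G (cis t * z) \<partial>area)" for t
  proof -
    have "(\<integral>\<^sup>+z. indicator (ann r) z * G z \<partial>area) = (\<integral>\<^sup>+z. indicator (ann r) (cis t * z) * G (cis t * z) \<partial>area)"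
      by (rule nn_integral_area_rotate[symmetric]) auto
    also have "(\<lambda>z. indicator (ann r) (cis t * z) :: ennreal) = indicator (ann r)"
      by (auto simp: fun_eq_iff indicator_def ann_def norm_mult)
    finally show ?thesis .
  qed
  have "(\<integral>\<^sup>+z. indicator (ann r) z * G z \<partial>area) = (\<integral>\<^sup>+t. (\<integral>\<^sup>+z. indicator (ann r) z * G z \<partial>area) \<partial>circle)"
    by (simp add: emeasure_circle_space)
  also have "\<dots> = (\<integral>\<^sup>+t. (\<integral>\<^sup>+z. indicator (ann r) z * G (cis t * z) \<partial>area) \<partial>circle)"
    by (intro nn_integral_cong rot)
  also have "\<dots> = (\<integral>\<^sup>+z. (\<integral>\<^sup>+t. indicator (ann r) z * G (cis t * z) \<partial>circle) \<partial>area)"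
    by (intro pair_sigma_finite.Fubini'[OF ps, symmetric]) measurable
  also have "\<dots> = (\<integral>\<^sup>+z. indicator (ann r) z * ennreal (\<integral>t. f (of_real (norm z) * cis t) \<partial>circle) \<partial>area)"
  proof (intro nn_integral_cong)
    fix z assume z: "z \<in> space area"
    have sph: "sphere 0 (norm z) \<subseteq> disc" using z by (auto simp: mem_disc)
    have f': "continuous_on (sphere 0 (norm z)) f" using f sph by (rule continuous_on_subset)
    have "(\<integral>\<^sup>+t. indicator (ann r) z * G (cis t * z) \<partial>circle) = indicator (ann r) z * (\<integral>\<^sup>+t. G (cis t * z) \<partial>circle)"
      by (rule nn_integral_cmult) measurable
    also have "(\<integral>\<^sup>+t. G (cis t * z) \<partial>circle) = (\<integral>\<^sup>+t. ennreal (f (z * cis t)) \<partial>circle)"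
      using z by (intro nn_integral_cong) (simp add: G_def mem_disc norm_mult mult.commute)
    also have "\<dots> = ennreal (\<integral>t. f (z * cis t) \<partial>circle)"
      using z by (intro nn_integral_eq_integral integral_circle(1) continuous_on_circle f' AE_I2 pos)
        (simp add: mem_disc norm_mult)
    also have "(\<integral>t. f (z * cis t) \<partial>circle) = (\<integral>t. f (of_real (norm z) * cis t) \<partial>circle)"
      by (rule integral_circle_rotate[OF f'])
    finally show "(\<integral>\<^sup>+t. indicator (ann r) z * G (cis t * z) \<partial>circle)
      = indicator (ann r) z * ennreal (\<integral>t. f (of_real (norm z) * cis t) \<partial>circle)" .
  qed
  finally show ?thesis using iG by simp
qed

lemma Holder_complex:
  fixes f g :: "'a \<Rightarrow> complex"
  assumes pq: "1 < p" "q = p / (p - 1)"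
    and [measurable]: "f \<in> borel_measurable M" "g \<in> borel_measurable M"
    and f: "integrable M (\<lambda>x. norm (f x) powr p)" and g: "integrable M (\<lambda>x. norm (g x) powr q)"
  shows "integrable M (\<lambda>x. f x * g x)"
    and "(\<integral>x. norm (f x * g x) \<partial>M)
      \<le> (\<integral>x. norm (f x) powr p \<partial>M) powr (1 / p) * (\<integral>x. norm (g x) powr q \<partial>M) powr (1 / q)"
    and "norm (\<integral>x. f x * g x \<partial>M)
      \<le> (\<integral>x. norm (f x) powr p \<partial>M) powr (1 / p) * (\<integral>x. norm (g x) powr q \<partial>M) powr (1 / q)"
proof -
  have q: "1 < q" "1 / p + 1 / q = 1" unfolding pq(2) using pq(1) by (simp_all add: field_simps)
  define X Y where "X = (\<integral>x. norm (f x) powr p \<partial>M)" and "Y = (\<integral>x. norm (g x) powr q \<partial>M)"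
  have XY: "0 \<le> X" "0 \<le> Y" by (auto simp: X_def Y_def)
  have young: "norm (f x * g x) \<le> norm (f x) powr p + norm (g x) powr q" for x
  proof -
    have "norm (f x) * norm (g x) \<le> norm (f x) powr p / p + norm (g x) powr q / q"
      using pq(1) q by (intro Youngs_inequality) auto
    also have "\<dots> \<le> norm (f x) powr p + norm (g x) powr q"
      using pq(1) q(1) by (intro add_mono) (auto simp: divide_le_eq mult_le_cancel_left1)
    finally show ?thesis by (simp add: norm_mult)
  qed
  show int: "integrable M (\<lambda>x. f x * g x)"
    by (rule Bochner_Integration.integrable_bound[OF Bochner_Integration.integrable_add[OF f g]])
      (auto intro!: AE_I2 order_trans[OF young])
  have le: "(\<integral>x. norm (f x * g x) \<partial>M) \<le> (X powr (1 / p) + e) * (Y powr (1 / q) + e)" if e: "0 < e" for e :: real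
  proof -
    \<comment> \<open>Young's inequality is applied after division by the norms; adding e keeps the
      divisors positive, and e tends to 0 at the end.\<close>
    define a b where "a = X powr (1 / p) + e" and "b = Y powr (1 / q) + e"
    have ab: "0 < a" "0 < b" using e by (auto simp: a_def b_def add_nonneg_pos)
    have pt: "norm (f x * g x) / (a * b) \<le> norm (f x) powr p / (p * a powr p) + norm (g x) powr q / (q * b powr q)" for x
      using Youngs_inequality[of p q "norm (f x) / a" "norm (g x) / b"] pq(1) q ab
      by (simp add: norm_mult powr_divide mult.commute)
    have "(\<integral>x. norm (f x * g x) / (a * b) \<partial>M)
        \<le> (\<integral>x. norm (f x) powr p / (p * a powr p) + norm (g x) powr q / (q * b powr q) \<partial>M)"
      using int f g by (intro integral_mono pt) auto
    also have "\<dots> = X / (p * a powr p) + Y / (q * b powr q)"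
      using f g by (simp add: X_def Y_def)
    also have "\<dots> \<le> 1 / p + 1 / q"
    proof (intro add_mono)
      have "X = (X powr (1 / p)) powr p" using XY pq by (simp add: powr_powr)
      also have "\<dots> \<le> a powr p" using e pq by (intro powr_mono2) (auto simp: a_def)
      finally show "X / (p * a powr p) \<le> 1 / p" using pq ab by (simp add: field_simps)
      have "Y = (Y powr (1 / q)) powr q" using XY q by (simp add: powr_powr)
      also have "\<dots> \<le> b powr q" using e q by (intro powr_mono2) (auto simp: b_def)
      finally show "Y / (q * b powr q) \<le> 1 / q" using q ab by (simp add: field_simps)
    qed
    finally have "(\<integral>x. norm (f x * g x) \<partial>M) / (a * b) \<le> 1" using q by simp
    then have "(\<integral>x. norm (f x * g x) \<partial>M) \<le> a * b" using ab by (simp add: field_simps)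
    then show ?thesis by (simp add: a_def b_def)
  qed
  have "((\<lambda>e. (X powr (1 / p) + e) * (Y powr (1 / q) + e)) \<longlongrightarrow> (X powr (1 / p) + 0) * (Y powr (1 / q) + 0)) (at_right 0)"
    by (intro tendsto_intros)
  then have "(\<integral>x. norm (f x * g x) \<partial>M) \<le> (X powr (1 / p) + 0) * (Y powr (1 / q) + 0)"
    by (rule tendsto_lowerbound) (auto simp: eventually_at_right_field intro!: exI[of _ 1] le)
  then show "(\<integral>x. norm (f x * g x) \<partial>M) \<le> X powr (1 / p) * Y powr (1 / q)" by simp
  then show "norm (\<integral>x. f x * g x \<partial>M) \<le> X powr (1 / p) * Y powr (1 / q)"
    using integral_norm_bound[of M "\<lambda>x. f x * g x"] by linarith
qed

section \<open>Integral means\<close>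

text \<open>The p-th power of \<open>Hp_mean\<close>: without the root it is additive under
  integration, as polar averaging and uniform convexity need.\<close>

definition circ_mean :: "real \<Rightarrow> (complex \<Rightarrow> complex) \<Rightarrow> real \<Rightarrow> real" where
  "circ_mean p f r = (\<integral>t. norm (f (of_real r * cis t)) powr p \<partial>circle)"

lemma circ_mean_nonneg [simp]: "0 \<le> circ_mean p f r"
  by (simp add: circ_mean_def)

lemma bounded_on_cball:
  fixes f :: "complex \<Rightarrow> complex"
  assumes "continuous_on disc f" "r < 1"
  obtains B where "0 \<le> B" "\<And>w. norm w \<le> r \<Longrightarrow> norm (f w) \<le> B"
proof -
  have "compact (f ` cball 0 r)"
    using assms by (intro compact_continuous_image continuous_on_subset[OF assms(1)]) (auto simp: mem_disc)
  then obtain B where "\<And>w. w \<in> cball 0 r \<Longrightarrow> norm (f w) \<le> B"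
    using compact_imp_bounded by (fastforce simp: bounded_iff)
  then show ?thesis by (intro that[of "max B 0"]) (auto simp: le_max_iff_disj)
qed

text \<open>The double successor starts the sequence at 1/2, since the dilation estimate below is
  available for r >= 1/2 only.\<close>

definition radius :: "nat \<Rightarrow> real" where
  "radius n = 1 - inverse (real (Suc (Suc n)))"

lemma radius: "1/2 \<le> radius n" "radius n < 1"
  by (auto simp: radius_def field_simps)

lemma radius_pos: "0 < radius n"
  using radius(1)[of n] by linarith

lemma radius_tendsto: "radius \<longlonglongrightarrow> 1"
proof -
  have "(\<lambda>n. 1 - inverse (real (Suc (Suc n)))) \<longlonglongrightarrow> 1 - 0"
    by (intro tendsto_intros LIMSEQ_Suc[OF LIMSEQ_inverse_real_of_nat])
  then show ?thesis by (simp add: radius_def[abs_def])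
qed

lemma continuous_on_disc_circle:
  assumes "continuous_on disc f" "0 \<le> r" "r < 1"
  shows "continuous_on A (\<lambda>t. f (of_real r * cis t))"
  using assms by (intro continuous_on_circle continuous_on_subset[OF assms(1)]) (auto simp: mem_disc)

lemma integrable_circ_mean:
  fixes f :: "complex \<Rightarrow> complex"
  assumes "continuous_on disc f" "0 \<le> r" "r < 1" "0 < p"
  shows "integrable circle (\<lambda>t. norm (f (of_real r * cis t)) powr p)"
  by (rule integral_circle(1)[OF continuous_on_norm_powr[OF continuous_on_disc_circle[OF assms(1-3)] assms(4)]])

lemma powr_inverse_powr: "0 < p \<Longrightarrow> 0 \<le> x \<Longrightarrow> (x powr (1 / p)) powr p = x" for x p :: real
  by (simp add: powr_powr)

lemma Hp_mean_eq:
  assumes "continuous_on disc f" "0 \<le> r" "r < 1" "0 < p"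
  shows "Hp_mean p f r = circ_mean p f r powr (1 / p)"
  unfolding Hp_mean_def circ_mean_def
  by (subst integral_circle) (use assms in \<open>auto intro!: continuous_on_norm_powr continuous_on_disc_circle\<close>)

lemma circ_mean_rotate:
  assumes "continuous_on disc f" "u \<in> disc" "0 < p"
  shows "(\<integral>t. norm (f (u * cis t)) powr p \<partial>circle) = circ_mean p f (norm u)"
proof -
  have "continuous_on (sphere 0 (norm u)) f"
    using assms by (intro continuous_on_subset[OF assms(1)]) (auto simp: mem_disc)
  with assms show ?thesis unfolding circ_mean_def
    by (intro integral_circle_rotate[where h="\<lambda>w. norm (f w) powr p"] continuous_on_norm_powr)
qed

text \<open>The maximum principle, applied to the holomorphic function
  \<open>u \<mapsto> \<integral> f (u e\<^sup>i\<^sup>t) \<psi> t\<close> with \<open>\<psi>\<close> extremal in Hoelder's inequality at radius \<open>r\<close>.\<close>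

lemma circ_mean_mono:
  assumes p: "1 < p" and f: "f holomorphic_on disc" and rs: "0 \<le> r" "r \<le> s" "s < 1"
  shows "circ_mean p f r \<le> circ_mean p f s"
proof (cases "r = s \<or> circ_mean p f r = 0")
  case False
  then have rs': "r < s" "0 < circ_mean p f r" using rs circ_mean_nonneg[of p f r] by (auto simp del: circ_mean_nonneg)
  define q where "q = p / (p - 1)"
  have cf: "continuous_on disc f" using f by (rule holomorphic_on_imp_continuous_on)
  define \<psi> where "\<psi> t = dual_unit p (f (of_real r * cis t))" for t
  have c\<psi>: "continuous_on A \<psi>" for A
    unfolding \<psi>_def using rs by (intro continuous_intros p continuous_on_disc_circle cf) auto
  have q\<psi>: "norm (\<psi> t) powr q = norm (f (of_real r * cis t)) powr p" for t
    using p by (simp add: \<psi>_def norm_dual_unit powr_powr q_def)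
  define H where "H u = integral {0..2 * pi} (\<lambda>t. f (u * cis t) * \<psi> t)" for u
  have ud: "u * cis t \<in> disc" if "u \<in> disc" for u t
    using that by (simp add: mem_disc norm_mult)
  have cu: "continuous_on A (\<lambda>t. f (u * cis t) * \<psi> t)" if "u \<in> disc" for u A
    using that by (intro continuous_intros c\<psi> continuous_on_circle continuous_on_subset[OF cf]) (auto simp: mem_disc)
  have "(\<lambda>u. integral (cbox 0 (2 * pi)) (\<lambda>t. f (u * cis t) * \<psi> t)) holomorphic_on disc"
  proof (rule leibniz_rule_holomorphic)
    fix u t assume u: "u \<in> disc"
    show "((\<lambda>u. f (u * cis t) * \<psi> t) has_field_derivative deriv f (u * cis t) * cis t * \<psi> t) (at u within disc)"
      using holomorphic_derivI[OF f open_disc ud[OF u]]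
      by (auto intro!: derivative_eq_intros DERIV_chain2[where f=f])
    show "(\<lambda>t. f (u * cis t) * \<psi> t) integrable_on cbox 0 (2 * pi)"
      using cu[OF u] by (auto intro: integrable_continuous_real)
  next
    have "continuous_on disc (deriv f)"
      using f by (intro holomorphic_on_imp_continuous_on holomorphic_deriv) auto
    then have "continuous_on (disc \<times> cbox 0 (2 * pi)) (\<lambda>x. deriv f (fst x * cis (snd x)))"
      by (rule continuous_on_compose2) (auto intro!: continuous_intros ud)
    moreover have "continuous_on (disc \<times> cbox 0 (2 * pi)) (\<lambda>x. \<psi> (snd x))"
      by (rule continuous_on_compose2[OF c\<psi>[of UNIV]]) (auto intro!: continuous_intros)
    ultimately show "continuous_on (disc \<times> cbox 0 (2 * pi)) (\<lambda>(u, t). deriv f (u * cis t) * cis t * \<psi> t)"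
      unfolding split_beta' by (intro continuous_intros) auto
  qed (simp add: disc_def)
  then have H: "H holomorphic_on disc" unfolding H_def by simp
  have Hb: "norm (H u) \<le> 2 * pi * (circ_mean p f (norm u) powr (1 / p) * circ_mean p f r powr (1 / q))"
    if u: "u \<in> disc" for u
  proof -
    have m: "(\<lambda>t. f (u * cis t)) \<in> borel_measurable circle" "\<psi> \<in> borel_measurable circle"
      using u by (intro borel_measurable_circle_continuous c\<psi> continuous_on_circle continuous_on_subset[OF cf]; auto simp: mem_disc)+
    have i: "integrable circle (\<lambda>t. norm (f (u * cis t)) powr p)" "integrable circle (\<lambda>t. norm (\<psi> t) powr q)"
      unfolding q\<psi> using u p rs
      by (intro integral_circle continuous_on_norm_powr continuous_on_circle continuous_on_disc_circle cf continuous_on_subset[OF cf]; auto simp: mem_disc)+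
    have "norm (\<integral>t. f (u * cis t) * \<psi> t \<partial>circle) \<le>
      (\<integral>t. norm (f (u * cis t)) powr p \<partial>circle) powr (1 / p) * (\<integral>t. norm (\<psi> t) powr q \<partial>circle) powr (1 / q)"
      by (rule Holder_complex(3)[OF p q_def m i])
    also have "(\<integral>t. norm (f (u * cis t)) powr p \<partial>circle) = circ_mean p f (norm u)"
      using p by (intro circ_mean_rotate cf u) auto
    also have "(\<integral>t. norm (\<psi> t) powr q \<partial>circle) = circ_mean p f r"
      unfolding q\<psi> circ_mean_def ..
    finally show ?thesis
      unfolding H_def by (subst (asm) integral_circle(2)[OF cu[OF u]]) (simp add: field_simps)
  qed
  have Hr: "H (of_real r) = of_real (2 * pi * circ_mean p f r)"
  proof -
    have "H (of_real r) = integral {0..2*pi} (\<lambda>t. complex_of_real (norm (f (of_real r * cis t)) powr p))"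
      unfolding H_def \<psi>_def by (simp add: mult.commute[of "f _"] dual_unit_mult_self)
    also have "\<dots> = of_real (integral {0..2*pi} (\<lambda>t. norm (f (of_real r * cis t)) powr p))"
    proof -
      have "(\<lambda>t. norm (f (of_real r * cis t)) powr p) integrable_on {0..2 * pi}"
        using rs p by (intro integrable_continuous_real continuous_on_norm_powr continuous_on_disc_circle cf) auto
      from integral_linear[OF this bounded_linear_of_real[where ?'a = complex]] show ?thesis
        by (simp add: o_def)
    qed
    also have "integral {0..2*pi} (\<lambda>t. norm (f (of_real r * cis t)) powr p) = 2 * pi * circ_mean p f r"
      unfolding circ_mean_def using rs p
      by (subst integral_circle) (auto intro!: continuous_on_norm_powr continuous_on_disc_circle cf)
    finally show ?thesis .
  qed
  have "norm (H (of_real r)) \<le> 2 * pi * (circ_mean p f s powr (1 / p) * circ_mean p f r powr (1 / q))"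
  proof (rule maximum_modulus_frontier[of H "cball 0 s"])
    show "H holomorphic_on interior (cball 0 s)"
      using H rs by (auto intro!: holomorphic_on_subset[OF H] simp: mem_disc)
    show "continuous_on (closure (cball 0 s)) H"
      using holomorphic_on_imp_continuous_on[OF H] rs by (auto intro: continuous_on_subset simp: mem_disc)
    show "norm (H z) \<le> 2 * pi * (circ_mean p f s powr (1 / p) * circ_mean p f r powr (1 / q))"
      if "z \<in> frontier (cball 0 s)" for z
    proof -
      have "norm z = s" "z \<in> disc" using that rs rs' by (auto simp: frontier_cball mem_disc)
      then show ?thesis using Hb[of z] by simp
    qed
  qed (use rs in auto)
  then have "circ_mean p f r \<le> circ_mean p f s powr (1 / p) * circ_mean p f r powr (1 / q)"
    unfolding Hr by (simp add: norm_mult mult.assoc)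
  also have "circ_mean p f r powr (1 / q) = circ_mean p f r * circ_mean p f r powr (- (1 / p))"
    using p rs' by (subst powr_mult_base) (auto simp: q_def field_simps)
  finally have "1 \<le> circ_mean p f s powr (1 / p) * circ_mean p f r powr (- (1 / p))"
    using rs' by (simp add: field_simps)
  then have "circ_mean p f r powr (1 / p) \<le> circ_mean p f s powr (1 / p)"
    using rs' by (simp add: powr_minus field_simps)
  then have "(circ_mean p f r powr (1 / p)) powr p \<le> (circ_mean p f s powr (1 / p)) powr p"
    using p by - (rule powr_mono2; simp)
  moreover have "0 < p" using p by simp
  ultimately show ?thesis by (simp only: powr_inverse_powr circ_mean_nonneg)
qed (use circ_mean_nonneg in auto)

abbreviation ann_int :: "real \<Rightarrow> (complex \<Rightarrow> complex) \<Rightarrow> real \<Rightarrow> real" where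
  "ann_int p f r \<equiv> LINT z:ann r|area. norm (f z) powr p"

text \<open>By polar averaging |f|^p may be replaced on the annulus by its circular means, all at
  most B, and the annulus has measure 1 - r^2. Integrability comes out of the same estimate, as the
  integral is taken in the extended sense.\<close>

lemma ann_integral_upper:
  assumes p: "0 < p" and f: "continuous_on disc f" and r: "0 \<le> r" "r < 1" and B: "\<And>s. r \<le> s \<Longrightarrow> s < 1 \<Longrightarrow> circ_mean p f s \<le> B"
  shows "set_integrable area (ann r) (\<lambda>z. norm (f z) powr p)"
    and "(ann_int p f r) \<le> (1 - r\<^sup>2) * B"
proof -
  have B0: "0 \<le> B" using B[of r] r circ_mean_nonneg[of p f r] by linarith
  have [measurable]: "(\<lambda>z. norm (f z) powr p) \<in> borel_measurable area"
    using f p by (intro borel_measurable_area_continuous continuous_on_norm_powr)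
  have "(\<integral>\<^sup>+z. ennreal (indicator (ann r) z * norm (f z) powr p) \<partial>area) = (\<integral>\<^sup>+z. indicator (ann r) z * ennreal (norm (f z) powr p) \<partial>area)"
    by (intro nn_integral_cong) (simp add: indicator_def)
  also have "\<dots> = (\<integral>\<^sup>+z. indicator (ann r) z * ennreal (circ_mean p f (norm z)) \<partial>area)"
    unfolding circ_mean_def using f p by (intro nn_integral_area_polar continuous_on_norm_powr) auto
  also have "\<dots> \<le> (\<integral>\<^sup>+z. ennreal B * indicator (ann r) z \<partial>area)"
    by (intro nn_integral_mono) (auto simp: indicator_def ann_def intro!: ennreal_leI B)
  also have "\<dots> = ennreal B * emeasure area (ann r)" by (rule nn_integral_cmult_indicator) simp
  also have "\<dots> = ennreal ((1 - r\<^sup>2) * B)"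
    using r B0 by (simp add: area.emeasure_eq_measure measure_area_ann ennreal_mult' mult.commute)
  finally have le: "(\<integral>\<^sup>+z. ennreal (indicator (ann r) z * norm (f z) powr p) \<partial>area) \<le> ennreal ((1 - r\<^sup>2) * B)" .
  show i: "set_integrable area (ann r) (\<lambda>z. norm (f z) powr p)"
    unfolding set_integrable_def using le
    by (intro integrableI_nonneg) (auto simp: top_unique intro: le_less_trans)
  have "ennreal (ann_int p f r) \<le> ennreal ((1 - r\<^sup>2) * B)"
    using i le unfolding set_integrable_def set_lebesgue_integral_def
    by (subst nn_integral_eq_integral[symmetric]) auto
  then show "(ann_int p f r) \<le> (1 - r\<^sup>2) * B"
    using r B0 by (subst (asm) ennreal_le_iff) (auto simp: power_le_one)
qed

text \<open>Means increase with the radius, so on the annulus they are at least the mean at r. This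
  is how area integrals control integral means.\<close>

lemma ann_integral_lower:
  assumes p: "1 < p" and f: "f holomorphic_on disc" and r: "0 \<le> r" "r < 1"
    and i: "set_integrable area (ann r) (\<lambda>z. norm (f z) powr p)"
  shows "(1 - r\<^sup>2) * circ_mean p f r \<le> (ann_int p f r)"
proof -
  have cf: "continuous_on disc f" using f by (rule holomorphic_on_imp_continuous_on)
  have "ennreal ((1 - r\<^sup>2) * circ_mean p f r) = ennreal (circ_mean p f r) * emeasure area (ann r)"
    using r by (simp add: area.emeasure_eq_measure measure_area_ann ennreal_mult' mult.commute)
  also have "\<dots> = (\<integral>\<^sup>+z. ennreal (circ_mean p f r) * indicator (ann r) z \<partial>area)"
    by (rule nn_integral_cmult_indicator[symmetric]) simp
  also have "\<dots> \<le> (\<integral>\<^sup>+z. indicator (ann r) z * ennreal (circ_mean p f (norm z)) \<partial>area)"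
    using r by (intro nn_integral_mono) (auto simp: indicator_def ann_def intro!: ennreal_leI circ_mean_mono p f)
  also have "\<dots> = (\<integral>\<^sup>+z. indicator (ann r) z * ennreal (norm (f z) powr p) \<partial>area)"
    unfolding circ_mean_def using cf p by (intro nn_integral_area_polar[symmetric] continuous_on_norm_powr) auto
  also have "\<dots> = (\<integral>\<^sup>+z. ennreal (indicator (ann r) z * norm (f z) powr p) \<partial>area)"
    by (intro nn_integral_cong) (simp add: indicator_def)
  also have "\<dots> = ennreal (ann_int p f r)"
    using i unfolding set_integrable_def set_lebesgue_integral_def
    by (subst nn_integral_eq_integral) auto
  finally show ?thesis
    by (subst (asm) ennreal_le_iff) (auto simp: set_lebesgue_integral_def)
qed

section \<open>Bergman and Hardy spaces\<close>

lemma norm_powr_add_le: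
  fixes a b :: complex
  assumes "1 \<le> p"
  shows "norm (a + b) powr p \<le> 2 powr (p - 1) * (norm a powr p + norm b powr p)"
proof -
  have "norm (a + b) powr p \<le> (norm a + norm b) powr p"
    using assms by (intro powr_mono2 norm_triangle_ineq) auto
  also have "\<dots> \<le> 2 powr (p - 1) * (norm a powr p + norm b powr p)"
    using assms by (intro powr_add_le) auto
  finally show ?thesis .
qed

lemma integrable_norm_powr_add:
  fixes f g :: "'a \<Rightarrow> complex"
  assumes "1 \<le> p" and [measurable]: "f \<in> borel_measurable M" "g \<in> borel_measurable M"
    and "integrable M (\<lambda>x. norm (f x) powr p)" "integrable M (\<lambda>x. norm (g x) powr p)"
  shows "integrable M (\<lambda>x. norm (f x + g x) powr p)"
  by (rule Bochner_Integration.integrable_bound[of M "\<lambda>x. 2 powr (p - 1) * (norm (f x) powr p + norm (g x) powr p)"])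
    (use assms(4,5) in \<open>auto intro!: AE_I2 norm_powr_add_le[OF assms(1)] simp: abs_of_nonneg\<close>)

lemma integrable_norm_powr_cmult:
  fixes f :: "'a \<Rightarrow> complex"
  assumes "integrable M (\<lambda>x. norm (f x) powr p)"
  shows "integrable M (\<lambda>x. norm (c * f x) powr p)"
  using assms by (simp add: norm_mult powr_mult)

lemma borel_measurable_cnj: "f \<in> borel_measurable M \<Longrightarrow> (\<lambda>x. cnj (f x)) \<in> borel_measurable M"
  by (rule measurable_compose[OF _ borel_measurable_continuous_onI]) (auto intro: continuous_intros)

definition Ap_int :: "real \<Rightarrow> (complex \<Rightarrow> complex) \<Rightarrow> real" where
  "Ap_int p f = (\<integral>z. norm (f z) powr p \<partial>area)"

lemma Ap_int_nonneg [simp]: "0 \<le> Ap_int p f"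
  by (simp add: Ap_int_def)

lemma holomorphic_measurable: "f holomorphic_on disc \<Longrightarrow> f \<in> borel_measurable area"
  by (intro borel_measurable_area_continuous holomorphic_on_imp_continuous_on)

lemma in_Ap_iff: "in_Ap p f \<longleftrightarrow> f holomorphic_on disc \<and> integrable area (\<lambda>z. norm (f z) powr p)"
proof (cases "f holomorphic_on disc")
  case True
  have [measurable]: "f \<in> borel_measurable area" using True by (rule holomorphic_measurable)
  have "(\<lambda>z. norm (f z) powr p) \<in> borel_measurable area" by measurable
  from integrable_area_iff[OF this] show ?thesis by (simp add: in_Ap_def)
qed (simp add: in_Ap_def)

lemma Ap_norm_eq: "f holomorphic_on disc \<Longrightarrow> Ap_norm p f = Ap_int p f powr (1 / p)"
  unfolding Ap_norm_def Ap_int_def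
  by (subst integral_area) (use holomorphic_measurable in auto)

lemma phi_eq:
  assumes "f holomorphic_on disc" "k holomorphic_on disc"
  shows "phi k f = (\<integral>z. f z * cnj (k z) \<partial>area)"
proof -
  have "(\<lambda>z. f z * cnj (k z)) \<in> borel_measurable area"
    using assms by (intro borel_measurable_area_continuous continuous_intros holomorphic_on_imp_continuous_on)
  from integral_area[OF this] show ?thesis by (simp add: phi_def scaleR_conv_of_real)
qed

lemma in_ApD:
  assumes "in_Ap p f"
  shows "f holomorphic_on disc" "f \<in> borel_measurable area" "integrable area (\<lambda>z. norm (f z) powr p)"
  using assms by (auto simp: in_Ap_iff holomorphic_measurable)

lemma in_Ap_add: "1 \<le> p \<Longrightarrow> in_Ap p f \<Longrightarrow> in_Ap p g \<Longrightarrow> in_Ap p (\<lambda>z. f z + g z)"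
  unfolding in_Ap_iff by (auto intro!: holomorphic_intros integrable_norm_powr_add holomorphic_measurable)

lemma in_Ap_cmult: "in_Ap p f \<Longrightarrow> in_Ap p (\<lambda>z. c * f z)"
  unfolding in_Ap_iff by (auto intro!: holomorphic_intros integrable_norm_powr_cmult)

lemma in_Ap_diff: "1 \<le> p \<Longrightarrow> in_Ap p f \<Longrightarrow> in_Ap p g \<Longrightarrow> in_Ap p (\<lambda>z. f z - g z)"
  using in_Ap_add[of p f "\<lambda>z. -1 * g z"] in_Ap_cmult[of p g "-1"] by simp

section \<open>The pairing of A^p and A^q\<close>

lemma phi_bound:
  assumes p: "1 < p" "q = p / (p - 1)" and f: "in_Ap p f" and k: "in_Ap q k"
  shows "integrable area (\<lambda>z. f z * cnj (k z))"
    and "norm (phi k f) \<le> Ap_int p f powr (1 / p) * Ap_int q k powr (1 / q)"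
proof -
  have m: "(\<lambda>z. cnj (k z)) \<in> borel_measurable area"
    using in_ApD[OF k] by (intro borel_measurable_area_continuous continuous_intros holomorphic_on_imp_continuous_on)
  show "integrable area (\<lambda>z. f z * cnj (k z))"
    using Holder_complex(1)[OF p in_ApD(2)[OF f] m in_ApD(3)[OF f]] in_ApD[OF k] by simp
  show "norm (phi k f) \<le> Ap_int p f powr (1 / p) * Ap_int q k powr (1 / q)"
    using Holder_complex(3)[OF p in_ApD(2)[OF f] m in_ApD(3)[OF f]] in_ApD[OF k] in_ApD[OF f]
    by (simp add: Ap_int_def phi_eq)
qed

lemma phi_linear:
  assumes p: "1 < p" "q = p / (p - 1)" and f: "in_Ap p f" and g: "in_Ap p g" and k: "in_Ap q k"
  shows "phi k (\<lambda>z. a * f z + b * g z) = a * phi k f + b * phi k g"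
proof -
  note i = phi_bound(1)[OF p f k] phi_bound(1)[OF p g k]
  have "phi k (\<lambda>z. a * f z + b * g z) = (\<integral>z. a * (f z * cnj (k z)) + b * (g z * cnj (k z)) \<partial>area)"
    using in_ApD[OF f] in_ApD[OF g] in_ApD[OF k] by (subst phi_eq) (auto intro!: holomorphic_intros simp: algebra_simps)
  also have "\<dots> = a * phi k f + b * phi k g"
    using i in_ApD[OF f] in_ApD[OF g] in_ApD[OF k] by (simp add: phi_eq)
  finally show ?thesis .
qed

lemma phi_diff:
  assumes "1 < p" "q = p / (p - 1)" "in_Ap p f" "in_Ap p g" "in_Ap q k"
  shows "phi k (\<lambda>z. f z - g z) = phi k f - phi k g"
  using phi_linear[OF assms, of 1 "-1"] by simp

lemma phi_kernel_diff:
  assumes p: "1 < p" "q = p / (p - 1)" and f: "in_Ap p f" and k: "in_Ap q k" and l: "in_Ap q l"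
  shows "phi (\<lambda>z. k z - l z) f = phi k f - phi l f"
proof -
  note i = phi_bound(1)[OF p f k] phi_bound(1)[OF p f l]
  have "phi (\<lambda>z. k z - l z) f = (\<integral>z. f z * cnj (k z) - f z * cnj (l z) \<partial>area)"
    using in_ApD[OF f] in_ApD[OF l] in_ApD[OF k] by (subst phi_eq) (auto intro!: holomorphic_intros simp: algebra_simps)
  also have "\<dots> = phi k f - phi l f"
    using i in_ApD[OF f] in_ApD[OF l] in_ApD[OF k] by (simp add: phi_eq)
  finally show ?thesis .
qed

section \<open>Hardy norm and integral means\<close>

lemma in_HpD:
  assumes "0 < p" "in_Hp p f"
  shows "f holomorphic_on disc" "continuous_on disc f"
  using assms by (auto simp: in_Hp_def holomorphic_on_imp_continuous_on)

lemma circ_mean_le_Hp_norm: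
  assumes p: "1 < p" and f: "in_Hp p f" and r: "0 \<le> r" "r < 1"
  shows "circ_mean p f r \<le> Hp_norm p f powr p"
proof -
  \<comment> \<open>The supremum in the norm runs over 0 < r < 1, whereas r = 0 is allowed here; s
    is an admissible radius at least r.\<close>
  define s where "s = (r + 1) / 2"
  have s: "s \<in> {0<..<1}" "r \<le> s" using r by (auto simp: s_def)
  have cf: "continuous_on disc f" using in_HpD[of p f] p f by auto
  have "circ_mean p f r \<le> circ_mean p f s" using p f r s by (intro circ_mean_mono) (auto simp: in_Hp_def)
  also have "\<dots> = (circ_mean p f s powr (1 / p)) powr p" using p by (simp add: powr_powr)
  also have "circ_mean p f s powr (1 / p) = Hp_mean p f s" using s p by (intro Hp_mean_eq[symmetric] cf) auto
  also have "\<dots> powr p \<le> Hp_norm p f powr p"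
    using f s p unfolding Hp_norm_def in_Hp_def
    by (intro powr_mono2 cSUP_upper) (auto simp: Hp_mean_def)
  finally show ?thesis .
qed

lemma in_HpI:
  assumes p: "1 < p" and f: "f holomorphic_on disc" and B: "\<And>r. 0 < r \<Longrightarrow> r < 1 \<Longrightarrow> circ_mean p f r \<le> B"
  shows "in_Hp p f" "Hp_norm p f \<le> B powr (1 / p)"
proof -
  have cf: "continuous_on disc f" using f by (rule holomorphic_on_imp_continuous_on)
  have le: "Hp_mean p f r \<le> B powr (1 / p)" if "r \<in> {0<..<1}" for r
    using that p B[of r] by (subst Hp_mean_eq[OF cf]) (auto intro!: powr_mono2)
  then show "in_Hp p f" using f by (auto simp: in_Hp_def intro!: bdd_aboveI2[where M="B powr (1 / p)"])
  show "Hp_norm p f \<le> B powr (1 / p)" unfolding Hp_norm_def by (intro cSUP_least le) auto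
qed

lemma Hp_norm_nonneg:
  assumes "in_Hp p f" shows "0 \<le> Hp_norm p f"
proof -
  have "0 \<le> Hp_mean p f (1/2)" by (simp add: Hp_mean_def)
  also have "\<dots> \<le> Hp_norm p f" using assms unfolding Hp_norm_def in_Hp_def by (intro cSUP_upper) auto
  finally show ?thesis .
qed

lemma Hp_norm_powr_le:
  assumes p: "1 < p" and f: "f holomorphic_on disc" and B: "\<And>r. 0 < r \<Longrightarrow> r < 1 \<Longrightarrow> circ_mean p f r \<le> B"
  shows "Hp_norm p f powr p \<le> B"
proof -
  have "0 \<le> B" using B[of "1/2"] circ_mean_nonneg[of p f "1/2"] by linarith
  have "Hp_norm p f powr p \<le> (B powr (1 / p)) powr p"
    using p in_HpI[OF p f B] Hp_norm_nonneg[of p f] by (intro powr_mono2) auto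
  then show ?thesis using \<open>0 \<le> B\<close> p by (simp add: powr_powr)
qed

text \<open>The annulus of inner radius 0 is the whole disc, so statements about annuli specialise
  to A^p integrals.\<close>

lemma set_integrable_area_disc:
  "set_integrable area (ann 0) f \<longleftrightarrow> integrable area f" "(LINT z:ann 0|area. f z) = integral\<^sup>L area f"
  for f :: "complex \<Rightarrow> 'b::{banach, second_countable_topology}"
  unfolding set_integrable_def set_lebesgue_integral_def
  by (auto intro!: Bochner_Integration.integrable_cong Bochner_Integration.integral_cong simp: ann_def indicator_def mem_disc)

lemma in_Hp_imp_in_Ap:
  assumes p: "1 < p" and f: "in_Hp p f"
  shows "in_Ap p f" "Ap_int p f \<le> Hp_norm p f powr p"
proof -
  have a: "0 < p" "continuous_on disc f" "f holomorphic_on disc" using p f in_HpD[of p f] by auto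
  have B: "circ_mean p f s \<le> Hp_norm p f powr p" if "0 \<le> s" "s < 1" for s
    using that p f by (intro circ_mean_le_Hp_norm)
  from ann_integral_upper[OF a(1,2), of 0 "Hp_norm p f powr p"] B a
  show "in_Ap p f" "Ap_int p f \<le> Hp_norm p f powr p"
    by (auto simp: set_integrable_area_disc in_Ap_iff Ap_int_def)
qed

lemma circ_mean_cmult: "circ_mean p (\<lambda>z. c * f z) r = norm c powr p * circ_mean p f r"
  by (simp add: circ_mean_def norm_mult powr_mult)

lemma circ_mean_add_le:
  assumes p: "1 < p" and "continuous_on disc f" "continuous_on disc g" "0 \<le> r" "r < 1"
  shows "circ_mean p (\<lambda>z. f z + g z) r \<le> 2 powr (p - 1) * (circ_mean p f r + circ_mean p g r)"
proof -
  note i = integrable_circ_mean[of _ r p]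
  have "circ_mean p (\<lambda>z. f z + g z) r \<le>
     (\<integral>t. 2 powr (p - 1) * (norm (f (of_real r * cis t)) powr p + norm (g (of_real r * cis t)) powr p) \<partial>circle)"
    unfolding circ_mean_def using assms p
    by (intro integral_mono i[of "\<lambda>z. f z + g z"] norm_powr_add_le integrable_mult_right Bochner_Integration.integrable_add i continuous_intros) auto
  also have "\<dots> = 2 powr (p - 1) * (circ_mean p f r + circ_mean p g r)"
    unfolding circ_mean_def using assms p i[of f] i[of g] by simp
  finally show ?thesis .
qed

lemma in_Hp_add:
  assumes p: "1 < p" and "in_Hp p f" "in_Hp p g"
  shows "in_Hp p (\<lambda>z. f z + g z)"
proof (rule in_HpI)
  fix r :: real assume r: "0 < r" "r < 1"
  have "circ_mean p (\<lambda>z. f z + g z) r \<le> 2 powr (p - 1) * (circ_mean p f r + circ_mean p g r)"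
    using assms r in_HpD[of p f] in_HpD[of p g] by (intro circ_mean_add_le) auto
  also have "\<dots> \<le> 2 powr (p - 1) * (Hp_norm p f powr p + Hp_norm p g powr p)"
    using assms r by (intro mult_left_mono add_mono circ_mean_le_Hp_norm) auto
  finally show "circ_mean p (\<lambda>z. f z + g z) r \<le> 2 powr (p - 1) * (Hp_norm p f powr p + Hp_norm p g powr p)" .
qed (use assms in \<open>auto simp: in_Hp_def intro!: holomorphic_intros\<close>)

lemma in_Hp_cmult:
  assumes p: "1 < p" and "in_Hp p f"
  shows "in_Hp p (\<lambda>z. c * f z)"
proof (rule in_HpI)
  fix r :: real assume r: "0 < r" "r < 1"
  show "circ_mean p (\<lambda>z. c * f z) r \<le> norm c powr p * Hp_norm p f powr p"
    unfolding circ_mean_cmult using assms r by (intro mult_left_mono circ_mean_le_Hp_norm) auto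
qed (use assms in \<open>auto simp: in_Hp_def intro!: holomorphic_intros\<close>)

lemma in_Hp_diff: "1 < p \<Longrightarrow> in_Hp p f \<Longrightarrow> in_Hp p g \<Longrightarrow> in_Hp p (\<lambda>z. f z - g z)"
  using in_Hp_add[of p f "\<lambda>z. -1 * g z"] in_Hp_cmult[of p g "-1"] by simp

text \<open>The measure is left open: \<open>area\<close> gives convergence in A^p,
  \<open>circle\<close> gives estimates of integral means.\<close>

lemma integral_uniform_convexity:
  fixes f g :: "'a \<Rightarrow> complex"
  assumes p: "1 < p"
    and K: "\<And>a b :: complex. norm (a - b) powr p \<le> e * (norm a powr p + norm b powr p)
        + K * ((norm a powr p + norm b powr p) / 2 - norm ((a + b) / 2) powr p)"
    and m: "f \<in> borel_measurable M" "g \<in> borel_measurable M"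
    and i: "integrable M (\<lambda>x. norm (f x) powr p)" "integrable M (\<lambda>x. norm (g x) powr p)"
  shows "(\<integral>x. norm (f x - g x) powr p \<partial>M)
    \<le> e * ((\<integral>x. norm (f x) powr p \<partial>M) + (\<integral>x. norm (g x) powr p \<partial>M))
      + K * (((\<integral>x. norm (f x) powr p \<partial>M) + (\<integral>x. norm (g x) powr p \<partial>M)) / 2
        - (\<integral>x. norm ((f x + g x) / 2) powr p \<partial>M))"
proof -
  have h: "integrable M (\<lambda>x. norm ((f x + g x) / 2) powr p)"
    using integrable_norm_powr_cmult[OF integrable_norm_powr_add[OF _ m i], of "1/2"] p by simp
  have "integrable M (\<lambda>x. norm (-1 * g x) powr p)" using i(2) by (rule integrable_norm_powr_cmult)
  then have "integrable M (\<lambda>x. norm (f x + -1 * g x) powr p)"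
    using p m by (intro integrable_norm_powr_add i(1)) auto
  then have d: "integrable M (\<lambda>x. norm (f x - g x) powr p)" by simp
  have "(\<integral>x. norm (f x - g x) powr p \<partial>M) \<le> (\<integral>x. e * (norm (f x) powr p + norm (g x) powr p)
        + K * ((norm (f x) powr p + norm (g x) powr p) / 2 - norm ((f x + g x) / 2) powr p) \<partial>M)"
    using i h d by (intro integral_mono K) auto
  also have "\<dots> = e * ((\<integral>x. norm (f x) powr p \<partial>M) + (\<integral>x. norm (g x) powr p \<partial>M))
      + K * (((\<integral>x. norm (f x) powr p \<partial>M) + (\<integral>x. norm (g x) powr p \<partial>M)) / 2
        - (\<integral>x. norm ((f x + g x) / 2) powr p \<partial>M))"
    using i h by simp
  finally show ?thesis .
qed

lemma circ_mean_uniform_convexity: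
  assumes p: "1 < p"
    and K: "\<And>a b :: complex. norm (a - b) powr p \<le> e * (norm a powr p + norm b powr p)
        + K * ((norm a powr p + norm b powr p) / 2 - norm ((a + b) / 2) powr p)"
    and fg: "continuous_on disc f" "continuous_on disc g" and r: "0 \<le> r" "r < 1"
  shows "circ_mean p (\<lambda>z. f z - g z) r \<le> e * (circ_mean p f r + circ_mean p g r)
      + K * ((circ_mean p f r + circ_mean p g r) / 2 - circ_mean p (\<lambda>z. (f z + g z) / 2) r)"
  unfolding circ_mean_def
  using p fg r by (intro integral_uniform_convexity[OF p K] borel_measurable_circle_continuous
    integrable_circ_mean continuous_on_disc_circle) auto

section \<open>Rotations and dilations in A^p\<close>

lemma holomorphic_on_mult_arg:
  assumes "f holomorphic_on disc" "norm u \<le> 1"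
  shows "(\<lambda>z. f (u * z)) holomorphic_on disc"
proof -
  have "(f \<circ> (\<lambda>z. u * z)) holomorphic_on disc"
    by (rule holomorphic_on_compose_gen[OF _ assms(1)])
      (use assms in \<open>auto intro!: holomorphic_intros mult_mem_disc\<close>)
  then show ?thesis by (simp add: o_def)
qed

lemma in_Ap_rotate:
  assumes u: "norm u = 1" and f: "in_Ap p f"
  shows "in_Ap p (\<lambda>z. f (u * z))" "Ap_int p (\<lambda>z. f (u * z)) = Ap_int p f"
proof -
  have m: "(\<lambda>z. norm (f z) powr p) \<in> borel_measurable area" using in_ApD[OF f] by auto
  have "(\<lambda>z. f (u * z)) holomorphic_on disc"
    using in_ApD[OF f] u by (intro holomorphic_on_mult_arg) auto
  then show "in_Ap p (\<lambda>z. f (u * z))" "Ap_int p (\<lambda>z. f (u * z)) = Ap_int p f"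
    using integral_area_rotate[OF u m] in_ApD[OF f] by (auto simp: in_Ap_iff Ap_int_def)
qed

lemma in_Ap_dilate:
  assumes r: "0 < r" "r \<le> 1" and f: "in_Ap p f"
  shows "in_Ap p (\<lambda>z. f (of_real r * z))"
    and "r\<^sup>2 * Ap_int p (\<lambda>z. f (of_real r * z)) = (LINT z:ball 0 r|area. norm (f z) powr p)"
proof -
  have m: "(\<lambda>z. norm (f z) powr p) \<in> borel_measurable area" using in_ApD[OF f] by auto
  have "(\<lambda>z. f (of_real r * z)) holomorphic_on disc"
    using in_ApD[OF f] r by (intro holomorphic_on_mult_arg) auto
  moreover have "set_integrable area (ball 0 r) (\<lambda>z. norm (f z) powr p)"
    unfolding set_integrable_def using r in_ApD[OF f]
    by (intro integrable_mult_indicator ball_sets) auto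
  ultimately show "in_Ap p (\<lambda>z. f (of_real r * z))"
    using integral_area_dilate(2)[OF r m] by (auto simp: in_Ap_iff)
  show "r\<^sup>2 * Ap_int p (\<lambda>z. f (of_real r * z)) = (LINT z:ball 0 r|area. norm (f z) powr p)"
    using integral_area_dilate(1)[OF r m] by (simp add: Ap_int_def)
qed

lemma integral_area_split:
  fixes f :: "complex \<Rightarrow> 'b::{banach, second_countable_topology}"
  assumes "integrable area f" "r \<le> 1"
  shows "integral\<^sup>L area f = (LINT z:ball 0 r|area. f z) + (LINT z:ann r|area. f z)"
    and "set_integrable area (ball 0 r) f" "set_integrable area (ann r) f"
proof -
  show i: "set_integrable area (ball 0 r) f" "set_integrable area (ann r) f"
    unfolding set_integrable_def using assms by (auto intro!: integrable_mult_indicator ball_sets)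
  have "integral\<^sup>L area f = (\<integral>z. indicator (ball 0 r) z *\<^sub>R f z + indicator (ann r) z *\<^sub>R f z \<partial>area)"
    by (intro Bochner_Integration.integral_cong) (auto simp: indicator_def ann_def mem_disc)
  also have "\<dots> = (LINT z:ball 0 r|area. f z) + (LINT z:ann r|area. f z)"
    using i unfolding set_integrable_def set_lebesgue_integral_def by (rule Bochner_Integration.integral_add)
  finally show "integral\<^sup>L area f = (LINT z:ball 0 r|area. f z) + (LINT z:ann r|area. f z)" .
qed

lemma ann_Holder:
  fixes f g :: "complex \<Rightarrow> complex"
  assumes pq: "1 < p" "q = p / (p - 1)" and f: "in_Ap p f" and k: "in_Ap q k"
  shows "norm (LINT z:ann r|area. f z * cnj (k z))
    \<le> (ann_int p f r) powr (1 / p) * (ann_int q k r) powr (1 / q)"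
proof -
  define F where "F z = indicator (ann r) z *\<^sub>R f z" for z
  define G where "G z = indicator (ann r) z *\<^sub>R cnj (k z)" for z
  have i: "(\<lambda>z. indicator (ann r) z) \<in> borel_measurable area" by simp
  have m: "F \<in> borel_measurable area" "G \<in> borel_measurable area"
    unfolding F_def G_def using in_ApD[OF f] in_ApD[OF k]
    by (auto intro!: borel_measurable_scaleR borel_measurable_cnj)
  have e: "norm (F z) powr p = indicator (ann r) z *\<^sub>R (norm (f z) powr p)"
     "norm (G z) powr q = indicator (ann r) z *\<^sub>R (norm (k z) powr q)"
     "F z * G z = indicator (ann r) z *\<^sub>R (f z * cnj (k z))" for z
    by (auto simp: F_def G_def indicator_def)
  have "integrable area (\<lambda>z. norm (F z) powr p)" "integrable area (\<lambda>z. norm (G z) powr q)"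
    unfolding e using in_ApD[OF f] in_ApD[OF k] by (intro integrable_mult_indicator; simp)+
  from Holder_complex(3)[OF pq m this] show ?thesis
    unfolding e set_lebesgue_integral_def .
qed

section \<open>Dilations are self-adjoint\<close>

lemma taylor_disc:
  assumes "f holomorphic_on disc"
  obtains a where "\<And>z. z \<in> disc \<Longrightarrow> (\<lambda>n. a n * z ^ n) sums f z"
    and "\<And>s. 0 \<le> s \<Longrightarrow> s < 1 \<Longrightarrow> summable (\<lambda>n. norm (a n) * s ^ n)"
proof
  define a where "a n = (deriv ^^ n) f 0 / fact n" for n
  show s: "(\<lambda>n. a n * z ^ n) sums f z" if "z \<in> disc" for z
    using holomorphic_power_series[of f 0 1 z] assms that by (simp add: disc_def a_def)
  show "summable (\<lambda>n. norm (a n) * s ^ n)" if "0 \<le> s" "s < 1" for s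
  proof -
    have "summable (\<lambda>n. a n * complex_of_real ((s + 1) / 2) ^ n)"
      by (rule sums_summable[OF s]) (use that in \<open>auto simp: mem_disc\<close>)
    from powser_insidea[OF this, of "of_real s"] that show ?thesis
      by (simp add: norm_mult norm_power)
  qed
qed

lemma integrable_area_bounded:
  fixes f :: "complex \<Rightarrow> 'b::{banach, second_countable_topology}"
  assumes "f \<in> borel_measurable area" "\<And>z. z \<in> disc \<Longrightarrow> norm (f z) \<le> B"
  shows "integrable area f"
  using assms by (intro area.integrable_const_bound[of _ B]) auto

text \<open>A rotation u with u^(i-j) = -1 preserves the integral and also changes its sign.\<close>

lemma area_monomials_orthogonal:
  assumes "i \<noteq> j" "s \<le> 1"
  shows "(LINT z:ball 0 s|area. z ^ i * cnj z ^ j) = 0"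
proof -
  define I where "I = (LINT z:ball 0 s|area. z ^ i * cnj z ^ j)"
  define h where "h z = indicator (ball 0 s) z *\<^sub>R (z ^ i * cnj z ^ j)" for z :: complex
  have m: "h \<in> borel_measurable area"
    unfolding h_def using assms
    by (intro borel_measurable_scaleR borel_measurable_area_continuous[of "\<lambda>z. z ^ i * cnj z ^ j"] continuous_intros
      borel_measurable_indicator ball_sets)
  define u where "u = cis (pi / (real i - real j))"
  have u': "cnj u = cis (- (pi / (real i - real j)))" by (simp add: u_def cis_cnj)
  have "u ^ i * cnj u ^ j = cis (real i * (pi / (real i - real j)) + real j * (- (pi / (real i - real j))))"
    unfolding u' unfolding u_def Complex.DeMoivre cis_mult ..
  also have "real i * (pi / (real i - real j)) + real j * (- (pi / (real i - real j))) = (real i - real j) * (pi / (real i - real j))"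
    by (simp add: left_diff_distrib diff_divide_distrib)
  also have "\<dots> = pi" using assms by simp
  finally have u1: "u ^ i * cnj u ^ j = -1" by simp
  have "h (u * z) = (u ^ i * cnj u ^ j) * h z" for z
    by (simp add: h_def indicator_def norm_mult u_def power_mult_distrib)
  then have hu: "h (u * z) = - h z" for z by (simp add: u1)
  have "(\<integral>z. h (u * z) \<partial>area) = (\<integral>z. h z \<partial>area)"
    by (intro integral_area_rotate m) (simp add: u_def)
  then have "- (\<integral>z. h z \<partial>area) = (\<integral>z. h z \<partial>area)" unfolding hu by simp
  then show ?thesis by (simp add: h_def set_lebesgue_integral_def)
qed

text \<open>On a ball of radius s < 1 the Taylor polynomials converge boundedly. For polynomials the
  difference of the two sides is a double sum with factors t^i - t^j: these vanish for i = j, and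
  orthogonality of monomials removes the other terms.\<close>

lemma set_integral_dilate_adjoint:
  assumes f: "f holomorphic_on disc" and g: "g holomorphic_on disc" and s: "0 \<le> s" "s < 1" and t: "0 \<le> t" "t \<le> 1"
  shows "(LINT z:ball 0 s|area. f (of_real t * z) * cnj (g z)) = (LINT z:ball 0 s|area. f z * cnj (g (of_real t * z)))"
proof -
  obtain a where a: "\<And>z. z \<in> disc \<Longrightarrow> (\<lambda>n. a n * z ^ n) sums f z" "summable (\<lambda>n. norm (a n) * s ^ n)"
    using taylor_disc[OF f] s by metis
  obtain b where b: "\<And>z. z \<in> disc \<Longrightarrow> (\<lambda>n. b n * z ^ n) sums g z" "summable (\<lambda>n. norm (b n) * s ^ n)"
    using taylor_disc[OF g] s by metis
  define P where "P n z = (\<Sum>i<n. a i * z ^ i)" for n z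
  define Q where "Q n z = (\<Sum>i<n. b i * z ^ i)" for n z
  define A where "A = (\<Sum>n. norm (a n) * s ^ n)"
  define B where "B = (\<Sum>n. norm (b n) * s ^ n)"
  have partial: "norm (\<Sum>i<n. c i * z ^ i) \<le> (\<Sum>n. norm (c n) * s ^ n)"
    if "summable (\<lambda>n. norm (c n) * s ^ n)" "norm z \<le> s" for c :: "nat \<Rightarrow> complex" and n z
  proof -
    have "norm (\<Sum>i<n. c i * z ^ i) \<le> (\<Sum>i<n. norm (c i) * s ^ i)"
      using that(2) by (intro order_trans[OF norm_sum] sum_mono)
        (auto simp: norm_mult norm_power intro!: mult_left_mono power_mono)
    also have "\<dots> \<le> (\<Sum>n. norm (c n) * s ^ n)" using s by (intro sum_le_suminf that(1)) auto
    finally show ?thesis .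
  qed
  have PA: "norm (P n z) \<le> A" and QB: "norm (Q n z) \<le> B" if "norm z \<le> s" for n z
    unfolding P_def Q_def A_def B_def using that by (auto intro!: partial a(2) b(2))
  have P: "(\<lambda>n. P n z) \<longlonglongrightarrow> f z" and Q: "(\<lambda>n. Q n z) \<longlonglongrightarrow> g z" if "z \<in> disc" for z
    using a(1)[OF that] b(1)[OF that] by (auto simp: sums_def P_def Q_def)
  have ts: "norm (of_real t * z) \<le> s" if "norm z \<le> s" for z :: complex
  proof -
    have "t * norm z \<le> 1 * s" using that t s by (intro mult_mono) auto
    then show ?thesis using t by (simp add: norm_mult)
  qed
  have td: "of_real t * z \<in> disc" if "z \<in> disc" for z using that t by (intro mult_mem_disc) auto
  let ?G = "\<lambda>n z. indicator (ball 0 s) z *\<^sub>R (P n (of_real t * z) * cnj (Q n z) - P n z * cnj (Q n (of_real t * z)))"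
  let ?g = "\<lambda>z. indicator (ball 0 s) z *\<^sub>R (f (of_real t * z) * cnj (g z) - f z * cnj (g (of_real t * z)))"
  have bi: "indicator (ball 0 s) \<in> borel_measurable area"
    using s by (intro borel_measurable_indicator ball_sets) auto
  have ft: "(\<lambda>z. f (of_real t * z)) holomorphic_on disc" "(\<lambda>z. g (of_real t * z)) holomorphic_on disc"
    using t f g by (auto intro!: holomorphic_on_mult_arg)
  have m1: "(\<lambda>z. f (of_real t * z) * cnj (g z)) \<in> borel_measurable area"
    using ft f g by (intro borel_measurable_times borel_measurable_cnj holomorphic_measurable)
  have m2: "(\<lambda>z. f z * cnj (g (of_real t * z))) \<in> borel_measurable area"
    using ft f g by (intro borel_measurable_times borel_measurable_cnj holomorphic_measurable)
  have "(\<lambda>n. integral\<^sup>L area (?G n)) \<longlonglongrightarrow> integral\<^sup>L area ?g"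
  proof (rule integral_dominated_convergence[where w="\<lambda>_. A * B + A * B"])
    show "?g \<in> borel_measurable area" using m1 m2 bi by (intro borel_measurable_scaleR borel_measurable_diff)
    show "?G n \<in> borel_measurable area" for n
      unfolding P_def Q_def
      by (intro borel_measurable_scaleR bi borel_measurable_area_continuous continuous_intros)
    show "AE z in area. (\<lambda>n. ?G n z) \<longlonglongrightarrow> ?g z"
      by (intro AE_I2 tendsto_intros P Q) (auto intro!: td)
    show "AE z in area. norm (?G n z) \<le> A * B + A * B" for n
    proof (intro AE_I2)
      fix z
      show "norm (?G n z) \<le> A * B + A * B"
      proof (cases "norm z < s")
        case True
        then have z: "norm z \<le> s" by simp
        have "norm (P n (of_real t * z) * cnj (Q n z)) \<le> A * B"
          using PA[OF ts[OF z]] QB[OF z] by (simp add: norm_mult mult_mono')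
        moreover have "norm (P n z * cnj (Q n (of_real t * z))) \<le> A * B"
          using PA[OF z] QB[OF ts[OF z]] by (simp add: norm_mult mult_mono')
        ultimately show ?thesis using norm_triangle_ineq4 by (smt (verit) True dist_0_norm indicator_simps(1) mem_ball scaleR_one)
      next
        case False
        have "0 \<le> A" "0 \<le> B" using PA[of 0 0] QB[of 0 0] s by (auto simp: P_def Q_def)
        then show ?thesis using False by simp
      qed
    qed
  qed auto
  moreover have "integral\<^sup>L area (?G n) = 0" for n
  proof -
    have mono: "set_integrable area (ball 0 s) (\<lambda>z. z ^ i * cnj z ^ j)" for i j
      unfolding set_integrable_def
    proof (rule integrable_area_bounded[of _ 1])
      show "(\<lambda>z. indicator (ball 0 s) z *\<^sub>R (z ^ i * cnj z ^ j)) \<in> borel_measurable area"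
        by (intro borel_measurable_scaleR bi borel_measurable_area_continuous continuous_intros)
      show "norm (indicator (ball 0 s) z *\<^sub>R (z ^ i * cnj z ^ j)) \<le> 1" if "z \<in> disc" for z :: complex
        using that by (auto simp: indicator_def mem_disc norm_mult norm_power intro!: mult_le_one power_le_one)
    qed
    define X where "X i j z = indicator (ball 0 s) z *\<^sub>R (z ^ i * cnj z ^ j)" for i j and z :: complex
    have PQ: "P n x * cnj (Q n y) = (\<Sum>i<n. \<Sum>j<n. a i * cnj (b j) * (x ^ i * cnj y ^ j))" for x y
      unfolding P_def Q_def cnj_sum sum_product by (intro sum.cong refl) (simp add: ac_simps)
    have "?G n = (\<lambda>z. \<Sum>i<n. \<Sum>j<n. (a i * cnj (b j) * (of_real t ^ i - of_real t ^ j)) * (indicator (ball 0 s) z *\<^sub>R (z ^ i * cnj z ^ j)))"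
    proof (rule ext)
      fix z
      have "P n (of_real t * z) * cnj (Q n z) - P n z * cnj (Q n (of_real t * z))
        = (\<Sum>i<n. \<Sum>j<n. (a i * cnj (b j) * (of_real t ^ i - of_real t ^ j)) * (z ^ i * cnj z ^ j))"
        unfolding PQ sum_subtractf[symmetric]
        by (intro sum.cong refl) (simp add: algebra_simps power_mult_distrib)
      then show "?G n z = (\<Sum>i<n. \<Sum>j<n. (a i * cnj (b j) * (of_real t ^ i - of_real t ^ j)) * (indicator (ball 0 s) z *\<^sub>R (z ^ i * cnj z ^ j)))"
        by (simp only: scaleR_sum_right mult_scaleR_right)
    qed
    then have G: "?G n = (\<lambda>z. \<Sum>i<n. \<Sum>j<n. (a i * cnj (b j) * (of_real t ^ i - of_real t ^ j)) * X i j z)"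
      by (simp only: X_def)
    have "integrable area (X i j)" "(LINT z:ball 0 s|area. z ^ i * cnj z ^ j) = integral\<^sup>L area (X i j)" for i j
      using mono[of i j] by (simp_all add: X_def[abs_def] set_integrable_def set_lebesgue_integral_def)
    then have "integral\<^sup>L area (?G n) = (\<Sum>i<n. \<Sum>j<n. (a i * cnj (b j) * (of_real t ^ i - of_real t ^ j)) * (LINT z:ball 0 s|area. z ^ i * cnj z ^ j))"
      unfolding G by simp
    also have "\<dots> = 0"
    proof (intro sum.neutral ballI)
      fix i j
      show "(a i * cnj (b j) * (of_real t ^ i - of_real t ^ j)) * (LINT z:ball 0 s|area. z ^ i * cnj z ^ j) = 0"
        using s area_monomials_orthogonal[of i j s] by (cases "i = j") auto
    qed
    finally show ?thesis .
  qed
  ultimately have z: "integral\<^sup>L area ?g = 0" by (simp add: LIMSEQ_const_iff)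
  have int: "set_integrable area (ball 0 s) h" if h: "continuous_on disc h" for h :: "complex \<Rightarrow> complex"
  proof -
    obtain C where C: "0 \<le> C" "\<And>z. norm z \<le> s \<Longrightarrow> norm (h z) \<le> C"
      using bounded_on_cball[OF h s(2)] by blast
    show ?thesis unfolding set_integrable_def
    proof (rule integrable_area_bounded[of _ C])
      show "(\<lambda>z. indicator (ball 0 s) z *\<^sub>R h z) \<in> borel_measurable area"
        using h by (intro borel_measurable_scaleR bi borel_measurable_area_continuous)
      show "norm (indicator (ball 0 s) z *\<^sub>R h z) \<le> C" if "z \<in> disc" for z
        using C(1) C(2)[of z] by (auto simp: indicator_def)
    qed
  qed
  note c = holomorphic_on_imp_continuous_on
  have "integral\<^sup>L area ?g = (LINT z:ball 0 s|area. f (of_real t * z) * cnj (g z)) - (LINT z:ball 0 s|area. f z * cnj (g (of_real t * z)))"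
    unfolding scaleR_diff_right set_lebesgue_integral_def
    using f g ft by (intro Bochner_Integration.integral_diff) (intro int[unfolded set_integrable_def] continuous_intros c; assumption)+
  with z show ?thesis by simp
qed

lemma set_integral_ball_tendsto:
  fixes h :: "complex \<Rightarrow> complex"
  assumes h: "integrable area h"
  shows "(\<lambda>n. LINT z:ball 0 (radius n)|area. h z) \<longlonglongrightarrow> integral\<^sup>L area h"
  unfolding set_lebesgue_integral_def
proof (rule integral_dominated_convergence[where w="\<lambda>z. norm (h z)"])
  show "(\<lambda>z. indicator (ball 0 (radius n)) z *\<^sub>R h z) \<in> borel_measurable area" for n
    using h radius(2)[of n] by (intro borel_measurable_scaleR borel_measurable_indicator ball_sets) auto
  show "AE z in area. (\<lambda>n. indicator (ball 0 (radius n)) z *\<^sub>R h z) \<longlonglongrightarrow> h z"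
  proof (intro AE_I2)
    fix z :: complex assume "z \<in> space area"
    then have z: "norm z < 1" by (simp add: mem_disc)
    have "\<forall>\<^sub>F n in sequentially. norm z < radius n"
      using order_tendstoD(1)[OF radius_tendsto z] .
    then have "\<forall>\<^sub>F n in sequentially. indicator (ball 0 (radius n)) z *\<^sub>R h z = h z"
      by eventually_elim (auto simp: indicator_def)
    then show "(\<lambda>n. indicator (ball 0 (radius n)) z *\<^sub>R h z) \<longlonglongrightarrow> h z"
      by (rule tendsto_eventually)
  qed
qed (use h in \<open>auto simp: indicator_def\<close>)

lemma phi_dilate_adjoint:
  assumes pq: "1 < p" "q = p / (p - 1)" and f: "in_Ap p f" and g: "in_Ap q g" and t: "0 < t" "t \<le> 1"
  shows "phi g (\<lambda>z. f (of_real t * z)) = phi (\<lambda>z. g (of_real t * z)) f"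
proof -
  note d = in_Ap_dilate(1)[OF t f] in_Ap_dilate(1)[OF t g]
  note hol = in_ApD(1)[OF f] in_ApD(1)[OF g] in_ApD(1)[OF d(1)] in_ApD(1)[OF d(2)]
  have "(\<lambda>n. LINT z:ball 0 (radius n)|area. f (of_real t * z) * cnj (g z))
      \<longlonglongrightarrow> phi g (\<lambda>z. f (of_real t * z))"
    using set_integral_ball_tendsto[OF phi_bound(1)[OF pq d(1) g]] hol by (simp add: phi_eq)
  moreover have "(\<lambda>n. LINT z:ball 0 (radius n)|area. f z * cnj (g (of_real t * z)))
      \<longlonglongrightarrow> phi (\<lambda>z. g (of_real t * z)) f"
    using set_integral_ball_tendsto[OF phi_bound(1)[OF pq f d(2)]] hol by (simp add: phi_eq)
  moreover have "(LINT z:ball 0 (radius n)|area. f (of_real t * z) * cnj (g z))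
    = (LINT z:ball 0 (radius n)|area. f z * cnj (g (of_real t * z)))" for n
    using t hol radius_pos[of n] radius(2)[of n] by (intro set_integral_dilate_adjoint) auto
  ultimately show ?thesis by (simp add: LIMSEQ_unique)
qed

text \<open>Self-adjointness lets half of the dilation, by sqrt r, move to the kernel. Both factors
  are then dilated alike, and a change of variables turns the dilation into a cut-off at radius sqrt
  r.\<close>

lemma phi_dilate_sqrt:
  assumes pq: "1 < p" "q = p / (p - 1)" and f: "in_Ap p f" and k: "in_Ap q k" and r: "0 < r" "r \<le> 1"
  shows "of_real r * phi k (\<lambda>z. f (of_real r * z)) = (LINT z:ball 0 (sqrt r)|area. f z * cnj (k z))"
proof -
  define s where "s = sqrt r"
  have s: "0 < s" "s \<le> 1" "s * s = r" using r by (auto simp: s_def)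
  have "phi k (\<lambda>z. f (of_real r * z)) = phi k (\<lambda>z. (\<lambda>w. f (of_real s * w)) (of_real s * z))"
    by (simp add: s(3)[symmetric] mult.assoc)
  also have "\<dots> = phi (\<lambda>z. k (of_real s * z)) (\<lambda>w. f (of_real s * w))"
    by (rule phi_dilate_adjoint[OF pq in_Ap_dilate(1)[OF s(1,2) f] k s(1,2)])
  also have "\<dots> = (\<integral>z. f (of_real s * z) * cnj (k (of_real s * z)) \<partial>area)"
    using in_ApD[OF f] in_ApD[OF k] s by (intro phi_eq holomorphic_on_mult_arg) auto
  finally have "of_real r * phi k (\<lambda>z. f (of_real r * z)) = s\<^sup>2 *\<^sub>R (\<integral>z. f (of_real s * z) * cnj (k (of_real s * z)) \<partial>area)"
    by (simp add: s(3)[symmetric] power2_eq_square scaleR_conv_of_real)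
  also have "\<dots> = (LINT z:ball 0 s|area. f z * cnj (k z))"
    by (rule integral_area_dilate(1)[OF s(1,2), of "\<lambda>z. f z * cnj (k z)"])
      (use in_ApD[OF f] in_ApD[OF k] in \<open>auto intro!: borel_measurable_times borel_measurable_cnj\<close>)
  finally show ?thesis by (simp add: s_def)
qed

lemma phi_minus_dilate:
  assumes pq: "1 < p" "q = p / (p - 1)" and f: "in_Ap p f" and k: "in_Ap q k" and r: "0 < r" "r \<le> 1"
  shows "phi k f - phi k (\<lambda>z. f (of_real r * z))
    = (LINT z:ann (sqrt r)|area. f z * cnj (k z)) - of_real (1 - r) * phi k (\<lambda>z. f (of_real r * z))"
  using integral_area_split(1)[OF phi_bound(1)[OF pq f k], of "sqrt r"] r phi_dilate_sqrt[OF assms]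
    in_ApD[OF f] in_ApD[OF k] by (simp add: phi_eq algebra_simps)

text \<open>Both terms of \<open>phi_minus_dilate\<close> are of order 1 - r, given a bound on the
  average of |f|^p over the annulus: the kernel contributes (1-r)^(1/q) because the annulus beyond
  sqrt r has measure exactly 1 - r. The 4 bounds the norm of the dilate: r >= 1/2 costs at most 4 in
  the integral, and 4^(1/p) <= 4.\<close>

lemma phi_minus_dilate_bound:
  assumes pq: "1 < p" "q = p / (p - 1)" and f: "in_Ap p f" and k: "in_Hp q k" and r: "1/2 \<le> r" "r < 1"
  shows "norm (phi k f - phi k (\<lambda>z. f (of_real r * z)))
    \<le> ((ann_int p f r) powr (1 / p) * (1 - r) powr (1 / q)
        + 4 * (1 - r) * Ap_int p f powr (1 / p)) * Hp_norm q k"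
proof -
  define \<kappa> where "\<kappa> = Hp_norm q k"
  have q: "1 < q" unfolding pq(2) using pq(1) by (simp add: field_simps)
  have kA: "in_Ap q k" "Ap_int q k \<le> \<kappa> powr q" using in_Hp_imp_in_Ap[OF q k] by (auto simp: \<kappa>_def)
  have \<kappa>: "0 \<le> \<kappa>" using Hp_norm_nonneg[OF k] by (simp add: \<kappa>_def)
  have r': "0 < r" "r \<le> 1" "0 \<le> sqrt r" "sqrt r < 1" using r by auto
  \<comment> \<open>For f the annulus is enlarged to inner radius r, the one in which the
    extremality estimate is phrased; for k the thinner one is kept.\<close>
  have rs: "r \<le> sqrt r" using r by (intro real_le_rsqrt) (auto simp: power2_eq_square mult_left_le)
  have "(ann_int p f (sqrt r)) \<le> (ann_int p f r)"
    using integral_area_split(3)[OF in_ApD(3)[OF f], of r] integral_area_split(3)[OF in_ApD(3)[OF f], of "sqrt r"] r rs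
    unfolding set_lebesgue_integral_def set_integrable_def
    by (intro integral_mono) (auto simp: indicator_def ann_def)
  then have 1: "(ann_int p f (sqrt r)) powr (1 / p) \<le> (ann_int p f r) powr (1 / p)"
    using pq by (intro powr_mono2) (auto simp: set_lebesgue_integral_def)
  have "(ann_int q k (sqrt r)) \<le> (1 - (sqrt r)\<^sup>2) * \<kappa> powr q"
    unfolding \<kappa>_def using q k r' in_HpD[of q k]
    by (intro ann_integral_upper(2) circ_mean_le_Hp_norm) (auto intro: order_trans[OF r'(3)])
  then have "(ann_int q k (sqrt r)) powr (1 / q) \<le> ((1 - r) * \<kappa> powr q) powr (1 / q)"
    using q r by (intro powr_mono2) (auto simp: set_lebesgue_integral_def)
  also have "\<dots> = (1 - r) powr (1 / q) * \<kappa>" using r \<kappa> q by (simp add: powr_mult powr_powr)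
  finally have 2: "(ann_int q k (sqrt r)) powr (1 / q) \<le> (1 - r) powr (1 / q) * \<kappa>" .
  have "norm (LINT z:ann (sqrt r)|area. f z * cnj (k z))
     \<le> (ann_int p f r) powr (1 / p) * ((1 - r) powr (1 / q) * \<kappa>)"
    by (rule order_trans[OF ann_Holder[OF pq f kA(1)] mult_mono[OF 1 2]]) auto
  moreover have "norm (phi k (\<lambda>z. f (of_real r * z))) \<le> 4 * Ap_int p f powr (1 / p) * \<kappa>"
  proof -
    have "r\<^sup>2 * Ap_int p (\<lambda>z. f (of_real r * z)) \<le> Ap_int p f"
      using in_Ap_dilate(2)[OF r'(1,2) f] integral_area_split(1)[OF in_ApD(3)[OF f] r'(2)]
      by (simp add: Ap_int_def set_lebesgue_integral_def)
    moreover have "(1/2)\<^sup>2 * Ap_int p (\<lambda>z. f (of_real r * z)) \<le> r\<^sup>2 * Ap_int p (\<lambda>z. f (of_real r * z))"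
      using r by (intro mult_right_mono power_mono) auto
    ultimately have "Ap_int p (\<lambda>z. f (of_real r * z)) \<le> 4 * Ap_int p f" by (simp add: power2_eq_square)
    then have "Ap_int p (\<lambda>z. f (of_real r * z)) powr (1 / p) \<le> (4 * Ap_int p f) powr (1 / p)"
      using pq by (intro powr_mono2) auto
    also have "\<dots> = 4 powr (1 / p) * Ap_int p f powr (1 / p)" by (simp add: powr_mult)
    also have "\<dots> \<le> 4 powr 1 * Ap_int p f powr (1 / p)"
      using pq by (intro mult_right_mono powr_mono) auto
    finally have a: "Ap_int p (\<lambda>z. f (of_real r * z)) powr (1 / p) \<le> 4 * Ap_int p f powr (1 / p)" by simp
    have b: "Ap_int q k powr (1 / q) \<le> \<kappa>"
      using powr_mono2[OF _ _ kA(2), of "1 / q"] q \<kappa> by (simp add: powr_powr)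
    show ?thesis
      by (rule order_trans[OF phi_bound(2)[OF pq in_Ap_dilate(1)[OF r'(1,2) f] kA(1)] mult_mono[OF a b]]) auto
  qed
  then have "norm (of_real (1 - r) * phi k (\<lambda>z. f (of_real r * z))) \<le> (1 - r) * (4 * Ap_int p f powr (1 / p) * \<kappa>)"
    unfolding norm_mult norm_of_real using r by (intro mult_mono) auto
  ultimately show ?thesis
    unfolding phi_minus_dilate[OF pq f kA(1) r'(1,2)]
    by (intro order_trans[OF norm_triangle_ineq4]) (simp add: algebra_simps flip: \<kappa>_def)
qed

section \<open>Extremal functions and the theorem of Ryabykh\<close>

lemma circ_mean_eq_0:
  assumes p: "0 < p" and f: "continuous_on disc f" and r: "0 \<le> r" "r < 1" and z: "circ_mean p f r = 0"
    and w: "norm w = r"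
  shows "f w = 0"
proof -
  let ?h = "\<lambda>t. norm (f (of_real r * cis t)) powr p"
  have c: "continuous_on {0..2 * pi} ?h"
    using p f r by (intro continuous_on_norm_powr continuous_on_disc_circle)
  have "integral {0..2 * pi} ?h = 0"
    using z integral_circle(2)[OF c] by (simp add: circ_mean_def)
  then have zero: "?h t = 0" if "t \<in> {0..2 * pi}" for t
    using integral_eq_0_iff[OF c] that by auto
  have "w = of_real r * cis (Arg2pi w)" "Arg2pi w \<in> {0..2 * pi}"
    using Arg2pi_eq[of w] Arg2pi_ge_0[of w] Arg2pi_lt_2pi[of w] w by (auto simp: cis_conv_exp)
  with zero[of "Arg2pi w"] show ?thesis by simp
qed

lemma Ap_int_eq_0:
  assumes p: "1 < p" and f: "in_Ap p f" and z: "Ap_int p f = 0" and w: "w \<in> disc"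
  shows "f w = 0"
proof -
  define r where "r = norm w"
  have r: "0 \<le> r" "r < 1" using w by (auto simp: r_def mem_disc)
  have "(1 - r\<^sup>2) * circ_mean p f r \<le> (ann_int p f r)"
    using in_ApD[OF f] integral_area_split(3)[OF in_ApD(3)[OF f], of r] r p by (intro ann_integral_lower) auto
  also have "\<dots> \<le> 0"
  proof -
    have "0 \<le> (LINT z:ball 0 r|area. norm (f z) powr p)" by (simp add: set_lebesgue_integral_def)
    then show ?thesis using integral_area_split(1)[OF in_ApD(3)[OF f], of r] r z unfolding Ap_int_def by linarith
  qed
  finally have "circ_mean p f r \<le> 0"
    using r abs_square_less_1[of r] by (simp add: mult_le_0_iff)
  then have "circ_mean p f r = 0" using circ_mean_nonneg[of p f r] by linarith
  then show ?thesis using p r in_ApD(1)[OF f]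
    by (intro circ_mean_eq_0[of p f r]) (auto simp: r_def holomorphic_on_imp_continuous_on)
qed

lemma in_Ap_dilate_strict:
  assumes f: "f holomorphic_on disc" and s: "0 \<le> s" "s < 1" and p: "0 < p"
  shows "in_Ap p (\<lambda>z. f (of_real s * z))"
proof -
  have h: "(\<lambda>z. f (of_real s * z)) holomorphic_on disc"
    using f s by (intro holomorphic_on_mult_arg) auto
  obtain C where C: "\<And>z. norm z \<le> s \<Longrightarrow> norm (f z) \<le> C"
    using bounded_on_cball[OF holomorphic_on_imp_continuous_on[OF f] s(2)] by metis
  have "integrable area (\<lambda>z. norm (f (of_real s * z)) powr p)"
  proof (rule integrable_area_bounded[of _ "C powr p"])
    show "(\<lambda>z. norm (f (of_real s * z)) powr p) \<in> borel_measurable area"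
      using holomorphic_measurable[OF h] by measurable
    show "norm (norm (f (of_real s * z)) powr p) \<le> C powr p" if "z \<in> disc" for z
      using that s p C[of "of_real s * z"] mult_left_le[of "norm z" s]
      by (auto simp: norm_mult mem_disc intro!: powr_mono2)
  qed
  with h show ?thesis by (simp add: in_Ap_iff)
qed

text \<open>Only k in A^q is assumed; membership of k in H^q enters with
  \<open>Ryabykh\<close>.\<close>

locale extremal_problem =
  fixes p q :: real and k F :: "complex \<Rightarrow> complex"
  assumes p: "1 < p" and q: "q = p / (p - 1)" and k_Ap: "in_Ap q k" and k_nz: "\<exists>z\<in>disc. k z \<noteq> 0"
    and ext: "Ap_extremal p k F"
begin

text \<open>The norm of the functional. The real part is taken because \<open>phi k F\<close> is
  seen to be real only through the Euler-Lagrange equation, in \<open>phi_F\<close>.\<close>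

definition N where "N = Re (phi k F)"

lemma q_gt_1: "1 < q" unfolding q using p by (simp add: field_simps)

lemma F_Ap: "in_Ap p F" using ext by (simp add: Ap_extremal_def)

lemma F_hol: "F holomorphic_on disc" using in_ApD[OF F_Ap] by simp

lemma Ap_int_F: "Ap_int p F = 1"
proof -
  have "Ap_int p F powr (1 / p) = 1" using ext F_hol by (simp add: Ap_extremal_def Ap_norm_eq)
  then have "(Ap_int p F powr (1 / p)) powr p = 1" by simp
  then show ?thesis using p powr_inverse_powr[of p "Ap_int p F"] by simp
qed

lemma Re_phi_le: assumes h: "in_Ap p h" shows "Re (phi k h) \<le> N * Ap_int p h powr (1 / p)"
proof (cases "Ap_int p h = 0")
  case True
  then show ?thesis using phi_bound(2)[OF p q h k_Ap] p by simp
next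
  case False
  define c where "c = Ap_int p h powr (1 / p)"
  have c: "0 < c" using False Ap_int_nonneg[of p h] by (simp add: c_def)
  define g where "g z = of_real (1 / c) * h z" for z
  have g: "in_Ap p g" unfolding g_def by (rule in_Ap_cmult[OF h])
  have "Ap_int p g = (1 / c) powr p * Ap_int p h"
    unfolding Ap_int_def g_def norm_mult norm_of_real using c by (simp add: powr_divide)
  also have "\<dots> = 1" using c p powr_inverse_powr[of p "Ap_int p h"] False by (simp add: powr_divide c_def)
  finally have g1: "Ap_norm p g = 1" using in_ApD(1)[OF g] by (simp add: Ap_norm_eq)
  have bdd: "bdd_above ((\<lambda>g. Re (phi k g)) ` {g. in_Ap p g \<and> Ap_norm p g = 1})"
  proof (rule bdd_aboveI2[where M="Ap_int q k powr (1 / q)"])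
    fix g assume "g \<in> {g. in_Ap p g \<and> Ap_norm p g = 1}"
    then have "in_Ap p g" "Ap_int p g powr (1 / p) = 1" using Ap_norm_eq[of g p] by (auto simp: in_Ap_iff)
    then show "Re (phi k g) \<le> Ap_int q k powr (1 / q)"
      using phi_bound(2)[OF p q _ k_Ap, of g] complex_Re_le_cmod[of "phi k g"] by simp
  qed
  have "Re (phi k g) \<le> (SUP g \<in> {g. in_Ap p g \<and> Ap_norm p g = 1}. Re (phi k g))"
    using g g1 bdd by (intro cSUP_upper) auto
  also have "\<dots> = N" using ext by (simp add: Ap_extremal_def N_def)
  finally have "Re (phi k g) \<le> N" .
  moreover have "phi k g = of_real (1 / c) * phi k h"
    using phi_linear[OF p q h h k_Ap, of "of_real (1 / c)" 0] by (simp add: g_def[abs_def])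
  ultimately show ?thesis using c by (simp add: field_simps flip: c_def)
qed

text \<open>The kernel may fail to lie in A^p, so the test function is k dilated twice by s. Moving
  one dilation across the pairing leaves the integral of |k(s z)|^2, which is positive because s
  exceeds the modulus of a point where k does not vanish.\<close>

lemma N_pos: "0 < N"
proof -
  obtain z0 where z0: "z0 \<in> disc" "k z0 \<noteq> 0" using k_nz by blast
  define s where "s = (norm z0 + 1) / 2"
  have s: "0 < s" "s < 1" "norm z0 < s" using z0 norm_ge_zero[of z0] by (simp_all add: s_def mem_disc add_nonneg_pos)
  define f where "f z = k (of_real s * z)" for z
  have k_hol: "k holomorphic_on disc" using in_ApD[OF k_Ap] by simp
  have f: "in_Ap p f" "in_Ap 2 f" unfolding f_def using k_hol s p by (auto intro!: in_Ap_dilate_strict)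
  have fs: "in_Ap p (\<lambda>z. f (of_real s * z))" using s by (intro in_Ap_dilate(1) f) auto
  have "phi k (\<lambda>z. f (of_real s * z)) = phi f f"
    using phi_dilate_adjoint[OF p q f(1) k_Ap, of s] s by (simp flip: f_def)
  also have "\<dots> = (\<integral>z. of_real (norm (f z) powr 2) \<partial>area)"
    using in_ApD[OF f(1)] by (simp add: phi_eq complex_norm_square[symmetric])
  also have "\<dots> = of_real (Ap_int 2 f)" unfolding Ap_int_def by (rule integral_complex_of_real)
  finally have e: "Re (phi k (\<lambda>z. f (of_real s * z))) = Ap_int 2 f" by simp
  have "Ap_int 2 f \<noteq> 0"
  proof
    assume "Ap_int 2 f = 0"
    from Ap_int_eq_0[OF _ f(2) this, of "z0 / of_real s"] s z0 show False
      by (auto simp: f_def mem_disc norm_divide)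
  qed
  then have "0 < Ap_int 2 f" using Ap_int_nonneg[of 2 f] by linarith
  also have "\<dots> \<le> N * Ap_int p (\<lambda>z. f (of_real s * z)) powr (1 / p)"
    using Re_phi_le[OF fs] e by simp
  finally show ?thesis by (auto simp: zero_less_mult_iff)
qed

text \<open>The norm of h is at least y = Re phi(h) / N, and t^p lies above its tangent at t = 1;
  for y < 0 the left-hand side is negative. This linearised extremality is what dilates, midpoints
  and small perturbations of F are tested against.\<close>

lemma Ap_int_ge:
  assumes h: "in_Ap p h"
  shows "1 + p * (Re (phi k h) / N - 1) \<le> Ap_int p h"
proof -
  define y where "y = Re (phi k h) / N"
  have y: "y \<le> Ap_int p h powr (1 / p)" using Re_phi_le[OF h] N_pos by (simp add: y_def field_simps)
  show ?thesis
  proof (cases "0 \<le> y")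
    case True
    have "1 + p * (y - 1) \<le> y powr p" using powr_tangent[of p 1 y] p True by simp
    also have "\<dots> \<le> (Ap_int p h powr (1 / p)) powr p" using True y p by (intro powr_mono2) auto
    also have "\<dots> = Ap_int p h" using p by (simp add: powr_inverse_powr)
    finally show ?thesis by (simp add: y_def)
  next
    case False
    then have "p * (y - 1) \<le> p * (- 1)" using p by (intro mult_left_mono) auto
    then show ?thesis using p Ap_int_nonneg[of p h] unfolding y_def by linarith
  qed
qed

text \<open>For a dilate, r^2 times the p-th power integral is the integral of |F|^p over the ball
  of radius r, that is, 1 minus the annular integral. A lower bound for the dilate is therefore an
  upper bound near the boundary.\<close>

lemma ann_integral_le:
  assumes r: "0 < r" "r < 1"
  shows "(ann_int p F r)
    \<le> (1 - r\<^sup>2) + r\<^sup>2 * (p / N) * Re (phi k F - phi k (\<lambda>z. F (of_real r * z)))"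
proof -
  have r': "0 < r" "r \<le> 1" using r by auto
  define y where "y = Re (phi k (\<lambda>z. F (of_real r * z))) / N"
  have "r\<^sup>2 * (1 + p * (y - 1)) \<le> r\<^sup>2 * Ap_int p (\<lambda>z. F (of_real r * z))"
    unfolding y_def by (intro mult_left_mono Ap_int_ge in_Ap_dilate(1) r' F_Ap) auto
  also have "\<dots> = 1 - (ann_int p F r)"
    using in_Ap_dilate(2)[OF r' F_Ap] integral_area_split(1)[OF in_ApD(3)[OF F_Ap] r'(2)] Ap_int_F
    by (simp add: Ap_int_def)
  finally have "(ann_int p F r) \<le> (1 - r\<^sup>2) + r\<^sup>2 * p * (1 - y)"
    by (simp add: algebra_simps)
  also have "1 - y = Re (phi k F - phi k (\<lambda>z. F (of_real r * z))) / N"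
    using N_pos by (simp add: y_def N_def field_simps)
  finally show ?thesis by simp
qed

lemma circ_mean_le_ann_integral:
  assumes r: "0 \<le> r" "r < 1"
  shows "(1 - r\<^sup>2) * circ_mean p F r \<le> (ann_int p F r)"
  using r p integral_area_split(3)[OF in_ApD(3)[OF F_Ap], of r] by (intro ann_integral_lower F_hol) auto

text \<open>The annular average A of |F|^p is finite because F is in A^p, and it satisfies A <= 1 +
  C (A^(1/p) + 4). As 1/p < 1, this bounds A by a constant independent of r. The bound is explicit
  in N and in the norm of the kernel, so it can be followed along a sequence.\<close>

theorem Ryabykh:
  assumes k: "in_Hp q k"
  shows "in_Hp p F" "Hp_norm p F powr p \<le> (1 + 5 * (p / N * Hp_norm q k)) powr q"
proof -
  define C where "C = p / N * Hp_norm q k"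
  have C: "0 \<le> C" using p N_pos Hp_norm_nonneg[OF k] by (simp add: C_def)
  have big: "circ_mean p F r \<le> (1 + 5 * C) powr q" if r: "1/2 \<le> r" "r < 1" for r
  proof -
    define T where "T = (ann_int p F r)"
    define d where "d = 1 - r\<^sup>2"
    define A where "A = T / d"
    have "r * r < 1 * 1" using r by (intro mult_strict_mono) auto
    then have d: "0 < d" by (simp add: d_def power2_eq_square)
    have rd: "1 - r \<le> d" using r by (simp add: d_def power2_eq_square mult_left_le)
    have T0: "0 \<le> T" by (simp add: T_def set_lebesgue_integral_def)
    have A0: "0 \<le> A" using T0 d by (simp add: A_def)
    have TA: "T = A * d" using d by (simp add: A_def)
    have "T \<le> d + r\<^sup>2 * (p / N) * Re (phi k F - phi k (\<lambda>z. F (of_real r * z)))"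
      using ann_integral_le[of r] r by (simp add: T_def d_def)
    also have "r\<^sup>2 * (p / N) * Re (phi k F - phi k (\<lambda>z. F (of_real r * z)))
        \<le> 1 * (p / N) * norm (phi k F - phi k (\<lambda>z. F (of_real r * z)))"
    proof -
      have "r\<^sup>2 * (p / N) * Re (phi k F - phi k (\<lambda>z. F (of_real r * z)))
         \<le> r\<^sup>2 * (p / N) * norm (phi k F - phi k (\<lambda>z. F (of_real r * z)))"
        using p N_pos by (intro mult_left_mono complex_Re_le_cmod) auto
      also have "\<dots> \<le> 1 * (p / N) * norm (phi k F - phi k (\<lambda>z. F (of_real r * z)))"
        using p N_pos r by (intro mult_right_mono) (auto intro!: power_le_one)
      finally show ?thesis .
    qed
    also have "\<dots> \<le> (p / N) * ((T powr (1 / p) * (1 - r) powr (1 / q) + 4 * (1 - r)) * Hp_norm q k)"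
      using phi_minus_dilate_bound[OF p q F_Ap k r] p N_pos
      by (simp add: T_def Ap_int_F divide_right_mono mult_left_mono)
    also have "\<dots> = C * (T powr (1 / p) * (1 - r) powr (1 / q) + 4 * (1 - r))"
      by (simp add: C_def)
    also have "\<dots> \<le> C * (A powr (1 / p) * d + 4 * d)"
    proof (intro mult_left_mono add_mono C)
      have "T powr (1 / p) * (1 - r) powr (1 / q) \<le> T powr (1 / p) * d powr (1 / q)"
        using r rd q_gt_1 by (intro mult_left_mono powr_mono2) auto
      also have "\<dots> = A powr (1 / p) * (d powr (1 / p) * d powr (1 / q))"
        using A0 d by (simp add: TA powr_mult)
      also have "d powr (1 / p) * d powr (1 / q) = d"
      proof -
        have "1 / p + 1 / q = 1" unfolding q using p by (simp add: field_simps)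
        then show ?thesis using d by (simp flip: powr_add)
      qed
      finally show "T powr (1 / p) * (1 - r) powr (1 / q) \<le> A powr (1 / p) * d" .
    qed (use rd in auto)
    finally have "A * d \<le> (1 + C * (A powr (1 / p) + 4)) * d" unfolding TA by (simp add: algebra_simps)
    then have A: "A \<le> 1 + C * (A powr (1 / p) + 4)" using d by simp
    have "A \<le> (1 + 5 * C) powr q"
    proof (cases "A \<le> 1")
      case True
      also have "1 \<le> (1 + 5 * C) powr q" using C q_gt_1 by (intro ge_one_powr_ge_zero) auto
      finally show ?thesis .
    next
      case False
      then have A1: "1 < A" "1 \<le> A powr (1 / p)" using p by (auto intro!: ge_one_powr_ge_zero)
      \<comment> \<open>For A > 1 the terms 1 and 4 C are absorbed into A^(1/p) and 4 C A^(1/p);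
        hence 5 = 1 + 4.\<close>
      have "C * 4 \<le> C * (4 * A powr (1 / p))" using A1 C by (intro mult_left_mono) auto
      then have "A \<le> (1 + 5 * C) * A powr (1 / p)" using A A1 by (simp add: algebra_simps)
      then have "A * A powr (- (1 / p)) \<le> (1 + 5 * C) * A powr (1 / p) * A powr (- (1 / p))"
        by (intro mult_right_mono) auto
      also have "\<dots> = 1 + 5 * C" using A1 by (simp flip: powr_add mult.assoc add: mult.assoc)
      also have "A * A powr (- (1 / p)) = A powr (1 / q)"
        using A1 p by (subst powr_mult_base) (auto simp: q field_simps)
      finally have "(A powr (1 / q)) powr q \<le> (1 + 5 * C) powr q"
        using q_gt_1 by - (rule powr_mono2; simp)
      then show ?thesis using A0 q_gt_1 by (simp add: powr_inverse_powr)
    qed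
    moreover have "circ_mean p F r \<le> A"
      using circ_mean_le_ann_integral[of r] r d by (simp add: A_def T_def d_def field_simps)
    ultimately show ?thesis by simp
  qed
  have "circ_mean p F r \<le> (1 + 5 * C) powr q" if r: "0 < r" "r < 1" for r
  proof (cases "1/2 \<le> r")
    case False
    then have "circ_mean p F r \<le> circ_mean p F (1/2)" using r by (intro circ_mean_mono p F_hol) auto
    then show ?thesis using big[of "1/2"] by simp
  qed (use big r in auto)
  then show "in_Hp p F" "Hp_norm p F powr p \<le> (1 + 5 * (p / N * Hp_norm q k)) powr q"
    using in_HpI[OF p F_hol] Hp_norm_powr_le[OF p F_hol] by (auto simp: C_def)
qed

end

section \<open>Uniform convexity and weak convergence in Hardy spaces\<close>

lemma circ_mean_midpoint_le:
  assumes p: "1 < p" and "continuous_on disc f" "continuous_on disc g" "0 \<le> r" "r < 1"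
  shows "circ_mean p (\<lambda>z. (f z + g z) / 2) r \<le> (circ_mean p f r + circ_mean p g r) / 2"
proof -
  have "circ_mean p (\<lambda>z. (f z + g z) / 2) r = (1/2) powr p * circ_mean p (\<lambda>z. f z + g z) r"
    using circ_mean_cmult[of p "1/2" "\<lambda>z. f z + g z" r] by (simp add: norm_divide)
  also have "\<dots> \<le> (1/2) powr p * (2 powr (p - 1) * (circ_mean p f r + circ_mean p g r))"
    using assms by (intro mult_left_mono circ_mean_add_le) auto
  also have "\<dots> = (circ_mean p f r + circ_mean p g r) / 2"
    by (simp add: powr_diff powr_divide)
  finally show ?thesis .
qed

lemma in_Hp_midpoint: "1 < p \<Longrightarrow> in_Hp p f \<Longrightarrow> in_Hp p g \<Longrightarrow> in_Hp p (\<lambda>z. (f z + g z) / 2)"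
  using in_Hp_cmult[of p "\<lambda>z. f z + g z" "1/2"] in_Hp_add[of p f g] by simp

text \<open>The midpoint enters through its mean at one fixed radius r0 instead of its norm, because
  convergence is known only on circles inside the disc. Monotonicity allows this: at max(r, r0) the
  mean of the difference has grown past r and that of the midpoint past r0.\<close>

lemma Hp_norm_diff_uniform_convexity:
  assumes p: "1 < p" and f: "in_Hp p f" and g: "in_Hp p g" and r0: "0 \<le> r0" "r0 < 1"
    and e: "0 \<le> e" "0 \<le> K"
    and K: "\<And>a b :: complex. norm (a - b) powr p \<le> e * (norm a powr p + norm b powr p)
        + K * ((norm a powr p + norm b powr p) / 2 - norm ((a + b) / 2) powr p)"
  shows "Hp_norm p (\<lambda>z. f z - g z) powr p \<le> e * (Hp_norm p f powr p + Hp_norm p g powr p)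
      + K * ((Hp_norm p f powr p + Hp_norm p g powr p) / 2 - circ_mean p (\<lambda>z. (f z + g z) / 2) r0)"
proof (rule Hp_norm_powr_le[OF p])
  have hol: "f holomorphic_on disc" "g holomorphic_on disc" using f g by (auto simp: in_Hp_def)
  then show "(\<lambda>z. f z - g z) holomorphic_on disc" by (intro holomorphic_intros)
  fix r :: real assume r: "0 < r" "r < 1"
  define s where "s = max r r0"
  have s: "r \<le> s" "r0 \<le> s" "0 \<le> s" "s < 1" using r r0 by (auto simp: s_def)
  have "circ_mean p (\<lambda>z. f z - g z) r \<le> circ_mean p (\<lambda>z. f z - g z) s"
    using r s hol by (intro circ_mean_mono p holomorphic_intros) auto
  also have "\<dots> \<le> e * (circ_mean p f s + circ_mean p g s)
      + K * ((circ_mean p f s + circ_mean p g s) / 2 - circ_mean p (\<lambda>z. (f z + g z) / 2) s)"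
    by (intro circ_mean_uniform_convexity[OF p K] holomorphic_on_imp_continuous_on hol s)
  also have "\<dots> \<le> e * (Hp_norm p f powr p + Hp_norm p g powr p)
      + K * ((Hp_norm p f powr p + Hp_norm p g powr p) / 2 - circ_mean p (\<lambda>z. (f z + g z) / 2) r0)"
    using r0 s e hol f g p
    by (intro add_mono mult_left_mono diff_mono divide_right_mono circ_mean_le_Hp_norm circ_mean_mono holomorphic_intros) auto
  finally show "circ_mean p (\<lambda>z. f z - g z) r \<le> e * (Hp_norm p f powr p + Hp_norm p g powr p)
      + K * ((Hp_norm p f powr p + Hp_norm p g powr p) / 2 - circ_mean p (\<lambda>z. (f z + g z) / 2) r0)" .
qed

section \<open>The Radon-Riesz property of H^p\<close>

lemma tendsto_zero_powrD:
  fixes x :: "nat \<Rightarrow> real"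
  assumes "(\<lambda>n. x n powr p) \<longlonglongrightarrow> 0" "0 < p" "\<And>n. 0 \<le> x n"
  shows "x \<longlonglongrightarrow> 0"
proof -
  have "(\<lambda>n. (x n powr p) powr (1 / p)) \<longlonglongrightarrow> 0 powr (1 / p)"
    using assms by (intro tendsto_powr') auto
  then show ?thesis using assms by (simp add: powr_powr)
qed

text \<open>At a suitable radius r0 the mean of F almost exhausts its norm. The midpoint of f n and
  F is close to F on that circle, so its norm is not much below that of F, while the norm of f n is
  not much above; uniform convexity then forces the difference to be small.\<close>

lemma Hp_norm_diff_tendsto_0:
  assumes p: "1 < p" and f: "\<And>n. in_Hp p (f n)" and F: "in_Hp p F"
    and loc: "\<And>r. 0 \<le> r \<Longrightarrow> r < 1 \<Longrightarrow> (\<lambda>n. circ_mean p (\<lambda>z. f n z - F z) r) \<longlonglongrightarrow> 0"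
    and lim: "\<And>e. 0 < e \<Longrightarrow> \<forall>\<^sub>F n in sequentially. Hp_norm p (f n) powr p \<le> Hp_norm p F powr p + e"
  shows "(\<lambda>n. Hp_norm p (\<lambda>z. f n z - F z)) \<longlonglongrightarrow> 0"
proof (rule tendsto_zero_powrD)
  define V where "V = Hp_norm p F powr p"
  have V: "0 \<le> V" by (simp add: V_def)
  have fc: "continuous_on disc (f n)" and Fc: "continuous_on disc F" and Fh: "F holomorphic_on disc" for n
    using f F in_HpD[of p] p by auto
  show "(\<lambda>n. Hp_norm p (\<lambda>z. f n z - F z) powr p) \<longlonglongrightarrow> 0"
  proof (rule order_tendstoI)
    fix a :: real assume a: "0 < a"
    \<comment> \<open>Budget for the target a: the term with e contributes a/4 and the convexity
      gap, at most 4 d, contributes K * 4 d <= a/2.\<close>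
    define e where "e = a / (4 * (2 * V + 1))"
    have e: "0 < e" "e * (2 * V + 1) = a / 4" using a V by (auto simp: e_def field_simps)
    obtain K where K: "K > 0" "\<And>a b :: complex. norm (a - b) powr p \<le> e * (norm a powr p + norm b powr p)
        + K * ((norm a powr p + norm b powr p) / 2 - norm ((a + b) / 2) powr p)"
      using uniform_convexity[OF p e(1)] by blast
    define d where "d = min 1 (a / (8 * K))"
    have d: "0 < d" "d \<le> 1" "K * d \<le> a / 8" using a K(1) by (auto simp: d_def min_def field_simps)
    obtain r0 where r0: "0 < r0" "r0 < 1" "V - d \<le> circ_mean p F r0"
    proof -
      have "\<not> (\<forall>r. 0 < r \<longrightarrow> r < 1 \<longrightarrow> circ_mean p F r \<le> V - d)"
        using Hp_norm_powr_le[OF p Fh, of "V - d"] d(1) by (auto simp: V_def)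
      then show ?thesis using that by force
    qed
    \<comment> \<open>The mean of the midpoint stays below V + 1, so the relative error e' costs at
      most d.\<close>
    define e' where "e' = d / (V + 1)"
    have e': "0 < e'" "e' * (V + 1) = d" using d V by (auto simp: e'_def)
    obtain K' where K': "K' > 0" "\<And>a b :: complex. norm a powr p \<le> (1 + e') * norm b powr p + K' * norm (a - b) powr p"
      using norm_powr_perturb[OF p e'(1)] by blast
    have "(\<lambda>n. K' * (norm (1/2 :: complex) powr p * circ_mean p (\<lambda>z. f n z - F z) r0)) \<longlonglongrightarrow> K' * (norm (1/2 :: complex) powr p * 0)"
      using r0 by (intro tendsto_intros loc) auto
    then have "\<forall>\<^sub>F n in sequentially. K' * (norm (1/2 :: complex) powr p * circ_mean p (\<lambda>z. f n z - F z) r0) < d"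
      using d by (intro order_tendstoD) auto
    moreover have "\<forall>\<^sub>F n in sequentially. Hp_norm p (f n) powr p \<le> V + d"
      using lim[OF d(1)] by (simp add: V_def)
    ultimately show "\<forall>\<^sub>F n in sequentially. Hp_norm p (\<lambda>z. f n z - F z) powr p < a"
    proof eventually_elim
      case (elim n)
      define h where "h z = (f n z + F z) / 2" for z
      have hc: "continuous_on disc h" unfolding h_def by (intro continuous_intros fc Fc) auto
      have "circ_mean p h r0 \<le> (circ_mean p (f n) r0 + circ_mean p F r0) / 2"
        unfolding h_def using r0 by (intro circ_mean_midpoint_le p fc Fc) auto
      also have "\<dots> \<le> (Hp_norm p (f n) powr p + V) / 2"
        unfolding V_def using r0 by (intro divide_right_mono add_mono circ_mean_le_Hp_norm p f F) auto
      also have "\<dots> \<le> V + 1" using elim(2) d V by (simp add: field_simps)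
      finally have h1: "circ_mean p h r0 \<le> V + 1" .
      have "circ_mean p F r0 \<le> (\<integral>t. (1 + e') * norm (h (of_real r0 * cis t)) powr p
          + K' * norm (F (of_real r0 * cis t) - h (of_real r0 * cis t)) powr p \<partial>circle)"
        unfolding circ_mean_def
        using r0 p hc Fc by (intro integral_mono K' Bochner_Integration.integrable_add integrable_mult_right
          integrable_circ_mean[of "\<lambda>z. F z - h z"] integrable_circ_mean continuous_intros) auto
      also have "\<dots> = (1 + e') * circ_mean p h r0 + K' * circ_mean p (\<lambda>z. F z - h z) r0"
        unfolding circ_mean_def using integrable_circ_mean[of "\<lambda>z. F z - h z" r0 p] integrable_circ_mean[of h r0 p] r0 p hc Fc
        by (simp add: continuous_on_diff)
      also have "(\<lambda>z. F z - h z) = (\<lambda>z. (- (1/2)) * (f n z - F z))"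
        by (auto simp: h_def field_simps)
      also have "circ_mean p (\<lambda>z. (- (1/2)) * (f n z - F z)) r0 = norm (1/2 :: complex) powr p * circ_mean p (\<lambda>z. f n z - F z) r0"
        unfolding circ_mean_cmult by simp
      finally have "circ_mean p F r0 \<le> circ_mean p h r0 + e' * circ_mean p h r0 + d"
        using elim(1) by (simp add: algebra_simps)
      moreover have "e' * circ_mean p h r0 \<le> d"
        using mult_left_mono[OF h1, of e'] e' by simp
      ultimately have h2: "V - 3 * d \<le> circ_mean p h r0" using r0(3) by linarith
      have "Hp_norm p (\<lambda>z. f n z - F z) powr p \<le> e * (Hp_norm p (f n) powr p + V)
        + K * ((Hp_norm p (f n) powr p + V) / 2 - circ_mean p h r0)"
        unfolding V_def h_def using r0 e K by (intro Hp_norm_diff_uniform_convexity p f F K(2)) auto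
      also have "\<dots> \<le> e * (2 * V + 1) + K * (4 * d)"
      proof (rule add_mono; rule mult_left_mono)
        show "(Hp_norm p (f n) powr p + V) / 2 - circ_mean p h r0 \<le> 4 * d"
          using elim(2) h2 d(1) by (simp add: field_simps)
      qed (use e K(1) elim(2) d in auto)
      also have "\<dots> < a" using e d a by simp
      finally show ?case .
    qed
  qed (auto intro!: always_eventually less_le_trans[OF _ powr_ge_zero])
next
  show "0 \<le> Hp_norm p (\<lambda>z. f n z - F z)" for n
    by (intro Hp_norm_nonneg in_Hp_diff p f F)
qed (use p in auto)

text \<open>Norm minimising midpoint combinations replace the duality argument: for uniformly convex
  norms they form a Cauchy sequence.\<close>

inductive_set midpoints :: "(nat \<Rightarrow> complex \<Rightarrow> complex) \<Rightarrow> nat \<Rightarrow> (complex \<Rightarrow> complex) set" for g m where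
  base: "m \<le> n \<Longrightarrow> g n \<in> midpoints g m"
| mid: "f \<in> midpoints g m \<Longrightarrow> h \<in> midpoints g m \<Longrightarrow> (\<lambda>z. (f z + h z) / 2) \<in> midpoints g m"

lemma midpoints_antimono: assumes "m \<le> n" "f \<in> midpoints g n" shows "f \<in> midpoints g m"
  using assms(2) by induction (use assms(1) in \<open>auto intro: midpoints.intros\<close>)

lemma midpoints_in_Hp:
  assumes "f \<in> midpoints g m" "1 < p" "\<And>n. in_Hp p (g n)" shows "in_Hp p f"
  using assms(1) by induction (use assms in \<open>auto intro: in_Hp_midpoint\<close>)

lemma midpoints_circ_mean_le:
  assumes "f \<in> midpoints g m" "1 < p" "\<And>n. in_Hp p (g n)" "0 \<le> r" "r < 1"
    and B: "\<And>n. m \<le> n \<Longrightarrow> circ_mean p (g n) r \<le> B"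
  shows "circ_mean p f r \<le> B"
  using assms(1)
proof induction
  case (mid f h)
  have "continuous_on disc f" "continuous_on disc h"
    using midpoints_in_Hp[OF mid(1) assms(2,3)] midpoints_in_Hp[OF mid(2) assms(2,3)] in_HpD[of p] assms(2) by auto
  from circ_mean_midpoint_le[OF assms(2) this assms(4,5)]
  have "circ_mean p (\<lambda>z. (f z + h z) / 2) r \<le> (circ_mean p f r + circ_mean p h r) / 2" .
  also have "\<dots> \<le> B" using mid.IH by simp
  finally show ?case .
qed (use B in auto)

text \<open>A hands-on form of Mazur's lemma. L equals 1 on every midpoint combination, so norms
  stay above 1/C. The infima a m over the tails increase to a limit A; two almost minimisers have a
  midpoint in the same tail, hence no smaller than the infimum, so uniform convexity makes them
  close. As later ones vanish on every circle, a single h n already has too small a norm.\<close>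

lemma Hp_weak_null_contradiction:
  assumes p: "1 < p" and g: "\<And>n. in_Hp p (g n)" and B: "\<And>n. Hp_norm p (g n) powr p \<le> B"
    and loc: "\<And>r. 0 \<le> r \<Longrightarrow> r < 1 \<Longrightarrow> (\<lambda>n. circ_mean p (g n) r) \<longlonglongrightarrow> 0"
    and lin: "\<And>f h a b. in_Hp p f \<Longrightarrow> in_Hp p h \<Longrightarrow> L (\<lambda>z. a * f z + b * h z) = a * L f + b * L h"
    and bound: "\<And>f. in_Hp p f \<Longrightarrow> norm (L f) \<le> C * Hp_norm p f"
    and one: "\<And>n. L (g n) = 1"
  shows False
proof -
  define \<nu> where "\<nu> f = Hp_norm p f powr p" for f
  have B0: "0 \<le> B" using B[of 0] powr_ge_zero order_trans by blast
  have mH: "in_Hp p f" if "f \<in> midpoints g m" for f m using midpoints_in_Hp[OF that p g] .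
  have mL: "L f = 1" if "f \<in> midpoints g m" for f m
    using that
  proof induction
    case (mid f h)
    then show ?case using lin[OF mH[OF mid(1)] mH[OF mid(2)], of "1/2" "1/2"] by (simp add: add_divide_distrib)
  qed (use one in auto)
  have mB: "\<nu> f \<le> B" if "f \<in> midpoints g m" for f m
    unfolding \<nu>_def
  proof (rule Hp_norm_powr_le[OF p])
    show "f holomorphic_on disc" using mH[OF that] by (simp add: in_Hp_def)
    show "circ_mean p f r \<le> B" if r: "0 < r" "r < 1" for r
      using \<open>f \<in> midpoints g m\<close> p g
    proof (rule midpoints_circ_mean_le)
      show "circ_mean p (g n) r \<le> B" for n
        using circ_mean_le_Hp_norm[OF p g, of r n] B[of n] r by linarith
    qed (use r in auto)
  qed
  define a where "a m = Inf (\<nu> ` midpoints g m)" for m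
  have ne: "midpoints g m \<noteq> {}" for m using midpoints.base[of m m g] by auto
  have bdd: "bdd_below (\<nu> ` midpoints g m)" for m by (rule bdd_belowI2[of _ 0]) (simp add: \<nu>_def)
  have a_le: "a m \<le> \<nu> f" if "f \<in> midpoints g m" for m f
    unfolding a_def using that bdd by (intro cINF_lower)
  have aB: "a m \<le> B" for m using a_le[OF midpoints.base[of m m]] mB[OF midpoints.base[of m m]] by force
  have a_mono: "incseq a"
    unfolding incseq_def a_def
    by (intro allI impI cINF_superset_mono ne bdd) (auto intro: midpoints_antimono)
  obtain A where A: "a \<longlonglongrightarrow> A" "\<And>m. a m \<le> A"
    using incseq_convergent[OF a_mono, of B] aB by auto
  have "\<exists>f\<in>midpoints g m. \<nu> f < a m + inverse (real (Suc m))" for m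
    using cInf_lessD[of "\<nu> ` midpoints g m" "a m + inverse (real (Suc m))"] ne by (auto simp: a_def)
  then obtain h where h: "\<And>m. h m \<in> midpoints g m" "\<And>m. \<nu> (h m) < a m + inverse (real (Suc m))"
    by metis
  have C: "0 < C"
  proof (rule ccontr)
    assume "\<not> 0 < C"
    then have "C * Hp_norm p (g 0) \<le> 0" using Hp_norm_nonneg[OF g] by (intro mult_nonpos_nonneg) auto
    with bound[OF g, of 0] one[of 0] show False by simp
  qed
  have low: "(1 / C) powr p \<le> \<nu> (h m)" for m
    unfolding \<nu>_def using bound[OF mH[OF h(1)], of m] mL[OF h(1), of m] C p
    by (intro powr_mono2) (auto simp: field_simps)
  \<comment> \<open>The factor 2^(p-1) is what splitting h n into h n - h m and h m will cost. One
    strict inequality suffices, so e and K are fixed once and for all.\<close>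
  define \<epsilon> where "\<epsilon> = (1 / C) powr p / 2 powr (p - 1)"
  have \<epsilon>: "0 < \<epsilon>" using C by (simp add: \<epsilon>_def)
  define e where "e = \<epsilon> / (4 * (B + 1))"
  have e: "0 < e" "e * (2 * B) < \<epsilon> / 2" using \<epsilon> B0 by (auto simp: e_def field_simps)
  obtain K where K: "K > 0" "\<And>a b :: complex. norm (a - b) powr p \<le> e * (norm a powr p + norm b powr p)
        + K * ((norm a powr p + norm b powr p) / 2 - norm ((a + b) / 2) powr p)"
    using uniform_convexity[OF p e(1)] by blast
  have diff: "circ_mean p (\<lambda>z. h n z - h m z) r \<le> e * (2 * B) + K * ((A - a n) / 2 + 2 * inverse (real (Suc n)))"
    if nm: "n \<le> m" and r: "0 \<le> r" "r < 1" for n m r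
  proof -
    define k where "k z = (h n z + h m z) / 2" for z
    have hm: "h m \<in> midpoints g n" using midpoints_antimono[OF nm h(1)] .
    have k: "k \<in> midpoints g n" unfolding k_def by (intro midpoints.mid h hm)
    \<comment> \<open>The uniform convexity estimate wants a radius at which the mean of the
      midpoint nearly reaches the infimum of its tail; otherwise its norm would fall below that
      infimum.\<close>
    have "\<not> (\<forall>r. 0 < r \<longrightarrow> r < 1 \<longrightarrow> circ_mean p k r \<le> a n - inverse (real (Suc n)))"
    proof
      assume "\<forall>r. 0 < r \<longrightarrow> r < 1 \<longrightarrow> circ_mean p k r \<le> a n - inverse (real (Suc n))"
      then have "\<nu> k \<le> a n - inverse (real (Suc n))"
        unfolding \<nu>_def using mH[OF k] by (intro Hp_norm_powr_le p) (auto simp: in_Hp_def)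
      moreover have "0 < inverse (real (Suc n))" by simp
      ultimately show False using a_le[OF k] by linarith
    qed
    then obtain r0 where r0: "0 < r0" "r0 < 1" "a n - inverse (real (Suc n)) < circ_mean p k r0"
      by (auto simp: not_le)
    have "inverse (real (Suc m)) \<le> inverse (real (Suc n))" using nm by (intro le_imp_inverse_le) auto
    then have nus: "\<nu> (h n) + \<nu> (h m) \<le> a n + A + 2 * inverse (real (Suc n))"
      using h(2)[of n] h(2)[of m] A(2)[of m] by linarith
    have "circ_mean p (\<lambda>z. h n z - h m z) r \<le> Hp_norm p (\<lambda>z. h n z - h m z) powr p"
      using r mH[OF h(1)] by (intro circ_mean_le_Hp_norm p in_Hp_diff) auto
    also have "\<dots> \<le> e * (\<nu> (h n) + \<nu> (h m)) + K * ((\<nu> (h n) + \<nu> (h m)) / 2 - circ_mean p k r0)"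
      unfolding \<nu>_def k_def using r0 e K mH[OF h(1)]
      by (intro Hp_norm_diff_uniform_convexity p K(2)) auto
    also have "\<dots> \<le> e * (2 * B) + K * ((A - a n) / 2 + 2 * inverse (real (Suc n)))"
    proof (rule add_mono; rule mult_left_mono)
      show "(\<nu> (h n) + \<nu> (h m)) / 2 - circ_mean p k r0 \<le> (A - a n) / 2 + 2 * inverse (real (Suc n))"
        using nus r0(3) by (simp add: field_simps)
    qed (use e K(1) mB[OF h(1), of n] mB[OF h(1), of m] in auto)
    finally show ?thesis .
  qed
  \<comment> \<open>Letting m grow removes h m: the means on circle r tend to 0 uniformly over the
    midpoints of a tail, and the estimate \<open>diff\<close> does not depend on m.\<close>
  have small: "circ_mean p (h n) r \<le> 2 powr (p - 1) * (e * (2 * B) + K * ((A - a n) / 2 + 2 * inverse (real (Suc n))))"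
    if r: "0 < r" "r < 1" for n r
  proof -
    define D where "D = e * (2 * B) + K * ((A - a n) / 2 + 2 * inverse (real (Suc n)))"
    have "\<exists>m0. \<forall>m\<ge>m0. circ_mean p (h n) r \<le> 2 powr (p - 1) * (D + d)" if d: "0 < d" for d
    proof -
      obtain m0 where m0: "\<And>m. m0 \<le> m \<Longrightarrow> circ_mean p (g m) r < d"
        using order_tendstoD(2)[OF loc[of r] d] r by (auto simp: eventually_sequentially)
      define m where "m = max n m0"
      have c: "continuous_on disc (h n)" "continuous_on disc (h m)"
        using in_HpD[OF _ mH[OF h(1)]] p by auto
      have "circ_mean p (h n) r = circ_mean p (\<lambda>z. (h n z - h m z) + h m z) r" by simp
      also have "\<dots> \<le> 2 powr (p - 1) * (circ_mean p (\<lambda>z. h n z - h m z) r + circ_mean p (h m) r)"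
        using r c by (intro circ_mean_add_le p continuous_intros) auto
      also have "\<dots> \<le> 2 powr (p - 1) * (D + d)"
      proof (intro mult_left_mono add_mono)
        show "circ_mean p (\<lambda>z. h n z - h m z) r \<le> D"
          unfolding D_def using r by (intro diff) (auto simp: m_def)
        show "circ_mean p (h m) r \<le> d"
          using r m0 by (intro midpoints_circ_mean_le[OF h(1) p g]) (auto simp: m_def intro: less_imp_le)
      qed auto
      finally show ?thesis by blast
    qed
    then have "circ_mean p (h n) r / 2 powr (p - 1) \<le> D + d" if "0 < d" for d
      using that by (fastforce simp: divide_le_eq mult.commute)
    then have "circ_mean p (h n) r / 2 powr (p - 1) \<le> D" by (rule field_le_epsilon)
    then show ?thesis by (simp add: D_def divide_le_eq mult.commute)
  qed
  have "(\<lambda>n. e * (2 * B) + K * ((A - a n) / 2 + 2 * inverse (real (Suc n)))) \<longlonglongrightarrow> e * (2 * B) + K * ((A - A) / 2 + 2 * 0)"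
    by (intro tendsto_intros A LIMSEQ_inverse_real_of_nat) simp
  from order_tendstoD(2)[OF this, of \<epsilon>]
  have "\<forall>\<^sub>F n in sequentially. e * (2 * B) + K * ((A - a n) / 2 + 2 * inverse (real (Suc n))) < \<epsilon>"
    using e(2) \<epsilon> by simp
  then obtain n where n: "e * (2 * B) + K * ((A - a n) / 2 + 2 * inverse (real (Suc n))) < \<epsilon>"
    by (auto simp: eventually_sequentially)
  have "\<nu> (h n) \<le> 2 powr (p - 1) * (e * (2 * B) + K * ((A - a n) / 2 + 2 * inverse (real (Suc n))))"
    unfolding \<nu>_def using mH[OF h(1), of n] by (intro Hp_norm_powr_le p small) (auto simp: in_Hp_def)
  also have "\<dots> < 2 powr (p - 1) * \<epsilon>" using n by (intro mult_strict_left_mono) auto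
  also have "\<dots> = (1 / C) powr p" by (simp add: \<epsilon>_def)
  finally show False using low[of n] by linarith
qed

text \<open>If L(f n) does not tend to 0, some f(\<sigma> m) divided by their values under L have
  L-value 1 and remain bounded, because these values stay away from 0.\<close>

lemma Hp_weak_null:
  assumes p: "1 < p" and f: "\<And>n. in_Hp p (f n)" and B: "\<And>n. Hp_norm p (f n) powr p \<le> B"
    and loc: "\<And>r. 0 \<le> r \<Longrightarrow> r < 1 \<Longrightarrow> (\<lambda>n. circ_mean p (f n) r) \<longlonglongrightarrow> 0"
    and L: "Hp_bounded_functional p L"
  shows "(\<lambda>n. L (f n)) \<longlonglongrightarrow> 0"
proof (rule ccontr)
  obtain C where lin: "\<And>f h a b. in_Hp p f \<Longrightarrow> in_Hp p h \<Longrightarrow> L (\<lambda>z. a * f z + b * h z) = a * L f + b * L h"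
    and bound: "\<And>f. in_Hp p f \<Longrightarrow> norm (L f) \<le> C * Hp_norm p f"
    using L by (auto simp: Hp_bounded_functional_def)
  assume "\<not> (\<lambda>n. L (f n)) \<longlonglongrightarrow> 0"
  then obtain d where d: "0 < d" "\<And>m. \<exists>n\<ge>m. d \<le> norm (L (f n))"
    by (auto simp: LIMSEQ_iff not_less)
  from d(2) obtain \<sigma> where \<sigma>: "\<And>m. m \<le> \<sigma> m" "\<And>m. d \<le> norm (L (f (\<sigma> m)))" by metis
  define c where "c m = 1 / L (f (\<sigma> m))" for m
  define g where "g m z = c m * f (\<sigma> m) z" for m z
  have nz: "L (f (\<sigma> m)) \<noteq> 0" for m using \<sigma>(2)[of m] d(1) by auto
  have c: "norm (c m) powr p \<le> (1 / d) powr p" for m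
    using \<sigma>(2)[of m] d(1) p by (intro powr_mono2) (auto simp: c_def norm_divide frac_le)
  have gH: "in_Hp p (g m)" for m unfolding g_def by (intro in_Hp_cmult p f)
  have gc: "circ_mean p (g m) r \<le> (1 / d) powr p * circ_mean p (f (\<sigma> m)) r" for m r
    using c[of m] unfolding g_def circ_mean_cmult by (intro mult_right_mono) auto
  have \<sigma>t: "filterlim \<sigma> at_top sequentially"
    using \<sigma>(1) by (auto simp: filterlim_at_top_ge[of _ _ 0] eventually_sequentially intro: order_trans)
  show False
  proof (rule Hp_weak_null_contradiction[OF p gH _ _ lin bound])
    show "Hp_norm p (g m) powr p \<le> (1 / d) powr p * B" for m
    proof (rule Hp_norm_powr_le[OF p])
      show "g m holomorphic_on disc" using gH by (simp add: in_Hp_def)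
      show "circ_mean p (g m) r \<le> (1 / d) powr p * B" if "0 < r" "r < 1" for r
        using circ_mean_le_Hp_norm[OF p f, of r "\<sigma> m"] B[of "\<sigma> m"] that
        by (intro order_trans[OF gc] mult_left_mono) auto
    qed
    show "(\<lambda>m. circ_mean p (g m) r) \<longlonglongrightarrow> 0" if r: "0 \<le> r" "r < 1" for r
    proof (rule tendsto_sandwich[OF _ _ tendsto_const])
      show "(\<lambda>m. (1 / d) powr p * circ_mean p (f (\<sigma> m)) r) \<longlonglongrightarrow> 0"
        using tendsto_mult_right_zero[OF filterlim_compose[OF loc[OF r] \<sigma>t]] by simp
    qed (use gc in auto)
    show "L (g m) = 1" for m
      using lin[OF f f, of "c m" "\<sigma> m" 0] nz[of m] by (simp add: g_def[abs_def] c_def)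
  qed
qed

section \<open>Sequences of extremal functions\<close>

locale extremal_sequence =
  fixes p q :: real and kn :: "nat \<Rightarrow> complex \<Rightarrow> complex" and k :: "complex \<Rightarrow> complex"
    and Fn :: "nat \<Rightarrow> complex \<Rightarrow> complex" and F :: "complex \<Rightarrow> complex"
  assumes p: "1 < p" and q: "q = p / (p - 1)"
    and kn_Hq: "\<And>n. in_Hp q (kn n)" and kn_nz: "\<And>n. \<exists>z\<in>disc. kn n z \<noteq> 0"
    and k_Hq: "in_Hp q k" and k_nz: "\<exists>z\<in>disc. k z \<noteq> 0"
    and conv: "(\<lambda>n. Hp_norm q (\<lambda>z. kn n z - k z)) \<longlonglongrightarrow> 0"
    and Fn_ext: "\<And>n. Ap_extremal p (kn n) (Fn n)" and F_ext: "Ap_extremal p k F"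
begin

lemma q_gt_1: "1 < q" unfolding q using p by (simp add: field_simps)

lemma kn_Ap: "in_Ap q (kn n)" and k_Ap: "in_Ap q k"
  using in_Hp_imp_in_Ap(1)[OF q_gt_1] kn_Hq k_Hq by auto

sublocale lim: extremal_problem p q k F
  by standard (use p q k_Ap k_nz F_ext in auto)

lemma seq: "extremal_problem p q (kn n) (Fn n)"
  by standard (use p q kn_Ap kn_nz Fn_ext in auto)

definition Nn where "Nn n = extremal_problem.N (kn n) (Fn n)"

definition \<kappa> where "\<kappa> n = Hp_norm q (\<lambda>z. kn n z - k z)"

lemma \<kappa>_nonneg: "0 \<le> \<kappa> n"
  unfolding \<kappa>_def by (intro Hp_norm_nonneg in_Hp_diff q_gt_1 kn_Hq k_Hq)

lemma \<kappa>_tendsto: "\<kappa> \<longlonglongrightarrow> 0"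
  using conv by (simp add: \<kappa>_def[abs_def])

lemma phi_kernel_close:
  assumes f: "in_Ap p f"
  shows "norm (phi (kn n) f - phi k f) \<le> Ap_int p f powr (1 / p) * \<kappa> n"
proof -
  have h: "in_Hp q (\<lambda>z. kn n z - k z)" by (intro in_Hp_diff q_gt_1 kn_Hq k_Hq)
  have "Ap_int q (\<lambda>z. kn n z - k z) powr (1 / q) \<le> (\<kappa> n powr q) powr (1 / q)"
    using in_Hp_imp_in_Ap(2)[OF q_gt_1 h] q_gt_1 by (intro powr_mono2) (auto simp: \<kappa>_def)
  also have "\<dots> = \<kappa> n" using q_gt_1 \<kappa>_nonneg[of n] by (simp add: powr_powr)
  finally have a: "Ap_int q (\<lambda>z. kn n z - k z) powr (1 / q) \<le> \<kappa> n" .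
  have "norm (phi (kn n) f - phi k f) = norm (phi (\<lambda>z. kn n z - k z) f)"
    by (simp add: phi_kernel_diff[OF p q f kn_Ap k_Ap])
  also have "\<dots> \<le> Ap_int p f powr (1 / p) * Ap_int q (\<lambda>z. kn n z - k z) powr (1 / q)"
    by (intro phi_bound(2)[OF p q f] in_Hp_imp_in_Ap(1)[OF q_gt_1 h])
  also have "\<dots> \<le> Ap_int p f powr (1 / p) * \<kappa> n" by (intro mult_left_mono a) auto
  finally show ?thesis .
qed

lemma Re_phi_kernel_close:
  assumes "in_Ap p f" "Ap_int p f = 1"
  shows "\<bar>Re (phi (kn n) f) - Re (phi k f)\<bar> \<le> \<kappa> n"
  using phi_kernel_close[OF assms(1), of n] abs_Re_le_cmod[of "phi (kn n) f - phi k f"] assms(2) by simp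

lemma Fn_Ap: "in_Ap p (Fn n)" "Ap_int p (Fn n) = 1"
  using extremal_problem.F_Ap[OF seq] extremal_problem.Ap_int_F[OF seq] by auto

text \<open>Each extremal function is admissible in the other problem, and exchanging the kernel
  costs at most the distance of the kernels.\<close>

lemma Nn_close: "\<bar>Nn n - lim.N\<bar> \<le> \<kappa> n"
proof -
  have "lim.N \<le> Nn n + \<kappa> n"
    using extremal_problem.Re_phi_le[OF seq lim.F_Ap, of n] Re_phi_kernel_close[OF lim.F_Ap lim.Ap_int_F, of n]
    by (simp add: lim.Ap_int_F Nn_def lim.N_def)
  moreover have "Nn n \<le> lim.N + \<kappa> n"
    using lim.Re_phi_le[OF Fn_Ap(1), of n] Re_phi_kernel_close[OF Fn_Ap, of n n]
    by (simp add: Fn_Ap Nn_def extremal_problem.N_def[OF seq])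
  ultimately show ?thesis by linarith
qed

lemma Nn_tendsto: "Nn \<longlonglongrightarrow> lim.N"
proof -
  have "(\<lambda>n. Nn n - lim.N) \<longlonglongrightarrow> 0"
    by (rule Lim_null_comparison[OF _ \<kappa>_tendsto]) (use Nn_close in auto)
  then show ?thesis by (simp add: LIM_zero_iff)
qed

lemma Nn_pos: "0 < Nn n" unfolding Nn_def by (rule extremal_problem.N_pos[OF seq])

lemma diff_Ap: "in_Ap p (\<lambda>z. Fn n z - F z)"
  using p by (intro in_Ap_diff Fn_Ap lim.F_Ap) auto

text \<open>F n is almost extremal for k, hence so is its midpoint with F; the midpoint then has
  norm close to 1, and uniform convexity applies.\<close>

lemma Ap_convergence: "(\<lambda>n. Ap_int p (\<lambda>z. Fn n z - F z)) \<longlonglongrightarrow> 0"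
proof (rule order_tendstoI)
  fix a :: real assume a: "0 < a"
  obtain K where K: "K > 0" "\<And>x y :: complex. norm (x - y) powr p \<le> (a / 4) * (norm x powr p + norm y powr p)
        + K * ((norm x powr p + norm y powr p) / 2 - norm ((x + y) / 2) powr p)"
    using uniform_convexity[OF p, of "a / 4"] a by auto
  have "(\<lambda>n. K * (p / lim.N * \<kappa> n)) \<longlonglongrightarrow> K * (p / lim.N * 0)"
    by (intro tendsto_intros \<kappa>_tendsto)
  then have "\<forall>\<^sub>F n in sequentially. K * (p / lim.N * \<kappa> n) < a / 2"
    using a by (intro order_tendstoD) auto
  then show "\<forall>\<^sub>F n in sequentially. Ap_int p (\<lambda>z. Fn n z - F z) < a"
  proof eventually_elim
    case (elim n)
    define h where "h z = (1/2) * Fn n z + (1/2) * F z" for z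
    have h: "in_Ap p h" unfolding h_def using p by (intro in_Ap_add in_Ap_cmult Fn_Ap lim.F_Ap) auto
    have "phi k h = (1/2) * phi k (Fn n) + (1/2) * phi k F"
      unfolding h_def by (intro phi_linear[OF p q] Fn_Ap lim.F_Ap k_Ap)
    then have "Re (phi k h) = (Re (phi k (Fn n)) + lim.N) / 2" by (simp add: lim.N_def)
    moreover have "lim.N - 2 * \<kappa> n \<le> Re (phi k (Fn n))"
      using Nn_close[of n] Re_phi_kernel_close[OF Fn_Ap, of n n] by (simp add: Nn_def extremal_problem.N_def[OF seq])
    ultimately have "lim.N - \<kappa> n \<le> Re (phi k h)" by (simp add: field_simps)
    then have "(lim.N - \<kappa> n) / lim.N \<le> Re (phi k h) / lim.N" using lim.N_pos by (intro divide_right_mono) auto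
    then have "1 - \<kappa> n / lim.N \<le> Re (phi k h) / lim.N" using lim.N_pos by (simp add: diff_divide_distrib)
    then have "p * (1 - \<kappa> n / lim.N - 1) \<le> p * (Re (phi k h) / lim.N - 1)"
      using p by (intro mult_left_mono) auto
    with lim.Ap_int_ge[OF h] have "1 - p / lim.N * \<kappa> n \<le> Ap_int p h" by simp
    moreover have "Ap_int p h = (\<integral>z. norm ((Fn n z + F z) / 2) powr p \<partial>area)"
      by (simp add: Ap_int_def h_def add_divide_distrib)
    moreover have "Ap_int p (\<lambda>z. Fn n z - F z) \<le> (a / 4) * (Ap_int p (Fn n) + Ap_int p F)
        + K * ((Ap_int p (Fn n) + Ap_int p F) / 2 - (\<integral>z. norm ((Fn n z + F z) / 2) powr p \<partial>area))"
      unfolding Ap_int_def using in_ApD[OF Fn_Ap(1)] in_ApD[OF lim.F_Ap]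
      by (intro integral_uniform_convexity[OF p K(2)])
    ultimately have "Ap_int p (\<lambda>z. Fn n z - F z) \<le> a / 2 + K * (1 - Ap_int p h)" and "1 - Ap_int p h \<le> p / lim.N * \<kappa> n"
      by (simp_all add: Fn_Ap lim.Ap_int_F)
    moreover from this(2) have "K * (1 - Ap_int p h) \<le> K * (p / lim.N * \<kappa> n)" using K(1) by (intro mult_left_mono) auto
    ultimately show ?case using elim by linarith
  qed
qed (auto intro!: always_eventually less_le_trans[OF _ Ap_int_nonneg])

text \<open>A mean at radius r is at most the average over the annulus outside it, so A^p
  convergence gives convergence on every circle.\<close>

lemma circ_mean_convergence:
  assumes r: "0 \<le> r" "r < 1"
  shows "(\<lambda>n. circ_mean p (\<lambda>z. Fn n z - F z) r) \<longlonglongrightarrow> 0"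
proof (rule tendsto_sandwich[OF _ _ tendsto_const])
  have d: "0 < 1 - r\<^sup>2" using r abs_square_less_1[of r] by simp
  show "\<forall>\<^sub>F n in sequentially. circ_mean p (\<lambda>z. Fn n z - F z) r \<le> Ap_int p (\<lambda>z. Fn n z - F z) / (1 - r\<^sup>2)"
  proof (intro always_eventually allI)
    fix n
    note f = in_ApD[OF diff_Ap[of n]]
    have "(1 - r\<^sup>2) * circ_mean p (\<lambda>z. Fn n z - F z) r \<le> (LINT z:ann r|area. norm (Fn n z - F z) powr p)"
      using r integral_area_split(3)[OF f(3), of r] by (intro ann_integral_lower p f(1)) auto
    also have "\<dots> \<le> (LINT z:ball 0 r|area. norm (Fn n z - F z) powr p) + (LINT z:ann r|area. norm (Fn n z - F z) powr p)"
      by (simp add: set_lebesgue_integral_def)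
    also have "\<dots> = Ap_int p (\<lambda>z. Fn n z - F z)"
      using integral_area_split(1)[OF f(3), of r] r by (simp add: Ap_int_def)
    finally show "circ_mean p (\<lambda>z. Fn n z - F z) r \<le> Ap_int p (\<lambda>z. Fn n z - F z) / (1 - r\<^sup>2)"
      using d by (simp add: field_simps)
  qed
  show "(\<lambda>n. Ap_int p (\<lambda>z. Fn n z - F z) / (1 - r\<^sup>2)) \<longlonglongrightarrow> 0"
    using tendsto_divide[OF Ap_convergence tendsto_const, of "1 - r\<^sup>2"] d by simp
qed auto

lemma Fn_Hp: "in_Hp p (Fn n)" and F_Hp: "in_Hp p F"
  using extremal_problem.Ryabykh(1)[OF seq kn_Hq] lim.Ryabykh(1)[OF k_Hq] by auto

text \<open>The kernel norms are replaced by majorants c n that converge as \<kappa> tends to 0; the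
  explicit bound of \<open>Ryabykh\<close> evaluated at them converges, hence is bounded.\<close>

lemma Fn_Hp_bounded: "\<exists>B. \<forall>n. Hp_norm p (Fn n) powr p \<le> B"
proof -
  define c where "c n = (2 powr (q - 1) * (\<kappa> n powr q + Hp_norm q k powr q)) powr (1 / q)" for n
  have c: "Hp_norm q (kn n) \<le> c n" for n
  proof -
    have "circ_mean q (kn n) r \<le> 2 powr (q - 1) * (\<kappa> n powr q + Hp_norm q k powr q)" if r: "0 < r" "r < 1" for r
    proof -
      have h: "in_Hp q (\<lambda>z. kn n z - k z)" by (intro in_Hp_diff q_gt_1 kn_Hq k_Hq)
      have "circ_mean q (\<lambda>z. (kn n z - k z) + k z) r \<le> 2 powr (q - 1) * (circ_mean q (\<lambda>z. kn n z - k z) r + circ_mean q k r)"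
        using r in_HpD(2)[OF _ h] in_HpD(2)[OF _ k_Hq] q_gt_1 by (intro circ_mean_add_le) auto
      also have "\<dots> \<le> 2 powr (q - 1) * (\<kappa> n powr q + Hp_norm q k powr q)"
        unfolding \<kappa>_def using r q_gt_1 h k_Hq by (intro mult_left_mono add_mono circ_mean_le_Hp_norm) auto
      finally show ?thesis by simp
    qed
    then show ?thesis unfolding c_def using kn_Hq[of n] by (intro in_HpI(2) q_gt_1) (auto simp: in_Hp_def)
  qed
  have "(\<lambda>n. (1 + 5 * (p / Nn n * c n)) powr q) \<longlonglongrightarrow> (1 + 5 * (p / lim.N * ((2 powr (q - 1) * (0 powr q + Hp_norm q k powr q)) powr (1 / q)))) powr q"
    unfolding c_def using q_gt_1 lim.N_pos p \<kappa>_nonneg Nn_pos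
    by (intro tendsto_powr' tendsto_intros \<kappa>_tendsto Nn_tendsto)
      (auto intro!: always_eventually add_nonneg_nonneg mult_nonneg_nonneg divide_nonneg_pos Nn_pos)
  then have "Bseq (\<lambda>n. (1 + 5 * (p / Nn n * c n)) powr q)" by (intro convergent_imp_Bseq convergentI)
  then obtain B where B: "\<And>n. norm ((1 + 5 * (p / Nn n * c n)) powr q) \<le> B" by (auto simp: Bseq_def)
  have "Hp_norm p (Fn n) powr p \<le> B" for n
  proof -
    have "Hp_norm p (Fn n) powr p \<le> (1 + 5 * (p / Nn n * Hp_norm q (kn n))) powr q"
      using extremal_problem.Ryabykh(2)[OF seq kn_Hq] by (simp add: Nn_def)
    also have "\<dots> \<le> (1 + 5 * (p / Nn n * c n)) powr q"
      using p q_gt_1 Nn_pos[of n] c[of n] Hp_norm_nonneg[OF kn_Hq, of n]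
      by (intro powr_mono2 add_mono mult_left_mono) (auto intro!: divide_nonneg_pos add_nonneg_nonneg)
    also have "\<dots> \<le> B" using B[of n] by simp
    finally show ?thesis .
  qed
  then show ?thesis by blast
qed

lemma weak_convergence: "Hp_weak_conv p Fn F"
  unfolding Hp_weak_conv_def
proof (intro allI impI)
  fix L assume L: "Hp_bounded_functional p L"
  then have lin: "\<And>f h a b. in_Hp p f \<Longrightarrow> in_Hp p h \<Longrightarrow> L (\<lambda>z. a * f z + b * h z) = a * L f + b * L h"
    by (auto simp: Hp_bounded_functional_def)
  obtain B where B: "\<And>n. Hp_norm p (Fn n) powr p \<le> B" using Fn_Hp_bounded by blast
  have "(\<lambda>n. L (\<lambda>z. Fn n z - F z)) \<longlonglongrightarrow> 0"
  proof (rule Hp_weak_null[OF p _ _ circ_mean_convergence L])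
    show "in_Hp p (\<lambda>z. Fn n z - F z)" for n by (intro in_Hp_diff p Fn_Hp F_Hp)
    show "Hp_norm p (\<lambda>z. Fn n z - F z) powr p \<le> 2 powr (p - 1) * (B + Hp_norm p F powr p)" for n
    proof (rule Hp_norm_powr_le[OF p])
      show "(\<lambda>z. Fn n z - F z) holomorphic_on disc" using in_ApD(1)[OF diff_Ap] .
      fix r :: real assume r: "0 < r" "r < 1"
      have c: "continuous_on disc (Fn n)" "continuous_on disc F"
        using in_HpD(2)[OF _ Fn_Hp] in_HpD(2)[OF _ F_Hp] p by auto
      have "circ_mean p (\<lambda>z. Fn n z + (-1) * F z) r \<le> 2 powr (p - 1) * (circ_mean p (Fn n) r + circ_mean p (\<lambda>z. (-1) * F z) r)"
        using r c by (intro circ_mean_add_le p continuous_intros) auto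
      also have "circ_mean p (\<lambda>z. (-1) * F z) r = circ_mean p F r" unfolding circ_mean_cmult by simp
      also have "2 powr (p - 1) * (circ_mean p (Fn n) r + circ_mean p F r) \<le> 2 powr (p - 1) * (B + Hp_norm p F powr p)"
        using r by (intro mult_left_mono add_mono circ_mean_le_Hp_norm p F_Hp order_trans[OF circ_mean_le_Hp_norm[OF p Fn_Hp] B]) auto
      finally show "circ_mean p (\<lambda>z. Fn n z - F z) r \<le> 2 powr (p - 1) * (B + Hp_norm p F powr p)" by simp
    qed
  qed
  moreover have "L (\<lambda>z. Fn n z - F z) = L (Fn n) - L F" for n
    using lin[OF Fn_Hp F_Hp, of 1 n "-1"] by simp
  ultimately show "(\<lambda>n. L (Fn n)) \<longlonglongrightarrow> L F" by (simp add: LIM_zero_iff)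
qed

end

section \<open>Polynomial kernels\<close>

lemma borel_measurable_dual_unit:
  assumes "1 < p" "f \<in> borel_measurable M" shows "(\<lambda>x. dual_unit p (f x)) \<in> borel_measurable M"
  using assms(2) borel_measurable_continuous_onI[of "dual_unit p"]
  by (rule measurable_compose) (use continuous_on_dual_unit[OF assms(1) continuous_on_id] in simp)

section \<open>The Euler-Lagrange equation\<close>

context extremal_problem
begin

text \<open>\<open>Ap_int_ge\<close> at F + e h bounds the p-th power integral from below to first
  order in e, convexity bounds it from above; division by p e and e -> 0 give the claim. For 0 <= e
  <= 1 the integrands are dominated by (|F| + |h|)^p.\<close>

lemma variational_inequality:
  assumes h: "in_Ap p h"
  shows "integrable area (\<lambda>z. dual_unit p (F z) * h z)"
    and "Re (phi k h) / N \<le> Re (\<integral>z. dual_unit p (F z) * h z \<partial>area)"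
proof -
  note mF = in_ApD(2)[OF F_Ap] and mh = in_ApD(2)[OF h]
  define \<epsilon> where "\<epsilon> n = inverse (real (Suc n))" for n
  have \<epsilon>: "0 < \<epsilon> n" "\<epsilon> n \<le> 1" for n by (auto simp: \<epsilon>_def field_simps)
  define w where "w z = (norm (F z) + norm (h z)) powr p" for z
  have w: "integrable area w"
  proof (rule Bochner_Integration.integrable_bound)
    show "integrable area (\<lambda>z. 2 powr (p - 1) * (norm (F z) powr p + norm (h z) powr p))"
      using in_ApD(3)[OF F_Ap] in_ApD(3)[OF h] by auto
    show "w \<in> borel_measurable area" unfolding w_def[abs_def] using mF mh by measurable
    show "AE z in area. norm (w z) \<le> norm (2 powr (p - 1) * (norm (F z) powr p + norm (h z) powr p))"
      using p by (intro AE_I2) (auto simp: w_def intro!: powr_add_le)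
  qed
  have m: "(\<lambda>z. dual_unit p (F z + of_real e * h z) * h z) \<in> borel_measurable area" for e
    using mF mh by (intro borel_measurable_times borel_measurable_dual_unit p borel_measurable_add borel_measurable_const)
  have b: "norm (dual_unit p (F z + of_real e * h z) * h z) \<le> w z" if e: "0 \<le> e" "e \<le> 1" for e z
  proof -
    have "norm (of_real e * h z) \<le> norm (h z)" using e by (simp add: norm_mult mult_left_le_one_le)
    then have le: "norm (F z + of_real e * h z) \<le> norm (F z) + norm (h z)"
      using norm_triangle_ineq[of "F z" "of_real e * h z"] by linarith
    have "norm (dual_unit p (F z + of_real e * h z) * h z) \<le> (norm (F z) + norm (h z)) powr (p - 1) * (norm (F z) + norm (h z))"
      unfolding norm_mult norm_dual_unit using p le by (intro mult_mono powr_mono2) auto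
    also have "\<dots> = w z"
      using powr_mult_base[of "norm (F z) + norm (h z)" "p - 1"] by (simp add: w_def mult.commute)
    finally show ?thesis .
  qed
  have i: "integrable area (\<lambda>z. dual_unit p (F z + of_real e * h z) * h z)" if "0 \<le> e" "e \<le> 1" for e
    by (rule Bochner_Integration.integrable_bound[OF w m])
      (use b[OF that] in \<open>auto simp: w_def intro!: AE_I2\<close>)
  show "integrable area (\<lambda>z. dual_unit p (F z) * h z)" using i[of 0] by simp
  have ineq: "Re (phi k h) / N \<le> Re (\<integral>z. dual_unit p (F z + of_real e * h z) * h z \<partial>area)" if e: "0 < e" "e \<le> 1" for e
  proof -
    have Fe: "in_Ap p (\<lambda>z. F z + of_real e * h z)" using p by (intro in_Ap_add in_Ap_cmult F_Ap h) auto
    have "phi k (\<lambda>z. F z + of_real e * h z) = phi k F + of_real e * phi k h"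
      using phi_linear[OF p q F_Ap h k_Ap, of 1 "of_real e"] by simp
    then have "Re (phi k (\<lambda>z. F z + of_real e * h z)) / N - 1 = e * Re (phi k h) / N"
      using N_pos by (simp add: N_def[symmetric] field_simps)
    with Ap_int_ge[OF Fe] have "1 + p * (e * Re (phi k h) / N) \<le> Ap_int p (\<lambda>z. F z + of_real e * h z)" by simp
    \<comment> \<open>The tangent is taken at F + e h and evaluated at F, which yields an upper
      bound without differentiating under the integral.\<close>
    also have "\<dots> \<le> (\<integral>z. norm (F z) powr p + p * e * Re (dual_unit p (F z + of_real e * h z) * h z) \<partial>area)"
      unfolding Ap_int_def
    proof (rule integral_mono)
      show "integrable area (\<lambda>z. norm (F z + of_real e * h z) powr p)" using in_ApD(3)[OF Fe] .
      show "integrable area (\<lambda>z. norm (F z) powr p + p * e * Re (dual_unit p (F z + of_real e * h z) * h z))"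
        using in_ApD(3)[OF F_Ap] i[of e] e by (intro Bochner_Integration.integrable_add integrable_mult_right integrable_Re) auto
      show "norm (F z + of_real e * h z) powr p \<le> norm (F z) powr p + p * e * Re (dual_unit p (F z + of_real e * h z) * h z)" for z
        using norm_powr_tangent[of p "F z + of_real e * h z" "F z"] p by (simp add: algebra_simps)
    qed
    also have "\<dots> = 1 + p * e * Re (\<integral>z. dual_unit p (F z + of_real e * h z) * h z \<partial>area)"
    proof -
      have "integrable area (\<lambda>z. Re (dual_unit p (F z + of_real e * h z) * h z))"
        using i[of e] e by (intro integrable_Re) auto
      moreover have "(\<integral>z. Re (dual_unit p (F z + of_real e * h z) * h z) \<partial>area) = Re (\<integral>z. dual_unit p (F z + of_real e * h z) * h z \<partial>area)"
        using i[of e] e by (intro integral_Re) auto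
      ultimately show ?thesis
        using in_ApD(3)[OF F_Ap] Ap_int_F unfolding Ap_int_def
        by (subst Bochner_Integration.integral_add) (auto simp del: times_complex.sel)
    qed
    finally have "(p * e) * (Re (phi k h) / N) \<le> (p * e) * Re (\<integral>z. dual_unit p (F z + of_real e * h z) * h z \<partial>area)" by simp
    then show ?thesis using p e by (subst (asm) mult_le_cancel_left_pos) auto
  qed
  have "(\<lambda>n. \<integral>z. dual_unit p (F z + of_real (\<epsilon> n) * h z) * h z \<partial>area) \<longlonglongrightarrow> (\<integral>z. dual_unit p (F z) * h z \<partial>area)"
  proof (rule integral_dominated_convergence[OF _ m w])
    show "(\<lambda>z. dual_unit p (F z) * h z) \<in> borel_measurable area" using m[of 0] by simp
    show "AE z in area. (\<lambda>n. dual_unit p (F z + of_real (\<epsilon> n) * h z) * h z) \<longlonglongrightarrow> dual_unit p (F z) * h z"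
    proof (intro AE_I2 tendsto_mult tendsto_const)
      fix z
      have "(\<lambda>n. F z + of_real (\<epsilon> n) * h z) \<longlonglongrightarrow> F z + of_real 0 * h z"
        unfolding \<epsilon>_def by (intro tendsto_intros LIMSEQ_inverse_real_of_nat)
      then show "(\<lambda>n. dual_unit p (F z + of_real (\<epsilon> n) * h z)) \<longlonglongrightarrow> dual_unit p (F z)"
        by (intro isCont_tendsto_compose[OF isCont_dual_unit[OF p]]) simp
    qed
    show "AE z in area. norm (dual_unit p (F z + of_real (\<epsilon> n) * h z) * h z) \<le> w z" for n
      using b[of "\<epsilon> n"] \<epsilon>[of n] by (intro AE_I2) auto
  qed
  from tendsto_Re[OF this]
  show "Re (phi k h) / N \<le> Re (\<integral>z. dual_unit p (F z) * h z \<partial>area)"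
    by (rule LIMSEQ_le_const) (use ineq[OF \<epsilon>] in blast)
qed

text \<open>The test functions form a complex vector space, so the inequality for h, -h, i h and -i
  h is an equation.\<close>

lemma euler_lagrange:
  assumes h: "in_Ap p h"
  shows "(\<integral>z. dual_unit p (F z) * h z \<partial>area) = phi k h / of_real N"
proof -
  define Y where "Y = (\<integral>z. dual_unit p (F z) * h z \<partial>area)"
  have c: "Re (c * phi k h) / N \<le> Re (c * Y)" for c
  proof -
    have "phi k (\<lambda>z. c * h z) = c * phi k h" using phi_linear[OF p q h h k_Ap, of c 0] by simp
    moreover have "(\<integral>z. dual_unit p (F z) * (c * h z) \<partial>area) = c * Y"
      unfolding Y_def by (subst integral_mult_right_zero[symmetric]) (simp add: ac_simps)
    ultimately show ?thesis using variational_inequality(2)[OF in_Ap_cmult[OF h, of c]] by simp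
  qed
  have "Re Y = Re (phi k h) / N" "Im Y = Im (phi k h) / N"
    using c[of 1] c[of "-1"] c[of "\<i>"] c[of "-\<i>"] by simp_all
  then show ?thesis by (simp add: Y_def[symmetric] complex_eq_iff Re_divide_of_real Im_divide_of_real)
qed

lemma phi_F: "phi k F = of_real N"
proof -
  have "(\<integral>z. dual_unit p (F z) * F z \<partial>area) = of_real (Ap_int p F)"
    unfolding dual_unit_mult_self Ap_int_def by (rule integral_complex_of_real)
  then show ?thesis using euler_lagrange[OF F_Ap] N_pos by (simp add: Ap_int_F field_simps)
qed

end

section \<open>Monomial and polynomial kernels\<close>

lemma in_Ap_power: "0 < p \<Longrightarrow> in_Ap p (\<lambda>z. z ^ j)"
  unfolding in_Ap_iff
proof
  assume p: "0 < p"
  show h: "(\<lambda>z. z ^ j) holomorphic_on disc" by (intro holomorphic_intros)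
  show "integrable area (\<lambda>z. norm (z ^ j) powr p)"
  proof (rule integrable_area_bounded[of _ 1])
    show "(\<lambda>z. norm (z ^ j) powr p) \<in> borel_measurable area" using holomorphic_measurable[OF h] by measurable
    show "norm (norm (z ^ j) powr p) \<le> 1" if "z \<in> disc" for z :: complex
      using that p powr_mono2[of p "norm (z ^ j)" 1] by (auto simp: mem_disc norm_power power_le_one)
  qed
qed

lemma phi_power_rotate:
  assumes f: "in_Ap p f" and u: "norm u = 1"
  shows "phi (\<lambda>z. z ^ j) (\<lambda>z. f (u * z)) = u ^ j * phi (\<lambda>z. z ^ j) f"
proof -
  have uu: "cnj u * u = 1" using u by (simp add: mult.commute complex_norm_square[symmetric])
  define g where "g z = f z * cnj ((cnj u * z) ^ j)" for z
  have g: "g \<in> borel_measurable area"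
    unfolding g_def[abs_def]
    by (intro borel_measurable_times in_ApD(2)[OF f] borel_measurable_cnj holomorphic_measurable holomorphic_intros)
  have "phi (\<lambda>z. z ^ j) (\<lambda>z. f (u * z)) = (\<integral>z. g (u * z) \<partial>area)"
    using uu in_ApD(1)[OF in_Ap_rotate(1)[OF u f]]
    by (subst phi_eq) (auto intro!: holomorphic_intros simp: g_def simp flip: mult.assoc)
  also have "\<dots> = (\<integral>z. g z \<partial>area)" by (rule integral_area_rotate(1)[OF u g])
  also have "\<dots> = (\<integral>z. u ^ j * (f z * cnj (z ^ j)) \<partial>area)"
    by (simp add: g_def power_mult_distrib ac_simps)
  also have "\<dots> = u ^ j * phi (\<lambda>z. z ^ j) f"
    using in_ApD(1)[OF f] by (subst phi_eq) (auto intro!: holomorphic_intros)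
  finally show ?thesis .
qed

lemma phi_power_dilate:
  assumes p: "1 < p" and f: "in_Ap p f" and r: "0 < r" "r \<le> 1"
  shows "phi (\<lambda>z. z ^ j) (\<lambda>z. f (of_real r * z)) = of_real r ^ j * phi (\<lambda>z. z ^ j) f"
proof -
  have "phi (\<lambda>z. z ^ j) (\<lambda>z. f (of_real r * z)) = phi (\<lambda>z. (of_real r * z) ^ j) f"
    using p by (intro phi_dilate_adjoint[OF p refl f in_Ap_power r]) auto
  also have "\<dots> = (\<integral>z. of_real r ^ j * (f z * cnj (z ^ j)) \<partial>area)"
    using in_ApD(1)[OF f] by (subst phi_eq) (auto intro!: holomorphic_intros simp: power_mult_distrib ac_simps)
  also have "\<dots> = of_real r ^ j * phi (\<lambda>z. z ^ j) f"
    using in_ApD(1)[OF f] by (subst phi_eq) (auto intro!: holomorphic_intros)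
  finally show ?thesis .
qed

lemma phi_polynomial:
  assumes p: "1 < p" and f: "in_Ap p f" and k: "\<And>z. z \<in> disc \<Longrightarrow> k z = (\<Sum>j\<le>d. b j * z ^ j)"
  shows "phi k f = (\<Sum>j\<le>d. cnj (b j) * phi (\<lambda>z. z ^ j) f)"
proof -
  have i: "integrable area (\<lambda>z. f z * cnj (z ^ j))" for j
    using p by (intro phi_bound(1)[OF p refl f in_Ap_power]) auto
  have "k holomorphic_on disc"
    by (rule holomorphic_transform[where f="\<lambda>z. \<Sum>j\<le>d. b j * z ^ j"]) (auto intro!: holomorphic_intros simp: k)
  then have "phi k f = (\<integral>z. f z * cnj (k z) \<partial>area)" using in_ApD(1)[OF f] by (intro phi_eq)
  also have "\<dots> = (\<integral>z. (\<Sum>j\<le>d. cnj (b j) * (f z * cnj (z ^ j))) \<partial>area)"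
    by (intro Bochner_Integration.integral_cong refl) (simp add: k sum_distrib_left ac_simps)
  also have "\<dots> = (\<Sum>j\<le>d. \<integral>z. cnj (b j) * (f z * cnj (z ^ j)) \<partial>area)"
    by (rule Bochner_Integration.integral_sum) (intro integrable_mult_right i)
  also have "\<dots> = (\<Sum>j\<le>d. cnj (b j) * (\<integral>z. f z * cnj (z ^ j) \<partial>area))" by simp
  also have "\<dots> = (\<Sum>j\<le>d. cnj (b j) * phi (\<lambda>z. z ^ j) f)"
    using in_ApD(1)[OF f] by (intro sum.cong refl) (subst phi_eq; auto intro!: holomorphic_intros)
  finally show ?thesis .
qed

text \<open>The divided difference at 1 of the polynomial with coefficients c, written as a
  polynomial so that it is defined at u = 1 too. Its value there is the derivative, the \<Lambda> of
  the bounds below.\<close>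

definition dquot :: "(nat \<Rightarrow> complex) \<Rightarrow> nat \<Rightarrow> complex \<Rightarrow> complex" where
  "dquot c d u = (\<Sum>j\<le>d. c j * (\<Sum>i<j. u ^ i))"

lemma dquot: "(\<Sum>j\<le>d. c j * u ^ j) - (\<Sum>j\<le>d. c j) = (u - 1) * dquot c d u"
proof -
  have "c j * u ^ j - c j = (u - 1) * (c j * (\<Sum>i<j. u ^ i))" for j
  proof -
    have "c j * u ^ j - c j = c j * (u ^ j - 1)" by (simp add: algebra_simps)
    then show ?thesis by (simp only: power_diff_1_eq ac_simps)
  qed
  then show ?thesis
    unfolding dquot_def sum_subtractf[symmetric] by (simp only: sum_distrib_left[symmetric])
qed

lemma dquot_1: "dquot c d 1 = (\<Sum>j\<le>d. of_nat j * c j)"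
  by (simp add: dquot_def mult.commute)

lemma continuous_dquot: "isCont (dquot c d) u"
  unfolding dquot_def by (intro continuous_intros)

lemma dquot_bound: "\<exists>C\<ge>0. \<forall>u. norm u \<le> 1 \<longrightarrow> norm (dquot c d u - dquot c d 1) \<le> C * norm (u - 1)"
proof -
  define C where "C = (\<Sum>j\<le>d. norm (c j) * (\<Sum>i<j. real i))"
  have "norm (dquot c d u - dquot c d 1) \<le> C * norm (u - 1)" if u: "norm u \<le> 1" for u
  proof -
    have pw: "norm (u ^ i - 1) \<le> real i * norm (u - 1)" for i
    proof -
      have "norm (u ^ i - 1) = norm (u - 1) * norm (\<Sum>l<i. u ^ l)" by (simp add: power_diff_1_eq norm_mult)
      also have "norm (u - 1) * norm (\<Sum>l<i. u ^ l) \<le> norm (u - 1) * (\<Sum>l<i. 1)"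
        using u by (intro mult_left_mono order_trans[OF norm_sum] sum_mono) (simp_all add: norm_power power_le_one)
      finally show ?thesis by (simp add: mult.commute)
    qed
    have "dquot c d u - dquot c d 1 = (\<Sum>j\<le>d. c j * (\<Sum>i<j. u ^ i - 1))"
      by (simp add: dquot_def sum_subtractf right_diff_distrib)
    also have "norm \<dots> \<le> (\<Sum>j\<le>d. norm (c j) * (\<Sum>i<j. real i * norm (u - 1)))"
      by (intro order_trans[OF norm_sum] sum_mono)
        (auto simp: norm_mult intro!: mult_left_mono order_trans[OF norm_sum] sum_mono pw)
    also have "\<dots> = C * norm (u - 1)" by (simp add: C_def sum_distrib_right mult.assoc)
    finally show ?thesis .
  qed
  moreover have "0 \<le> C" by (auto simp: C_def intro!: sum_nonneg mult_nonneg_nonneg)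
  ultimately show ?thesis by blast
qed

text \<open>The derivative of v -> f(\<rho> v z) at v = 1 under the integral sign. The inner
  dilation keeps f' bounded, so dominated convergence applies. The points u n are general enough to
  cover real dilations as well as rotations.\<close>

lemma dilation_quotient_limit:
  fixes u :: "nat \<Rightarrow> complex"
  assumes f: "f holomorphic_on disc" and \<rho>: "0 \<le> \<rho>" "\<rho> < 1"
    and u: "u \<longlonglongrightarrow> 1" "\<And>n. u n \<noteq> 1" "\<And>n. norm (u n) \<le> 1"
    and bm: "\<And>n. b n \<in> borel_measurable area" "b0 \<in> borel_measurable area"
    and bB: "\<And>n z. z \<in> disc \<Longrightarrow> norm (b n z) \<le> B"
    and bl: "\<And>z. z \<in> disc \<Longrightarrow> (\<lambda>n. b n z) \<longlonglongrightarrow> b0 z"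
  shows "(\<lambda>n. \<integral>z. b n z * ((f (of_real \<rho> * (u n * z)) - f (of_real \<rho> * z)) / (u n - 1)) \<partial>area)
    \<longlonglongrightarrow> (\<integral>z. b0 z * (of_real \<rho> * z * deriv f (of_real \<rho> * z)) \<partial>area)"
proof -
  have df: "deriv f holomorphic_on disc" using f by (intro holomorphic_deriv) auto
  have cb: "cball 0 \<rho> \<subseteq> disc" using \<rho> by (auto simp: mem_disc)
  obtain C where C0: "0 \<le> C" and C: "\<And>w. norm w \<le> \<rho> \<Longrightarrow> norm (deriv f w) \<le> C"
    using bounded_on_cball[OF holomorphic_on_imp_continuous_on[OF df] \<rho>(2)] by blast
  have B0: "0 \<le> B" using bB[of 0 0] norm_ge_zero order_trans zero_in_disc by blast
  have Rd: "of_real \<rho> * z \<in> disc" "of_real \<rho> * z \<in> cball 0 \<rho>" if "norm z \<le> 1" for z :: complex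
    using that \<rho> mult_left_le[of "norm z" \<rho>] by (auto simp: mem_disc norm_mult)
  have un: "norm (u n * z) \<le> 1" if "z \<in> disc" for n z
    using mult_mem_disc[OF u(3) that, of n] by (simp add: mem_disc)
  have diff: "norm ((f (of_real \<rho> * (u n * z)) - f (of_real \<rho> * z)) / (u n - 1)) \<le> C" if z: "z \<in> disc" for n z
  proof -
    have z': "norm z \<le> 1" using z by (simp add: mem_disc)
    have "norm (f (of_real \<rho> * (u n * z)) - f (of_real \<rho> * z)) \<le> C * norm (of_real \<rho> * (u n * z) - of_real \<rho> * z)"
    proof (rule field_differentiable_bound[of "cball 0 \<rho>" f "deriv f"])
      show "(f has_field_derivative deriv f w) (at w within cball 0 \<rho>)" if "w \<in> cball 0 \<rho>" for w
        using holomorphic_derivI[OF f open_disc] that cb by blast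
    qed (use C Rd(2)[OF z'] Rd(2)[OF un[OF z]] in auto)
    also have "of_real \<rho> * (u n * z) - of_real \<rho> * z = (u n - 1) * (of_real \<rho> * z)" by (simp add: algebra_simps)
    also have "C * norm ((u n - 1) * (of_real \<rho> * z)) \<le> C * (norm (u n - 1) * 1)"
      unfolding norm_mult[of "u n - 1"] using C0 Rd(1)[OF z'] by (intro mult_left_mono) (auto simp: mem_disc)
    finally show ?thesis using u(2)[of n] by (simp add: norm_divide divide_le_eq)
  qed
  have ptl: "(\<lambda>n. (f (of_real \<rho> * (u n * z)) - f (of_real \<rho> * z)) / (u n - 1)) \<longlonglongrightarrow> of_real \<rho> * z * deriv f (of_real \<rho> * z)"
    if z: "z \<in> disc" for z
  proof -
    have z': "norm z \<le> 1" using z by (simp add: mem_disc)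
    have "((\<lambda>v. f (of_real \<rho> * z * v)) has_field_derivative deriv f (of_real \<rho> * z * 1) * (of_real \<rho> * z)) (at 1)"
      by (rule DERIV_chain2[of f]) (use holomorphic_derivI[OF f open_disc Rd(1)[OF z']] in \<open>auto intro!: derivative_eq_intros\<close>)
    then have "(\<lambda>v. (f (of_real \<rho> * z * v) - f (of_real \<rho> * z * 1)) / (v - 1)) \<midarrow>1\<rightarrow> of_real \<rho> * z * deriv f (of_real \<rho> * z)"
      unfolding has_field_derivative_iff by (simp add: mult.commute)
    moreover have "filterlim u (at 1) sequentially"
      using u by (auto simp: filterlim_at)
    ultimately have "(\<lambda>n. (f (of_real \<rho> * z * u n) - f (of_real \<rho> * z * 1)) / (u n - 1)) \<longlonglongrightarrow> of_real \<rho> * z * deriv f (of_real \<rho> * z)"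
      by (rule filterlim_compose)
    then show ?thesis by (simp add: ac_simps)
  qed
  have m1: "(\<lambda>z. f (of_real \<rho> * z)) \<in> borel_measurable area" "(\<lambda>z. deriv f (of_real \<rho> * z)) \<in> borel_measurable area"
    using f df \<rho> by (auto intro!: holomorphic_measurable holomorphic_on_mult_arg)
  have m2: "(\<lambda>z. f (of_real \<rho> * (u n * z))) \<in> borel_measurable area" for n
  proof -
    have "norm (of_real \<rho> * u n) \<le> 1" using \<rho> u(3)[of n] by (simp add: norm_mult mult_le_one)
    from holomorphic_measurable[OF holomorphic_on_mult_arg[OF f this]] show ?thesis by (simp add: mult.assoc)
  qed
  have mz: "(\<lambda>z. z) \<in> borel_measurable area" by (rule borel_measurable_area_borel) simp
  show ?thesis
  proof (rule integral_dominated_convergence[where w="\<lambda>_. B * C"])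
    show "(\<lambda>z. b0 z * (of_real \<rho> * z * deriv f (of_real \<rho> * z))) \<in> borel_measurable area"
      using m1 bm mz by measurable
    show "(\<lambda>z. b n z * ((f (of_real \<rho> * (u n * z)) - f (of_real \<rho> * z)) / (u n - 1))) \<in> borel_measurable area" for n
      using m1 m2 bm by measurable
    show "AE z in area. (\<lambda>n. b n z * ((f (of_real \<rho> * (u n * z)) - f (of_real \<rho> * z)) / (u n - 1)))
        \<longlonglongrightarrow> b0 z * (of_real \<rho> * z * deriv f (of_real \<rho> * z))"
      using bl ptl by (intro AE_I2 tendsto_mult) auto
    show "AE z in area. norm (b n z * ((f (of_real \<rho> * (u n * z)) - f (of_real \<rho> * z)) / (u n - 1))) \<le> B * C" for n
      unfolding norm_mult using bB diff B0 by (intro AE_I2 mult_mono) auto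
  qed simp
qed

text \<open>One half of the identity \<open>M\<^sub>p\<^sup>p(1, G) = \<integral> \<bar>G\<bar>\<^sup>p + (p/2) Re \<integral> \<bar>G\<bar>\<^sup>p\<^sup>-\<^sup>2 cnj G z G'\<close> of the divergence
  theorem, obtained from dilations and convexity.\<close>

lemma dilation_derivative_le:
  assumes p: "1 < p" and f: "in_Hp p f" and \<rho>: "0 < \<rho>" "\<rho> < 1"
  shows "p * Re (\<integral>z. dual_unit p (f (of_real \<rho> * z)) * (of_real \<rho> * z * deriv f (of_real \<rho> * z)) \<partial>area)
    \<le> 2 * (Hp_norm p f powr p - Ap_int p (\<lambda>z. f (of_real \<rho> * z)))"
proof -
  define M where "M = Hp_norm p f powr p"
  define G where "G z = f (of_real \<rho> * z)" for z
  have fA: "in_Ap p f" using in_Hp_imp_in_Ap[OF p f] by simp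
  have fh: "f holomorphic_on disc" using in_ApD[OF fA] by simp
  have G: "in_Ap p G" unfolding G_def using \<rho> by (intro in_Ap_dilate(1) fA) auto
  have Gh: "G holomorphic_on disc" using in_ApD[OF G] by simp
  have Gc: "continuous_on disc G" using Gh by (rule holomorphic_on_imp_continuous_on)
  define A where "A = Ap_int p G"
  define s where "s = radius"
  have s: "0 < s n" "s n < 1" for n by (auto simp: s_def radius_pos radius)
  have sl: "s \<longlonglongrightarrow> 1" using radius_tendsto by (simp add: s_def)
  obtain B where B0: "0 \<le> B" and fB: "\<And>w. norm w \<le> \<rho> \<Longrightarrow> norm (f w) \<le> B"
    using bounded_on_cball[OF holomorphic_on_imp_continuous_on[OF fh] \<rho>(2)] by blast
  have B: "norm (G z) \<le> B" if "z \<in> disc" for z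
    using that \<rho> mult_left_le[of "norm z" \<rho>] unfolding G_def by (intro fB) (auto simp: mem_disc norm_mult)
  have sG: "of_real (s n) * z \<in> disc" if "z \<in> disc" for n z
    using that s[of n] by (intro mult_mem_disc) auto
  define W where "W n z = dual_unit p (G (of_real (s n) * z))" for n z
  have Gsm: "(\<lambda>z. G (of_real (s n) * z)) \<in> borel_measurable area" for n
    using s[of n] by (intro holomorphic_measurable holomorphic_on_mult_arg Gh) auto
  have WB: "norm (W n z) \<le> B powr (p - 1)" if "z \<in> disc" for n z
    unfolding W_def norm_dual_unit using B[OF sG[OF that]] p by (intro powr_mono2) auto
  define DQ where "DQ n z = (f (of_real \<rho> * (of_real (s n) * z)) - f (of_real \<rho> * z)) / (of_real (s n) - 1)" for n z
  define J where "J n = (\<integral>z. W n z * DQ n z \<partial>area)" for n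
  define J0 where "J0 = (\<integral>z. dual_unit p (G z) * (of_real \<rho> * z * deriv f (of_real \<rho> * z)) \<partial>area)"
  have lim: "J \<longlonglongrightarrow> J0"
    unfolding J_def[abs_def] J0_def DQ_def
  proof (rule dilation_quotient_limit[where B="B powr (p - 1)"])
    show "W n \<in> borel_measurable area" for n unfolding W_def[abs_def] by (intro borel_measurable_dual_unit p Gsm)
    show "(\<lambda>z. dual_unit p (G z)) \<in> borel_measurable area"
      by (intro borel_measurable_dual_unit p in_ApD(2)[OF G])
    show "(\<lambda>n. complex_of_real (s n)) \<longlonglongrightarrow> 1" using tendsto_of_real[OF sl] by simp
    show "complex_of_real (s n) \<noteq> 1" for n using s[of n] by simp
    show "norm (complex_of_real (s n)) \<le> 1" for n using s[of n] by simp
    show "(\<lambda>n. W n z) \<longlonglongrightarrow> dual_unit p (G z)" if z: "z \<in> disc" for z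
    proof -
      have "(\<lambda>n. of_real (s n) * z) \<longlonglongrightarrow> of_real 1 * z" by (intro tendsto_intros sl)
      then have "(\<lambda>n. G (of_real (s n) * z)) \<longlonglongrightarrow> G z"
        using z Gc sG[OF z] by (intro continuous_on_tendsto_compose[OF Gc]) auto
      then show ?thesis unfolding W_def by (intro isCont_tendsto_compose[OF isCont_dual_unit[OF p]])
    qed
  qed (use WB fh \<rho> in auto)
  have le: "p * Re (J n) \<le> (1 + s n) / (s n)\<^sup>2 * (M - A)" for n
  proof -
    define T where "T = (ann_int p G (s n))"
    have s': "0 < s n" "s n \<le> 1" "0 \<le> s n" using s[of n] by auto
    note Gs = in_Ap_dilate[OF s'(1,2) G]
    have iJ: "integrable area (\<lambda>z. W n z * DQ n z)"
    proof (rule integrable_area_bounded)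
      show "(\<lambda>z. W n z * DQ n z) \<in> borel_measurable area"
        using Gsm[of n] in_ApD(2)[OF G] unfolding W_def G_def DQ_def
        by (intro borel_measurable_times borel_measurable_dual_unit p borel_measurable_divide borel_measurable_diff borel_measurable_const)
      show "norm (W n z * DQ n z)
         \<le> B powr (p - 1) * ((B + B) / norm (complex_of_real (s n) - 1))" if z: "z \<in> disc" for z
        unfolding norm_mult norm_divide DQ_def using WB[OF z, of n] B[OF z] B[OF sG[OF z, of n]] B0
        by (intro mult_mono divide_right_mono order_trans[OF norm_triangle_ineq4] add_mono) (auto simp: G_def)
    qed
    have "(1 - s n) * (p * Re (J n)) = (\<integral>z. (1 - s n) * (p * Re (W n z * DQ n z)) \<partial>area)"
      unfolding J_def integral_mult_right_zero by (simp only: integral_Re[OF iJ])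
    \<comment> \<open>The tangent is taken at the dilated value G(s z) and evaluated at G(z), so the
      quotient bounds the difference of the p-th powers from below.\<close>
    also have "\<dots> \<le> (\<integral>z. norm (G z) powr p - norm (G (of_real (s n) * z)) powr p \<partial>area)"
    proof (rule integral_mono)
      show "integrable area (\<lambda>z. (1 - s n) * (p * Re (W n z * DQ n z)))"
        using iJ by (intro integrable_mult_right integrable_Re)
      show "integrable area (\<lambda>z. norm (G z) powr p - norm (G (of_real (s n) * z)) powr p)"
        using in_ApD(3)[OF G] in_ApD(3)[OF Gs(1)] by (rule Bochner_Integration.integrable_diff)
      fix z
      have "of_real (1 - s n) * (W n z * DQ n z)
        = W n z * (G z - G (of_real (s n) * z))"
        using s[of n] by (simp add: G_def DQ_def divide_simps) (simp add: algebra_simps)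
      then have "Re (W n z * (G z - G (of_real (s n) * z))) = (1 - s n) * Re (W n z * DQ n z)"
        by (metis Re_complex_of_real Im_complex_of_real mult_zero_left diff_zero times_complex.sel(1))
      then show "(1 - s n) * (p * Re (W n z * DQ n z))
        \<le> norm (G z) powr p - norm (G (of_real (s n) * z)) powr p"
        using norm_powr_tangent[of p "G (of_real (s n) * z)" "G z"] p unfolding W_def
        by (simp add: mult.left_commute del: times_complex.sel)
    qed
    also have "\<dots> = A - Ap_int p (\<lambda>z. G (of_real (s n) * z))"
      using in_ApD(3)[OF G] in_ApD(3)[OF Gs(1)] by (simp add: A_def Ap_int_def)
    finally have 1: "(1 - s n) * (p * Re (J n)) \<le> A - Ap_int p (\<lambda>z. G (of_real (s n) * z))" .
    have 2: "(s n)\<^sup>2 * Ap_int p (\<lambda>z. G (of_real (s n) * z)) = A - T"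
      using Gs(2) integral_area_split(1)[OF in_ApD(3)[OF G] s'(2)] by (simp add: A_def Ap_int_def T_def)
    \<comment> \<open>Means of G at r are means of f at \<rho> r, hence at most M. Combined with
      \<open>1\<close> and \<open>2\<close> this gives s^2 (1-s) p Re J <= (1-s^2) (M-A); cancelling
      1 - s leaves 1 + s, the origin of the factor 2.\<close>
    have 3: "T \<le> (1 - (s n)\<^sup>2) * M"
      unfolding T_def
    proof (rule ann_integral_upper(2))
      fix r assume r: "s n \<le> r" "r < 1"
      have r0: "0 \<le> \<rho> * r" "\<rho> * r < 1" using r \<rho> s'(1) mult_strict_mono[of \<rho> 1 r 1] by auto
      have "circ_mean p G r = circ_mean p f (\<rho> * r)"
        by (simp add: circ_mean_def G_def mult.assoc)
      also have "\<dots> \<le> M" unfolding M_def by (rule circ_mean_le_Hp_norm[OF p f r0])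
      finally show "circ_mean p G r \<le> M" .
    qed (use p Gc s[of n] s' in auto)
    have "(s n)\<^sup>2 * ((1 - s n) * (p * Re (J n))) \<le> (s n)\<^sup>2 * (A - Ap_int p (\<lambda>z. G (of_real (s n) * z)))"
      using 1 by (intro mult_left_mono) auto
    also have "\<dots> = (s n)\<^sup>2 * A - (A - T)" by (simp add: right_diff_distrib 2)
    also have "\<dots> \<le> (1 - (s n)\<^sup>2) * (M - A)" using 3 by (simp add: algebra_simps)
    also have "\<dots> = (1 - s n) * ((1 + s n) * (M - A))" by (simp add: algebra_simps power2_eq_square)
    finally have "(1 - s n) * ((s n)\<^sup>2 * (p * Re (J n))) \<le> (1 - s n) * ((1 + s n) * (M - A))" by (simp add: ac_simps)
    then have "(s n)\<^sup>2 * (p * Re (J n)) \<le> (1 + s n) * (M - A)" using s[of n] by simp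
    then show ?thesis using s[of n] by (simp add: pos_le_divide_eq mult.commute)
  qed
  have "p * Re J0 \<le> (1 + 1) / 1\<^sup>2 * (M - A)"
  proof (rule LIMSEQ_le)
    show "(\<lambda>n. p * Re (J n)) \<longlonglongrightarrow> p * Re J0" by (intro tendsto_intros lim)
    show "(\<lambda>n. (1 + s n) / (s n)\<^sup>2 * (M - A)) \<longlonglongrightarrow> (1 + 1) / 1\<^sup>2 * (M - A)"
      by (intro tendsto_intros sl) auto
  qed (use le in blast)
  then show ?thesis by (simp add: J0_def G_def[abs_def] M_def A_def)
qed

section \<open>Lower bound for the Hardy norm of the limit\<close>

locale polynomial_extremal_problem = extremal_problem +
  fixes b :: "nat \<Rightarrow> complex" and d :: nat
  assumes k_poly: "\<And>z. z \<in> disc \<Longrightarrow> k z = (\<Sum>j\<le>d. b j * z ^ j)"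
begin

definition c where "c j = cnj (b j) * phi (\<lambda>z. z ^ j) F"

text \<open>The value of the functional at the rotated F, for |u| = 1: rotation multiplies the
  pairing with z^j by u^j.\<close>

definition X where "X u = (\<Sum>j\<le>d. c j * u ^ j)"

lemma X_1: "X 1 = of_real N"
  using phi_polynomial[OF p F_Ap k_poly] phi_F by (simp add: X_def c_def)

lemma phi_rotate: assumes u: "norm u = 1" shows "phi k (\<lambda>z. F (u * z)) = X u"
proof -
  have "phi k (\<lambda>z. F (u * z)) = (\<Sum>j\<le>d. cnj (b j) * phi (\<lambda>z. z ^ j) (\<lambda>z. F (u * z)))"
    by (rule phi_polynomial[OF p in_Ap_rotate(1)[OF u F_Ap] k_poly])
  also have "\<dots> = X u"
    unfolding phi_power_rotate[OF F_Ap u] X_def c_def by (simp add: ac_simps)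
  finally show ?thesis .
qed

lemma X_minus_N: "X u - of_real N = (u - 1) * dquot c d u"
  using dquot[of c u d] X_1 by (simp add: X_def)

text \<open>The weighted square that \<open>uniform_convexity_quadratic\<close> controls, here
  measuring how far F moves under a rotation.\<close>

definition quad where
  "quad u z = (norm (F z) + norm (F (u * z))) powr (p - 2) * (norm (F z - F (u * z)))\<^sup>2"

lemma measurable_rotated: "norm u = 1 \<Longrightarrow> (\<lambda>z. F (u * z)) \<in> borel_measurable area"
  by (intro holomorphic_measurable holomorphic_on_mult_arg F_hol) auto

lemma measurable_quad: "norm u = 1 \<Longrightarrow> quad u \<in> borel_measurable area"
  unfolding quad_def[abs_def] using measurable_rotated[of u] in_ApD(2)[OF F_Ap] by measurable

text \<open>Averaging over \<open>u\<close> and its conjugate removes the first order term of \<open>N - Re (X u)\<close>.\<close>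

lemma quad_bound:
  "\<exists>C\<ge>0. \<forall>u. norm u = 1 \<longrightarrow> integrable area (quad u) \<and> (\<integral>z. quad u z \<partial>area) \<le> C * (norm (u - 1))\<^sup>2"
proof -
  obtain c0 where c0: "c0 > 0" "\<And>a b :: complex. c0 * ((norm a + norm b) powr (p - 2) * (norm (a - b))\<^sup>2)
      \<le> (norm a powr p + norm b powr p) / 2 - norm ((a + b) / 2) powr p"
    using uniform_convexity_quadratic[OF p] by blast
  obtain C' where C': "C' \<ge> 0" "\<And>u. norm u \<le> 1 \<Longrightarrow> norm (dquot c d u - dquot c d 1) \<le> C' * norm (u - 1)"
    using dquot_bound[of c d] by blast
  define \<Lambda> where "\<Lambda> = dquot c d 1"
  have one: "integrable area (quad u)" "c0 * (\<integral>z. quad u z \<partial>area) \<le> p / (2 * N) * (N - Re (X u))"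
    if u: "norm u = 1" for u
  proof -
    define m where "m z = (1/2) * F z + (1/2) * F (u * z)" for z
    note R = in_Ap_rotate[OF u F_Ap]
    have m: "in_Ap p m" unfolding m_def using p by (intro in_Ap_add in_Ap_cmult F_Ap R) auto
    have i: "integrable area (\<lambda>z. (norm (F z) powr p + norm (F (u * z)) powr p) / 2 - norm (m z) powr p)"
      using in_ApD(3)[OF F_Ap] in_ApD(3)[OF R(1)] in_ApD(3)[OF m] by auto
    have le: "c0 * quad u z \<le> (norm (F z) powr p + norm (F (u * z)) powr p) / 2 - norm (m z) powr p" for z
      using c0(2)[of "F z" "F (u * z)"] by (simp add: quad_def m_def add_divide_distrib)
    have q0: "0 \<le> quad u z" for z by (simp add: quad_def)
    have ic: "integrable area (\<lambda>z. c0 * quad u z)"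
      using measurable_quad[OF u] le c0(1) q0
      by (intro Bochner_Integration.integrable_bound[OF i]) (auto intro!: AE_I2 order_trans[OF le abs_ge_self])
    then show iq: "integrable area (quad u)" using c0(1) by simp
    have "c0 * (\<integral>z. quad u z \<partial>area) = (\<integral>z. c0 * quad u z \<partial>area)" by simp
    also have "\<dots> \<le> (\<integral>z. (norm (F z) powr p + norm (F (u * z)) powr p) / 2 - norm (m z) powr p \<partial>area)"
      by (rule integral_mono[OF ic i le])
    also have "\<dots> = (Ap_int p F + Ap_int p (\<lambda>z. F (u * z))) / 2 - Ap_int p m"
      using in_ApD(3)[OF F_Ap] in_ApD(3)[OF R(1)] in_ApD(3)[OF m] by (simp add: Ap_int_def)
    also have "\<dots> = 1 - Ap_int p m" using R(2) by (simp add: Ap_int_F)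
    also have "\<dots> \<le> - (p * (Re (phi k m) / N - 1))" using Ap_int_ge[OF m] by simp
    also have "phi k m = (1/2) * phi k F + (1/2) * phi k (\<lambda>z. F (u * z))"
      unfolding m_def by (rule phi_linear[OF p q F_Ap R(1) k_Ap])
    also have "- (p * (Re ((1/2) * phi k F + (1/2) * phi k (\<lambda>z. F (u * z))) / N - 1)) = p / (2 * N) * (N - Re (X u))"
      unfolding phi_F phi_rotate[OF u] using N_pos by (simp add: field_simps)
    finally show "c0 * (\<integral>z. quad u z \<partial>area) \<le> p / (2 * N) * (N - Re (X u))" .
  qed
  have "(\<integral>z. quad u z \<partial>area) \<le> p / (4 * N * c0) * (norm \<Lambda> + 2 * C') * (norm (u - 1))\<^sup>2" if u: "norm u = 1" for u
  proof -
    have u': "norm (cnj u) = 1" using u by simp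
    have uu: "cnj u * u = 1" using u by (simp add: mult.commute complex_norm_square[symmetric])
    \<comment> \<open>Substituting u z exchanges the two points that are compared, so u and its
      conjugate give the same integral.\<close>
    have "quad (cnj u) (u * z) = quad u z" for z
      using uu by (simp add: quad_def mult.assoc[symmetric] norm_minus_commute add.commute)
    then have sym: "(\<integral>z. quad u z \<partial>area) = (\<integral>z. quad (cnj u) z \<partial>area)"
      using integral_area_rotate(1)[OF u measurable_quad[OF u']] by simp
    have NX: "N - Re (X v) \<le> - Re ((v - 1) * \<Lambda>) + C' * (norm (v - 1))\<^sup>2" if v: "norm v = 1" for v
    proof -
      have "of_real N - X v = - ((v - 1) * \<Lambda>) - (v - 1) * (dquot c d v - \<Lambda>)"
        using X_minus_N[of v] by (simp add: algebra_simps)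
      then have "N - Re (X v) = Re (- ((v - 1) * \<Lambda>) - (v - 1) * (dquot c d v - \<Lambda>))"
        by (metis Re_complex_of_real minus_complex.sel(1))
      also have "\<dots> = - Re ((v - 1) * \<Lambda>) - Re ((v - 1) * (dquot c d v - \<Lambda>))" by simp
      also have "\<dots> \<le> - Re ((v - 1) * \<Lambda>) + norm ((v - 1) * (dquot c d v - \<Lambda>))"
        using abs_Re_le_cmod[of "(v - 1) * (dquot c d v - \<Lambda>)"] by linarith
      also have "\<dots> \<le> - Re ((v - 1) * \<Lambda>) + norm (v - 1) * (C' * norm (v - 1))"
        unfolding norm_mult \<Lambda>_def using v by (intro add_left_mono mult_left_mono C'(2)) auto
      finally show ?thesis by (simp add: power2_eq_square ac_simps)
    qed
    have n2: "(norm (u - 1))\<^sup>2 = 2 - 2 * Re u"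
    proof -
      have "(norm (u - 1))\<^sup>2 = (norm u)\<^sup>2 - 2 * Re u + 1"
        unfolding cmod_power2 by (simp add: power2_eq_square algebra_simps)
      then show ?thesis using u by simp
    qed
    have nc: "norm (cnj u - 1) = norm (u - 1)"
      by (metis complex_cnj_diff complex_cnj_one complex_mod_cnj)
    \<comment> \<open>(u - 1) + (conj u - 1) = - |u - 1|^2, which turns the first order terms into a
      second order one.\<close>
    have "- Re ((u - 1) * \<Lambda>) - Re ((cnj u - 1) * \<Lambda>) = (2 - 2 * Re u) * Re \<Lambda>" by (simp add: algebra_simps)
    also have "\<dots> \<le> (norm (u - 1))\<^sup>2 * norm \<Lambda>" unfolding n2[symmetric] by (intro mult_left_mono complex_Re_le_cmod) auto
    finally have "(N - Re (X u)) + (N - Re (X (cnj u))) \<le> (norm \<Lambda> + 2 * C') * (norm (u - 1))\<^sup>2"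
      using NX[OF u] NX[OF u'] nc by (simp add: algebra_simps)
    then have "p / (2 * N) * ((N - Re (X u)) + (N - Re (X (cnj u)))) \<le> p / (2 * N) * ((norm \<Lambda> + 2 * C') * (norm (u - 1))\<^sup>2)"
      using p N_pos by (intro mult_left_mono) auto
    moreover have "2 * (c0 * (\<integral>z. quad u z \<partial>area)) \<le> p / (2 * N) * ((N - Re (X u)) + (N - Re (X (cnj u))))"
      using one(2)[OF u] one(2)[OF u'] sym unfolding distrib_left by simp
    ultimately have "2 * (c0 * (\<integral>z. quad u z \<partial>area)) \<le> p / (2 * N) * ((norm \<Lambda> + 2 * C') * (norm (u - 1))\<^sup>2)" by linarith
    then show ?thesis using c0(1) N_pos by (simp add: field_simps)
  qed
  moreover have "0 \<le> p / (4 * N * c0) * (norm \<Lambda> + 2 * C')" using p N_pos c0 C' by (intro mult_nonneg_nonneg) auto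
  ultimately show ?thesis using one(1) by blast
qed

text \<open>The integrand is at most s^(p-1) e with s = |F| + |F_u| and e = |F - F_u|. It factors
  into the root of \<open>quad\<close> and s^(p/2), whose square is controlled by the p-th powers of
  F and F_u; these have equal integrals over the annulus.\<close>

lemma ann_quotient_bound:
  assumes C: "\<And>u. norm u = 1 \<Longrightarrow> integrable area (quad u)" "\<And>u. norm u = 1 \<Longrightarrow> (\<integral>z. quad u z \<partial>area) \<le> C * (norm (u - 1))\<^sup>2"
    and u: "norm u = 1" "u \<noteq> 1" and \<rho>: "\<rho> \<le> 1" and \<eta>: "0 < \<eta>"
  shows "norm (LINT z:ann \<rho>|area. dual_unit p (F z) * (F (u * z) - F z))
    \<le> norm (u - 1) * ((\<eta> * C + 2 powr p * (ann_int p F \<rho>) / \<eta>) / 2)"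
proof -
  define \<delta> where "\<delta> = norm (u - 1)"
  have \<delta>: "0 < \<delta>" using u by (simp add: \<delta>_def)
  define T where "T = (ann_int p F \<rho>)"
  note R = in_Ap_rotate(1)[OF u(1) F_Ap]
  have rot: "(LINT z:ann \<rho>|area. norm (F (u * z)) powr p) = T"
  proof -
    have "(\<lambda>z. indicator (ann \<rho>) z *\<^sub>R (norm (F z) powr p)) \<in> borel_measurable area"
      using in_ApD(3)[OF F_Ap] by (intro borel_measurable_scaleR) auto
    from integral_area_rotate(1)[OF u(1) this]
    have "(\<integral>z. indicator (ann \<rho>) (u * z) *\<^sub>R (norm (F (u * z)) powr p) \<partial>area) = T"
      by (simp add: T_def set_lebesgue_integral_def)
    moreover have "indicator (ann \<rho>) (u * z) = (indicator (ann \<rho>) z :: real)" for z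
      using u by (simp add: indicator_def ann_def norm_mult)
    ultimately show ?thesis by (simp add: set_lebesgue_integral_def)
  qed
  define B where "B z = (\<eta> / (2 * \<delta>)) * quad u z + (\<delta> * 2 powr (p - 1) / (2 * \<eta>)) *
      (indicator (ann \<rho>) z * norm (F z) powr p + indicator (ann \<rho>) z * norm (F (u * z)) powr p)" for z
  have pt: "norm (indicator (ann \<rho>) z *\<^sub>R (dual_unit p (F z) * (F (u * z) - F z))) \<le> B z" for z
  proof (cases "z \<in> ann \<rho>")
    case False
    then show ?thesis using \<delta> \<eta> by (simp add: B_def quad_def)
  next
    case True
    define s where "s = norm (F z) + norm (F (u * z))"
    define e where "e = norm (F z - F (u * z))"
    have s: "0 \<le> s" "0 \<le> e" by (auto simp: s_def e_def)
    have "norm (dual_unit p (F z) * (F (u * z) - F z)) \<le> s powr (p - 1) * e"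
      unfolding norm_mult norm_dual_unit e_def s_def norm_minus_commute[of "F (u * z)"]
      using p by (intro mult_right_mono powr_mono2) auto
    also have "s powr (p - 1) * e = (s powr ((p - 2) / 2) * e) * s powr (p / 2)"
    proof -
      have "s powr (p - 1) = s powr ((p - 2) / 2) * s powr (p / 2)"
      proof -
        have "(p - 2) / 2 + p / 2 = p - 1" by (simp add: field_simps)
        then show ?thesis by (simp flip: powr_add)
      qed
      then show ?thesis by simp
    qed
    \<comment> \<open>The weights are balanced so that both terms are of order \<delta>, as the
      integral of \<open>quad\<close> is of order \<delta>^2. The free \<eta> trades the constant C
      against the annular integral.\<close>
    also have "\<dots> \<le> (\<eta> / (2 * \<delta>)) * (s powr ((p - 2) / 2) * e)\<^sup>2 + (\<delta> / (2 * \<eta>)) * (s powr (p / 2))\<^sup>2"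
    proof -
      define x y where "x = s powr ((p - 2) / 2) * e" and "y = s powr (p / 2)"
      have "0 \<le> (\<eta> * x - \<delta> * y)\<^sup>2" by simp
      then have "2 * \<eta> * \<delta> * (x * y) \<le> \<eta>\<^sup>2 * x\<^sup>2 + \<delta>\<^sup>2 * y\<^sup>2" by (simp add: power2_eq_square algebra_simps)
      then have "x * y \<le> (\<eta>\<^sup>2 * x\<^sup>2 + \<delta>\<^sup>2 * y\<^sup>2) / (2 * \<eta> * \<delta>)" using \<eta> \<delta> by (simp add: pos_le_divide_eq mult.commute)
      also have "\<dots> = (\<eta> / (2 * \<delta>)) * x\<^sup>2 + (\<delta> / (2 * \<eta>)) * y\<^sup>2" using \<eta> \<delta> by (simp add: field_simps power2_eq_square)
      finally show ?thesis by (simp add: x_def y_def)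
    qed
    also have "(s powr ((p - 2) / 2) * e)\<^sup>2 = quad u z"
      by (simp add: power_mult_distrib quad_def s_def[symmetric] e_def[symmetric] power2_eq_square[of "s powr _"] flip: powr_add)
    also have "(s powr (p / 2))\<^sup>2 = s powr p" by (simp add: power2_eq_square flip: powr_add)
    also have "(\<eta> / (2 * \<delta>)) * quad u z + (\<delta> / (2 * \<eta>)) * s powr p
       \<le> (\<eta> / (2 * \<delta>)) * quad u z + (\<delta> / (2 * \<eta>)) * (2 powr (p - 1) * (norm (F z) powr p + norm (F (u * z)) powr p))"
      using \<delta> \<eta> p unfolding s_def by (intro add_left_mono mult_left_mono powr_add_le) auto
    finally show ?thesis using True by (simp add: B_def)
  qed
  have i1: "integrable area (\<lambda>z. indicator (ann \<rho>) z * norm (F z) powr p)"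
     "integrable area (\<lambda>z. indicator (ann \<rho>) z * norm (F (u * z)) powr p)"
    using integral_area_split(3)[OF in_ApD(3)[OF F_Ap] \<rho>] integral_area_split(3)[OF in_ApD(3)[OF R] \<rho>]
    by (simp_all add: set_integrable_def)
  have iB: "integrable area B" unfolding B_def[abs_def] using C(1)[OF u(1)] i1 by auto
  have "norm (LINT z:ann \<rho>|area. dual_unit p (F z) * (F (u * z) - F z)) \<le> (\<integral>z. norm (indicator (ann \<rho>) z *\<^sub>R (dual_unit p (F z) * (F (u * z) - F z))) \<partial>area)"
    unfolding set_lebesgue_integral_def by (rule integral_norm_bound)
  also have "\<dots> \<le> (\<integral>z. B z \<partial>area)"
    by (rule integral_mono'[OF iB pt]) (rule order_trans[OF norm_ge_zero pt])
  also have "\<dots> = (\<eta> / (2 * \<delta>)) * (\<integral>z. quad u z \<partial>area) + (\<delta> * 2 powr (p - 1) / (2 * \<eta>)) * (T + T)"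
    unfolding B_def using C(1)[OF u(1)] i1 rot by (simp add: T_def set_lebesgue_integral_def)
  also have "\<dots> \<le> (\<eta> / (2 * \<delta>)) * (C * \<delta>\<^sup>2) + (\<delta> * 2 powr (p - 1) / (2 * \<eta>)) * (T + T)"
    using C(2)[OF u(1)] \<eta> \<delta> by (intro add_right_mono mult_left_mono) (auto simp: \<delta>_def)
  also have "\<dots> = \<delta> * ((\<eta> * C + 2 powr p * T / \<eta>) / 2)"
    using \<delta> \<eta> by (simp add: field_simps power2_eq_square powr_diff)
  finally show ?thesis by (simp add: \<delta>_def T_def)
qed

text \<open>The Euler-Lagrange equation for (F_u - F) / (u - 1) is split at radius \<rho>. On the
  ball the quotient converges and \<open>dilation_derivative_le\<close> bounds its limit by the
  Hardy norm; the rest is estimated by \<open>ann_quotient_bound\<close>.\<close>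

lemma Hp_norm_lower_bound:
  assumes F: "in_Hp p F"
  shows "1 + p / (2 * N) * Re (dquot c d 1) \<le> Hp_norm p F powr p"
proof -
  define M where "M = Hp_norm p F powr p"
  define \<Lambda> where "\<Lambda> = dquot c d 1"
  obtain C where C: "C \<ge> 0" "\<And>u. norm u = 1 \<Longrightarrow> integrable area (quad u)"
      "\<And>u. norm u = 1 \<Longrightarrow> (\<integral>z. quad u z \<partial>area) \<le> C * (norm (u - 1))\<^sup>2"
    using quad_bound by blast
  define T where "T \<rho> = (ann_int p F \<rho>)" for \<rho>
  define \<theta> where "\<theta> n = inverse (real (Suc n))" for n
  define u where "u n = cis (\<theta> n)" for n
  have u1: "norm (u n) = 1" for n by (simp add: u_def)
  have u2: "u n \<noteq> 1" for n
  proof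
    assume "u n = 1"
    then have "sin (\<theta> n) = 0" by (auto simp: u_def complex_eq_iff)
    moreover have "\<theta> n \<le> 1" "0 < \<theta> n" by (auto simp: \<theta>_def field_simps)
    moreover from this have "\<theta> n < pi" using pi_gt3 by linarith
    ultimately show False using sin_gt_zero by fastforce
  qed
  have u3: "u \<longlonglongrightarrow> 1"
  proof -
    have "(\<lambda>n. cis (\<theta> n)) \<longlonglongrightarrow> cis 0"
      unfolding \<theta>_def by (intro tendsto_cis LIMSEQ_inverse_real_of_nat)
    then show ?thesis by (simp add: u_def[abs_def])
  qed
  \<comment> \<open>The limit u -> 1 for fixed \<rho> and \<eta>. It has to precede \<rho> -> 1,
    since the derivative is controlled only inside the disc.\<close>
  have main: "p / (2 * N) * Re \<Lambda> \<le> M - 1 + T \<rho> + p / 4 * (\<eta> * C + 2 powr p * T \<rho> / \<eta>)"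
    if \<rho>: "0 < \<rho>" "\<rho> < 1" and \<eta>: "0 < \<eta>" for \<rho> \<eta>
  proof -
    define G where "G z = F (of_real \<rho> * z)" for z
    have \<rho>': "0 < \<rho>" "\<rho> \<le> 1" using \<rho> by auto
    have G: "in_Ap p G" unfolding G_def by (intro in_Ap_dilate(1) \<rho>' F_Ap)
    define J where "J n = (\<integral>z. dual_unit p (G z) * ((F (of_real \<rho> * (u n * z)) - F (of_real \<rho> * z)) / (u n - 1)) \<partial>area)" for n
    define J0 where "J0 = (\<integral>z. dual_unit p (G z) * (of_real \<rho> * z * deriv F (of_real \<rho> * z)) \<partial>area)"
    obtain B where B: "\<And>w. norm w \<le> \<rho> \<Longrightarrow> norm (F w) \<le> B"
      using bounded_on_cball[OF holomorphic_on_imp_continuous_on[OF F_hol] \<rho>(2)] by metis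
    have GB: "norm (dual_unit p (G z)) \<le> B powr (p - 1)" if "z \<in> disc" for z
      unfolding norm_dual_unit G_def using that \<rho> p mult_left_le[of "norm z" \<rho>]
      by (intro powr_mono2 B) (auto simp: mem_disc norm_mult)
    have lim: "J \<longlonglongrightarrow> J0"
      unfolding J_def[abs_def] J0_def
      by (rule dilation_quotient_limit[where b="\<lambda>n z. dual_unit p (G z)" and B="B powr (p - 1)"])
        (use F_hol \<rho> u1 u2 u3 GB in \<open>auto intro!: borel_measurable_dual_unit p in_ApD(2)[OF G]\<close>)
    have J: "norm (dquot c d (u n) / of_real N - of_real (\<rho>\<^sup>2) * J n) \<le> (\<eta> * C + 2 powr p * T \<rho> / \<eta>) / 2" for n
    proof -
      note R = in_Ap_rotate(1)[OF u1[of n] F_Ap]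
      have D: "in_Ap p (\<lambda>z. F (u n * z) - F z)" using p by (intro in_Ap_diff R F_Ap) auto
      define H where "H z = dual_unit p (F z) * (F (u n * z) - F z)" for z
      have iH: "integrable area H" unfolding H_def[abs_def] by (rule variational_inequality(1)[OF D])
      have "integral\<^sup>L area H = phi k (\<lambda>z. F (u n * z) - F z) / of_real N"
        unfolding H_def[abs_def] by (rule euler_lagrange[OF D])
      also have "phi k (\<lambda>z. F (u n * z) - F z) = (u n - 1) * dquot c d (u n)"
        using phi_diff[OF p q R F_Ap k_Ap] by (simp add: phi_rotate[OF u1] phi_F X_minus_N)
      finally have e1: "integral\<^sup>L area H = (u n - 1) * (dquot c d (u n) / of_real N)" by simp
      have "(LINT z:ball 0 \<rho>|area. H z) = \<rho>\<^sup>2 *\<^sub>R (\<integral>z. H (of_real \<rho> * z) \<partial>area)"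
        using iH by (intro integral_area_dilate(1)[symmetric] \<rho>') auto
      also have "(\<integral>z. H (of_real \<rho> * z) \<partial>area) = (u n - 1) * J n"
        unfolding J_def integral_mult_right_zero[symmetric] using u2[of n]
        by (intro Bochner_Integration.integral_cong refl) (simp add: H_def G_def ac_simps)
      finally have e2: "(LINT z:ball 0 \<rho>|area. H z) = (u n - 1) * (of_real (\<rho>\<^sup>2) * J n)"
        by (simp add: scaleR_conv_of_real ac_simps)
      have "(u n - 1) * (dquot c d (u n) / of_real N - of_real (\<rho>\<^sup>2) * J n) = (LINT z:ann \<rho>|area. H z)"
        using integral_area_split(1)[OF iH \<rho>'(2)] e1 e2 by (simp add: right_diff_distrib)
      then have "norm (u n - 1) * norm (dquot c d (u n) / of_real N - of_real (\<rho>\<^sup>2) * J n) = norm (LINT z:ann \<rho>|area. H z)"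
        by (metis norm_mult)
      also have "\<dots> \<le> norm (u n - 1) * ((\<eta> * C + 2 powr p * T \<rho> / \<eta>) / 2)"
        unfolding H_def T_def by (rule ann_quotient_bound[OF C(2,3) u1 u2 \<rho>'(2) \<eta>])
      finally show ?thesis using u2[of n] by (subst (asm) mult_le_cancel_left_pos) auto
    qed
    have "(\<lambda>n. dquot c d (u n)) \<longlonglongrightarrow> \<Lambda>"
      unfolding \<Lambda>_def by (rule isCont_tendsto_compose[OF continuous_dquot u3])
    then have "(\<lambda>n. norm (dquot c d (u n) / of_real N - of_real (\<rho>\<^sup>2) * J n)) \<longlonglongrightarrow> norm (\<Lambda> / of_real N - of_real (\<rho>\<^sup>2) * J0)"
      using N_pos by (intro tendsto_intros lim) auto
    then have "norm (\<Lambda> / of_real N - of_real (\<rho>\<^sup>2) * J0) \<le> (\<eta> * C + 2 powr p * T \<rho> / \<eta>) / 2"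
      by (rule LIMSEQ_le_const2) (use J in blast)
    then have "Re (\<Lambda> / of_real N - of_real (\<rho>\<^sup>2) * J0) \<le> (\<eta> * C + 2 powr p * T \<rho> / \<eta>) / 2"
      using complex_Re_le_cmod order_trans by blast
    moreover have "Re (\<Lambda> / of_real N - of_real (\<rho>\<^sup>2) * J0) = Re \<Lambda> / N - \<rho>\<^sup>2 * Re J0"
      by (simp add: Re_divide_of_real)
    ultimately have "Re \<Lambda> / N \<le> \<rho>\<^sup>2 * Re J0 + (\<eta> * C + 2 powr p * T \<rho> / \<eta>) / 2"
      by (simp only: diff_le_eq add.commute)
    then have "p / 2 * (Re \<Lambda> / N) \<le> p / 2 * (\<rho>\<^sup>2 * Re J0 + (\<eta> * C + 2 powr p * T \<rho> / \<eta>) / 2)"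
      using p by (intro mult_left_mono) auto
    moreover have "p / 2 * (\<rho>\<^sup>2 * Re J0 + R / 2) = \<rho>\<^sup>2 * (p * Re J0) / 2 + p / 4 * R" for R
      by (simp add: field_simps)
    moreover have "p / 2 * (Re \<Lambda> / N) = p / (2 * N) * Re \<Lambda>" by simp
    ultimately have 1: "p / (2 * N) * Re \<Lambda> \<le> \<rho>\<^sup>2 * (p * Re J0) / 2 + p / 4 * (\<eta> * C + 2 powr p * T \<rho> / \<eta>)"
      by (simp only:)
    have "p * Re J0 \<le> 2 * (M - Ap_int p G)"
      using dilation_derivative_le[OF p F \<rho>] by (simp add: J0_def M_def G_def[abs_def])
    then have "\<rho>\<^sup>2 * (p * Re J0) \<le> \<rho>\<^sup>2 * (2 * (M - Ap_int p G))" by (intro mult_left_mono) auto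
    moreover have "\<rho>\<^sup>2 * Ap_int p G = 1 - T \<rho>"
      using in_Ap_dilate(2)[OF \<rho>' F_Ap] integral_area_split(1)[OF in_ApD(3)[OF F_Ap] \<rho>'(2)] Ap_int_F
      by (simp add: G_def[abs_def] T_def Ap_int_def)
    moreover have "\<rho>\<^sup>2 * M \<le> 1 * M" using \<rho> by (intro mult_right_mono power_le_one) (auto simp: M_def)
    ultimately have "\<rho>\<^sup>2 * (p * Re J0) / 2 \<le> M - 1 + T \<rho>" by (simp add: right_diff_distrib)
    with 1 show ?thesis by linarith
  qed
  have Tl: "(\<lambda>n. T (radius n)) \<longlonglongrightarrow> 0"
  proof (rule tendsto_sandwich[OF _ _ tendsto_const])
    have "(\<lambda>n. (1 - (radius n)\<^sup>2) * M) \<longlonglongrightarrow> (1 - 1\<^sup>2) * M"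
      by (intro tendsto_intros radius_tendsto)
    then show "(\<lambda>n. (1 - (radius n)\<^sup>2) * M) \<longlonglongrightarrow> 0" by simp
    show "\<forall>\<^sub>F n in sequentially. T (radius n) \<le> (1 - (radius n)\<^sup>2) * M"
    proof (intro always_eventually allI)
      fix n
      have r: "0 \<le> radius n" "radius n < 1" using radius_pos[of n] radius(2)[of n] by auto
      show "T (radius n) \<le> (1 - (radius n)\<^sup>2) * M"
        unfolding T_def M_def
        using p F_hol by (intro ann_integral_upper(2)[OF _ _ r] circ_mean_le_Hp_norm p F holomorphic_on_imp_continuous_on order_trans[OF r(1)]) auto
    qed
  qed (auto simp: T_def set_lebesgue_integral_def)
  \<comment> \<open>\<rho> -> 1 comes before \<eta> -> 0: the annular integral T is divided by
    \<eta>, so it must have vanished already.\<close>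
  have eta: "p / (2 * N) * Re \<Lambda> \<le> M - 1 + p / 4 * (\<eta> * C)" if \<eta>: "0 < \<eta>" for \<eta>
  proof (rule LIMSEQ_le_const)
    have "(\<lambda>n. M - 1 + T (radius n) + p / 4 * (\<eta> * C + 2 powr p * T (radius n) / \<eta>))
      \<longlonglongrightarrow> M - 1 + 0 + p / 4 * (\<eta> * C + 2 powr p * 0 / \<eta>)"
      using \<eta> by (intro tendsto_intros Tl) auto
    then show "(\<lambda>n. M - 1 + T (radius n) + p / 4 * (\<eta> * C + 2 powr p * T (radius n) / \<eta>))
      \<longlonglongrightarrow> M - 1 + p / 4 * (\<eta> * C)" by simp
    show "\<exists>n0. \<forall>n\<ge>n0. p / (2 * N) * Re \<Lambda> \<le> M - 1 + T (radius n) + p / 4 * (\<eta> * C + 2 powr p * T (radius n) / \<eta>)"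
      by (intro exI allI impI main \<eta> radius_pos radius)
  qed
  have "p / (2 * N) * Re \<Lambda> \<le> M - 1 + p / 4 * (0 * C)"
  proof (rule LIMSEQ_le_const)
    show "(\<lambda>n. M - 1 + p / 4 * (inverse (real (Suc n)) * C)) \<longlonglongrightarrow> M - 1 + p / 4 * (0 * C)"
      by (intro tendsto_intros LIMSEQ_inverse_real_of_nat)
    show "\<exists>n0. \<forall>n\<ge>n0. p / (2 * N) * Re \<Lambda> \<le> M - 1 + p / 4 * (inverse (real (Suc n)) * C)"
      by (intro exI allI impI eta) auto
  qed
  then show ?thesis by (simp add: M_def \<Lambda>_def)
qed

end

section \<open>Upper bound along the sequence and norm convergence\<close>

context extremal_sequence
begin

lemma phi_fixed_kernel_tendsto:
  assumes g: "in_Ap q g"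
  shows "(\<lambda>n. phi g (Fn n)) \<longlonglongrightarrow> phi g F"
proof -
  have "(\<lambda>n. Ap_int p (\<lambda>z. Fn n z - F z) powr (1 / p)) \<longlonglongrightarrow> 0 powr (1 / p)"
    by (rule tendsto_powr'[OF Ap_convergence tendsto_const]) (use p in simp)
  then have "(\<lambda>n. Ap_int p (\<lambda>z. Fn n z - F z) powr (1 / p) * Ap_int q g powr (1 / q)) \<longlonglongrightarrow> 0"
    unfolding powr_0 by (rule tendsto_mult_left_zero)
  then have "(\<lambda>n. phi g (\<lambda>z. Fn n z - F z)) \<longlonglongrightarrow> 0"
    by (rule Lim_null_comparison[rotated]) (intro always_eventually allI phi_bound(2)[OF p q diff_Ap g])
  then show ?thesis by (simp add: phi_diff[OF p q Fn_Ap(1) lim.F_Ap g] LIM_zero_iff)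
qed

text \<open>The kernel is split as k + (kn n - k), so only the fixed degree of k occurs. For k the
  effect of a dilation is computed exactly through \<open>dquot\<close>; for the remainder
  \<open>phi_minus_dilate_bound\<close> gives (1 - r) times a multiple of \<kappa> n, because the
  Hardy bound B makes the annular integral of order 1 - r.\<close>

lemma Fn_Hp_norm_upper_bound:
  assumes k_poly: "\<And>z. z \<in> disc \<Longrightarrow> k z = (\<Sum>j\<le>d. b j * z ^ j)"
    and B: "Hp_norm p (Fn n) powr p \<le> B"
  defines "c \<equiv> \<lambda>j. cnj (b j) * phi (\<lambda>z. z ^ j) (Fn n)"
  shows "Hp_norm p (Fn n) powr p \<le> 1 + p / (2 * Nn n) * (Re (dquot c d 1) + ((2 * B) powr (1 / p) + 4) * \<kappa> n)"
proof -
  \<comment> \<open>2 B comes from 1 - r^2 <= 2 (1 - r) in the annular integral, and 4 from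
    \<open>phi_minus_dilate_bound\<close>.\<close>
  define D where "D = (2 * B) powr (1 / p) + 4"
  have B0: "0 \<le> B" using B powr_ge_zero order_trans by blast
  have l: "in_Hp q (\<lambda>z. kn n z - k z)" by (intro in_Hp_diff q_gt_1 kn_Hq k_Hq)
  have pq: "1 / p + 1 / q = 1" unfolding q using p by (simp add: field_simps)
  \<comment> \<open>Dividing by 1 - r^2 turns r^2 (1 - r) into r^2 / (1 + r), which tends to 1/2 as
    r tends to 1.\<close>
  define E where "E r = 1 + r\<^sup>2 / (1 + r) * (p / Nn n) * (Re (dquot c d (of_real r)) + D * \<kappa> n)" for r
  have le: "circ_mean p (Fn n) r \<le> E r" if r: "1/2 \<le> r" "r < 1" for r
  proof -
    have r': "0 < r" "r \<le> 1" "0 \<le> r" using r by auto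
    define f where "f z = Fn n (of_real r * z)" for z
    have f: "in_Ap p f" unfolding f_def by (intro in_Ap_dilate(1) r' Fn_Ap)
    define T where "T = (ann_int p (Fn n) r)"
    have "T \<le> (1 - r\<^sup>2) * B"
      unfolding T_def using r p in_HpD[OF _ Fn_Hp, of n]
      by (intro ann_integral_upper(2) order_trans[OF circ_mean_le_Hp_norm[OF p Fn_Hp] B]) auto
    also have "\<dots> = (1 - r) * ((1 + r) * B)" by (simp add: power2_eq_square algebra_simps)
    also have "\<dots> \<le> (1 - r) * (2 * B)" using r B0 by (intro mult_left_mono mult_right_mono) auto
    finally have "T powr (1 / p) \<le> ((1 - r) * (2 * B)) powr (1 / p)"
      using p by (intro powr_mono2) (auto simp: T_def set_lebesgue_integral_def)
    also have "\<dots> = (1 - r) powr (1 / p) * (2 * B) powr (1 / p)" using r B0 by (simp add: powr_mult)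
    finally have "T powr (1 / p) * (1 - r) powr (1 / q) \<le> (1 - r) powr (1 / p) * (2 * B) powr (1 / p) * (1 - r) powr (1 / q)"
      by (intro mult_right_mono) auto
    also have "\<dots> = (1 - r) powr (1 / p + 1 / q) * (2 * B) powr (1 / p)" by (simp add: powr_add ac_simps)
    also have "\<dots> = (1 - r) * (2 * B) powr (1 / p)" using r by (simp add: pq)
    finally have T: "T powr (1 / p) * (1 - r) powr (1 / q) + 4 * (1 - r) \<le> (1 - r) * D" by (simp add: D_def algebra_simps)
    have "norm (phi (\<lambda>z. kn n z - k z) (Fn n) - phi (\<lambda>z. kn n z - k z) f)
       \<le> (T powr (1 / p) * (1 - r) powr (1 / q) + 4 * (1 - r) * Ap_int p (Fn n) powr (1 / p)) * \<kappa> n"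
      unfolding f_def T_def \<kappa>_def by (rule phi_minus_dilate_bound[OF p q Fn_Ap(1) l r])
    also have "\<dots> \<le> ((1 - r) * D) * \<kappa> n" using T \<kappa>_nonneg[of n] by (intro mult_right_mono) (auto simp: Fn_Ap)
    finally have 1: "norm (phi (\<lambda>z. kn n z - k z) (Fn n) - phi (\<lambda>z. kn n z - k z) f) \<le> (1 - r) * (D * \<kappa> n)" by (simp add: ac_simps)
    have 2: "phi k (Fn n) - phi k f = of_real (1 - r) * dquot c d (of_real r)"
    proof -
      have "phi k f = (\<Sum>j\<le>d. cnj (b j) * phi (\<lambda>z. z ^ j) f)" by (rule phi_polynomial[OF p f k_poly])
      also have "\<dots> = (\<Sum>j\<le>d. c j * of_real r ^ j)"
        unfolding f_def phi_power_dilate[OF p Fn_Ap(1) r'(1,2)] c_def by (simp add: ac_simps)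
      finally have "phi k f = (\<Sum>j\<le>d. c j * of_real r ^ j)" .
      moreover have "phi k (Fn n) = (\<Sum>j\<le>d. c j)"
        unfolding c_def by (rule phi_polynomial[OF p Fn_Ap(1) k_poly])
      ultimately show ?thesis using dquot[of c "of_real r" d] by (simp add: algebra_simps)
    qed
    have "phi (kn n) (Fn n) - phi (kn n) f = (phi k (Fn n) - phi k f) + (phi (\<lambda>z. kn n z - k z) (Fn n) - phi (\<lambda>z. kn n z - k z) f)"
      by (simp add: phi_kernel_diff[OF p q Fn_Ap(1) kn_Ap k_Ap] phi_kernel_diff[OF p q f kn_Ap k_Ap])
    then have "Re (phi (kn n) (Fn n) - phi (kn n) f) = (1 - r) * Re (dquot c d (of_real r)) + Re (phi (\<lambda>z. kn n z - k z) (Fn n) - phi (\<lambda>z. kn n z - k z) f)"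
      unfolding 2 by simp
    also have "\<dots> \<le> (1 - r) * Re (dquot c d (of_real r)) + (1 - r) * (D * \<kappa> n)"
      using complex_Re_le_cmod order_trans[OF _ 1] by (intro add_left_mono) blast
    finally have 3: "Re (phi (kn n) (Fn n) - phi (kn n) f) \<le> (1 - r) * (Re (dquot c d (of_real r)) + D * \<kappa> n)"
      by (simp add: distrib_left)
    have "(1 - r\<^sup>2) * circ_mean p (Fn n) r \<le> T"
      unfolding T_def using extremal_problem.circ_mean_le_ann_integral[OF seq] r by auto
    also have "\<dots> \<le> (1 - r\<^sup>2) + r\<^sup>2 * (p / Nn n) * Re (phi (kn n) (Fn n) - phi (kn n) f)"
      unfolding T_def f_def Nn_def using extremal_problem.ann_integral_le[OF seq] r by auto
    also have "\<dots> \<le> (1 - r\<^sup>2) + r\<^sup>2 * (p / Nn n) * ((1 - r) * (Re (dquot c d (of_real r)) + D * \<kappa> n))"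
      using p Nn_pos[of n] by (intro add_left_mono mult_left_mono 3) auto
    also have "\<dots> = (1 - r\<^sup>2) * E r"
    proof -
      have "(1 - r\<^sup>2) / (1 + r) = 1 - r" using r by (simp add: field_simps power2_eq_square)
      moreover have "(1 - r\<^sup>2) * (1 + r\<^sup>2 / (1 + r) * x * y) = (1 - r\<^sup>2) + r\<^sup>2 * x * ((1 - r\<^sup>2) / (1 + r) * y)" for x y
        by (simp add: distrib_left)
      ultimately show ?thesis by (simp only: E_def)
    qed
    finally show ?thesis
      using r abs_square_less_1[of r] by (subst (asm) mult_le_cancel_left_pos) auto
  qed
  have "(\<lambda>m. complex_of_real (radius m)) \<longlonglongrightarrow> 1" using tendsto_of_real[OF radius_tendsto] by simp
  then have dl: "(\<lambda>m. dquot c d (of_real (radius m))) \<longlonglongrightarrow> dquot c d 1"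
    by (rule isCont_tendsto_compose[OF continuous_dquot])
  have "(\<lambda>m. E (radius m)) \<longlonglongrightarrow> 1 + 1\<^sup>2 / (1 + 1) * (p / Nn n) * (Re (dquot c d 1) + D * \<kappa> n)"
    unfolding E_def by (intro tendsto_intros radius_tendsto dl) auto
  then have El: "(\<lambda>m. E (radius m)) \<longlonglongrightarrow> 1 + p / (2 * Nn n) * (Re (dquot c d 1) + D * \<kappa> n)" by simp
  have "circ_mean p (Fn n) r \<le> 1 + p / (2 * Nn n) * (Re (dquot c d 1) + D * \<kappa> n)" if r: "0 < r" "r < 1" for r
  proof (rule LIMSEQ_le_const[OF El])
    have "\<forall>\<^sub>F m in sequentially. r < radius m" using order_tendstoD(1)[OF radius_tendsto r(2)] .
    then obtain m0 where m0: "\<And>m. m0 \<le> m \<Longrightarrow> r < radius m" by (auto simp: eventually_sequentially)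
    have "circ_mean p (Fn n) r \<le> E (radius m)" if "m0 \<le> m" for m
      using m0[OF that] r radius[of m] in_ApD(1)[OF Fn_Ap(1)]
      by (intro order_trans[OF circ_mean_mono[OF p, of "Fn n" r "radius m"] le]) auto
    then show "\<exists>m0. \<forall>m\<ge>m0. circ_mean p (Fn n) r \<le> E (radius m)" by blast
  qed
  then show ?thesis
    unfolding D_def[symmetric] using in_ApD(1)[OF Fn_Ap(1)] by (intro Hp_norm_powr_le p) auto
qed

text \<open>The upper bounds for the norms of F n converge to exactly the lower bound for the norm
  of F, so the norms cannot exceed that of F in the limit; with convergence on circles the
  Radon-Riesz argument applies.\<close>

lemma norm_convergence:
  assumes poly: "is_poly_on_disc k"
  shows "(\<lambda>n. Hp_norm p (\<lambda>z. Fn n z - F z)) \<longlonglongrightarrow> 0"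
proof -
  obtain P where P: "\<And>z. z \<in> disc \<Longrightarrow> k z = poly P z" using poly by (auto simp: is_poly_on_disc_def)
  define d b where "d = degree P" and "b = coeff P"
  have k_poly: "k z = (\<Sum>j\<le>d. b j * z ^ j)" if "z \<in> disc" for z
    using P[OF that] by (simp add: poly_altdef d_def b_def)
  interpret P: polynomial_extremal_problem p q k F b d
    by standard (rule k_poly)
  obtain B where B: "\<And>n. Hp_norm p (Fn n) powr p \<le> B" using Fn_Hp_bounded by blast
  define c where "c n j = cnj (b j) * phi (\<lambda>z. z ^ j) (Fn n)" for n j
  have ql: "in_Ap q (\<lambda>z. z ^ j)" for j using q_gt_1 by (intro in_Ap_power) auto
  \<comment> \<open>At 1 the divided difference is a finite sum of pairings of F n with fixed
    monomials, continuous under A^p convergence.\<close>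
  have "(\<lambda>n. dquot (c n) d 1) \<longlonglongrightarrow> dquot P.c d 1"
    unfolding dquot_1 c_def P.c_def by (intro tendsto_intros phi_fixed_kernel_tendsto ql)
  then have up: "(\<lambda>n. 1 + p / (2 * Nn n) * (Re (dquot (c n) d 1) + ((2 * B) powr (1 / p) + 4) * \<kappa> n))
      \<longlonglongrightarrow> 1 + p / (2 * lim.N) * (Re (dquot P.c d 1) + ((2 * B) powr (1 / p) + 4) * 0)"
    using lim.N_pos by (intro tendsto_intros Nn_tendsto \<kappa>_tendsto) auto
  have low: "1 + p / (2 * lim.N) * Re (dquot P.c d 1) \<le> Hp_norm p F powr p"
    by (rule P.Hp_norm_lower_bound[OF F_Hp])
  show ?thesis
  proof (rule Hp_norm_diff_tendsto_0[OF p Fn_Hp F_Hp circ_mean_convergence])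
    fix e :: real assume e: "0 < e"
    have "\<forall>\<^sub>F n in sequentially. 1 + p / (2 * Nn n) * (Re (dquot (c n) d 1) + ((2 * B) powr (1 / p) + 4) * \<kappa> n) < Hp_norm p F powr p + e"
      using order_tendstoD(2)[OF up] low e by simp
    then show "\<forall>\<^sub>F n in sequentially. Hp_norm p (Fn n) powr p \<le> Hp_norm p F powr p + e"
    proof eventually_elim
      case (elim n)
      have "Hp_norm p (Fn n) powr p \<le> 1 + p / (2 * Nn n) * (Re (dquot (c n) d 1) + ((2 * B) powr (1 / p) + 4) * \<kappa> n)"
        unfolding c_def by (rule Fn_Hp_norm_upper_bound[OF k_poly B])
      with elim show ?case by linarith
    qed
  qed
qed

end

theorem theorem2p3:
  fixes p q :: real and kn :: "nat \<Rightarrow> complex \<Rightarrow> complex" and k :: "complex \<Rightarrow> complex"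
    and Fn :: "nat \<Rightarrow> complex \<Rightarrow> complex" and F :: "complex \<Rightarrow> complex"
  assumes p: "1 < p" and q: "q = p / (p - 1)"
    and kn_Hq: "\<And>n. in_Hp q (kn n)" and kn_nz: "\<And>n. \<exists>z\<in>disc. kn n z \<noteq> 0"
    and k_Hq: "in_Hp q k" and k_nz: "\<exists>z\<in>disc. k z \<noteq> 0"
    and conv: "(\<lambda>n. Hp_norm q (\<lambda>z. kn n z - k z)) \<longlonglongrightarrow> 0"
    and Fn_ext: "\<And>n. Ap_extremal p (kn n) (Fn n)" and F_ext: "Ap_extremal p k F"
  shows "(\<forall>n. in_Hp p (Fn n)) \<and> in_Hp p F \<and> Hp_weak_conv p Fn F \<and>
         ((is_poly_on_disc k \<and> (\<forall>n. is_poly_on_disc (kn n))) \<longrightarrow>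
            (\<lambda>n. Hp_norm p (\<lambda>z. Fn n z - F z)) \<longlonglongrightarrow> 0)"
proof -
  interpret extremal_sequence p q kn k Fn F
    by standard (fact assms)+
  show ?thesis using Fn_Hp F_Hp weak_convergence norm_convergence by blast
qed

end
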